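(* Let $V:S^1\to\mathbb{R}$ satisfy $V\in L^1(S^1)$, $V\ge0$, and $V$ even, and let $s\ge1$ be a real number. For every sufficiently small $\epsilon>0$ there exists a continuous function $C=C(s,E,M)>0$ of the energy and mass (also allowed to depend on $\epsilon$ and on the fixed potential $V$) such that the following holds. For every $\Phi\in H^s(S^1)$, if $u$ is the global solution of the Hartree equation $$iu_t+\Delta u=(V*|u|^2)u,\quad x\in S^1,\ t\in\mathbb{R},\qquad u(x,0)=\Phi(x),$$ then for all $t\in\mathbb{R}$, $$\|u(t)\|_{H^s}\le C\big(s,E(\Phi),M(\Phi)\big)\,(1+|t|)^{\frac12 s+\epsilon}\,\|\Phi\|_{H^s}.$$
   Context: $S^1=\mathbb{R}/2\pi\mathbb{Z}$; $\widehat f(n)=\int_{S^1}f(x)e^{-inx}dx$; $\langle n\rangle=\sqrt{1+|n|^2}$; $\|f\|_{H^s}=\big(\sum_{n\in\mathbb{Z}}|\widehat f(n)|^2\langle n\rangle^{2s}\big)^{1/2}$; $*$ is convolution in $x$ on $S^1$. For $\Phi\in H^s(S^1)$, $s\ge1$, the equation has a unique global solution $u\in C(\mathbb{R};H^s(S^1))$ (in the sense of Duhamel's formula). The mass and energy are $$M(f)=\int_{S^1}|f|^2dx,\qquad E(f)=\frac12\int_{S^1}|\nabla f|^2dx+\frac14\int_{S^1}(V*|f|^2)|f|^2dx,$$ and are conserved by the flow. *)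

theory Defs
  imports "HOL-Analysis.Analysis" "HOL-Library.Periodic_Fun"
begin

text \<open>
  A function on \<open>S\<^sup>1 = \<real>/2\<pi>\<int>\<close> is a \<open>2\<pi>\<close>-periodic function on the real line, integrated over one
  period with respect to (unnormalised) Lebesgue measure. Elements of \<open>L\<^sup>1\<close>, \<open>H\<^sup>s\<close> are represented by
  arbitrary members of their almost-everywhere classes; everything below depends only on the
  classes.
\<close>

abbreviation on_circle :: "(real \<Rightarrow> 'a) \<Rightarrow> bool" where
  "on_circle f \<equiv> periodic_fun_simple f (2 * pi)"

abbreviation circle_measure :: "real measure" where
  "circle_measure \<equiv> lebesgue_on {0..2 * pi}"

definition L1_circle :: "(real \<Rightarrow> 'a::{banach, second_countable_topology}) set" where
  "L1_circle = {f. on_circle f \<and> integrable circle_measure f}"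

definition fourier_coeff :: "(real \<Rightarrow> complex) \<Rightarrow> int \<Rightarrow> complex" where
  "fourier_coeff f n = (LINT x|circle_measure. f x * exp (- \<i> * of_int n * of_real x))"

definition japanese_bracket :: "int \<Rightarrow> real" where
  "japanese_bracket n = sqrt (1 + (of_int n)\<^sup>2)"

text \<open>For \<open>s \<ge> 0\<close> the space \<open>H\<^sup>s\<close> is contained in \<open>L\<^sup>2\<close>, so its elements are functions.\<close>

definition sobolev_space :: "real \<Rightarrow> (real \<Rightarrow> complex) set" where
  "sobolev_space s = {f. on_circle f \<and> f \<in> borel_measurable circle_measure \<and>
     integrable circle_measure (\<lambda>x. (cmod (f x))\<^sup>2) \<and>
     (\<lambda>n. (cmod (fourier_coeff f n))\<^sup>2 * japanese_bracket n powr (2 * s)) summable_on UNIV}"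

definition sobolev_norm :: "real \<Rightarrow> (real \<Rightarrow> complex) \<Rightarrow> real" where
  "sobolev_norm s f =
     sqrt (\<Sum>\<^sub>\<infinity>n. (cmod (fourier_coeff f n))\<^sup>2 * japanese_bracket n powr (2 * s))"

definition circle_conv :: "(real \<Rightarrow> real) \<Rightarrow> (real \<Rightarrow> real) \<Rightarrow> real \<Rightarrow> real" where
  "circle_conv f g x = (LINT y|circle_measure. f (x - y) * g y)"

definition circle_test_functions :: "(real \<Rightarrow> real) set" where
  "circle_test_functions =
     {\<phi>. on_circle \<phi> \<and> (\<forall>k. (deriv ^^ k) \<phi> differentiable_on UNIV)}"

definition has_weak_deriv :: "(real \<Rightarrow> complex) \<Rightarrow> (real \<Rightarrow> complex) \<Rightarrow> bool" where
  "has_weak_deriv f g \<longleftrightarrow> g \<in> L1_circle \<and>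
     (\<forall>\<phi>\<in>circle_test_functions.
        (LINT x|circle_measure. f x * of_real (deriv \<phi> x)) =
        - (LINT x|circle_measure. g x * of_real (\<phi> x)))"

text \<open>Weak derivatives are unique only up to null sets, hence the choice of a representative.\<close>

definition weak_deriv :: "(real \<Rightarrow> complex) \<Rightarrow> real \<Rightarrow> complex" where
  "weak_deriv f = (SOME g. has_weak_deriv f g)"

definition mass :: "(real \<Rightarrow> complex) \<Rightarrow> real" where
  "mass f = (LINT x|circle_measure. (cmod (f x))\<^sup>2)"

definition energy :: "(real \<Rightarrow> real) \<Rightarrow> (real \<Rightarrow> complex) \<Rightarrow> real" where
  "energy V f =
     1/2 * (LINT x|circle_measure. (cmod (weak_deriv f x))\<^sup>2) +
     1/4 * (LINT x|circle_measure. circle_conv V (\<lambda>y. (cmod (f y))\<^sup>2) x * (cmod (f x))\<^sup>2)"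

definition hartree_nonlinearity :: "(real \<Rightarrow> real) \<Rightarrow> (real \<Rightarrow> complex) \<Rightarrow> real \<Rightarrow> complex" where
  "hartree_nonlinearity V f x = of_real (circle_conv V (\<lambda>y. (cmod (f y))\<^sup>2) x) * f x"

text \<open>
  The free propagator \<open>exp (i t \<Delta>)\<close>, the Fourier multiplier with symbol \<open>exp (-i t n\<^sup>2)\<close>. The factor
  \<open>1/(2\<pi>)\<close> comes from the normalisation of the Fourier coefficients. On \<open>H\<^sup>s\<close> with \<open>s \<ge> 1\<close> the
  series converges absolutely, so this is the continuous representative.
\<close>

definition free_propagator :: "real \<Rightarrow> (real \<Rightarrow> complex) \<Rightarrow> real \<Rightarrow> complex" where
  "free_propagator t f x =
     1 / (2 * pi) * (\<Sum>\<^sub>\<infinity>n::int. exp (- \<i> * of_real t * (of_int n)\<^sup>2) * fourier_coeff f n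
                          * exp (\<i> * of_int n * of_real x))"

text \<open>
  \<open>u \<in> C(\<real>; H\<^sup>s)\<close> satisfies Duhamel's formula
  \<open>u(t) = exp (i t \<Delta>) \<Phi> - i \<integral>\<^sub>0\<^sup>t exp (i (t-\<tau>) \<Delta>) ((V * |u|\<^sup>2) u)(\<tau>) d\<tau>\<close>, for every \<open>t\<close>, as an identity
  of almost-everywhere classes. Point evaluation of the continuous representative is a bounded
  functional on \<open>H\<^sup>s\<close>, \<open>s \<ge> 1\<close>, so the \<open>H\<^sup>s\<close>-valued integral may be evaluated pointwise in \<open>x\<close>, where its
  integrand is continuous in \<open>\<tau>\<close>. The integral is oriented, so \<open>t < 0\<close> is covered; \<open>t = 0\<close> is the
  initial condition.
\<close>

definition hartree_solution ::
    "(real \<Rightarrow> real) \<Rightarrow> real \<Rightarrow> (real \<Rightarrow> complex) \<Rightarrow> (real \<Rightarrow> real \<Rightarrow> complex) \<Rightarrow> bool" where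
  "hartree_solution V s \<Phi> u \<longleftrightarrow>
     (\<forall>t. u t \<in> sobolev_space s) \<and>
     (\<forall>t0. ((\<lambda>t. sobolev_norm s (\<lambda>x. u t x - u t0 x)) \<longlongrightarrow> 0) (at t0)) \<and>
     (\<forall>t. AE x in circle_measure.
        u t x = free_propagator t \<Phi> x
          - \<i> * (LBINT \<tau>=0..t. free_propagator (t - \<tau>) (hartree_nonlinearity V (u \<tau>)) x))"

end

theory Submission
  imports Defs
begin

text \<open>
  In Fourier coefficients \<open>a\<^sub>n\<close> the equation reads \<open>a\<^sub>n' = - i n\<^sup>2 a\<^sub>n - i F\<^sub>n\<close>, where \<open>F\<close> is cubic in \<open>a\<close>. For a
  weight \<open>g\<close>, the time derivative of \<open>\<Sum> g(n) |a\<^sub>n|\<^sup>2\<close> is a quartic sum over \<open>n\<^sub>1 - n\<^sub>2 + n\<^sub>3 - n\<^sub>4 = 0\<close> which,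
  after symmetrisation, carries the factor \<open>g(n\<^sub>1) - g(n\<^sub>2) + g(n\<^sub>3) - g(n\<^sub>4)\<close>. This is a second difference of \<open>g\<close>
  with steps \<open>h = n\<^sub>1 - n\<^sub>2\<close> and \<open>k = n\<^sub>2 - n\<^sub>3\<close>, while the resonance function \<open>n\<^sub>1\<^sup>2 - n\<^sub>2\<^sup>2 + n\<^sub>3\<^sup>2 - n\<^sub>4\<^sup>2\<close> equals
  \<open>2 h k\<close>. Hence the quotient \<open>M\<close> of the two is bounded by \<open>g''\<close>, and adding the quartic form with multiplier \<open>M\<close> to
  the weighted norm removes the quartic term from its derivative. For \<open>g(n) = (1 + n\<^sup>2/N\<^sup>2)\<^sup>s\<close> one has
  \<open>g'' \<lesssim> g / N\<^sup>2\<close>, so correction and remaining derivative are \<open>O(N\<^sup>-\<^sup>2)\<close> times the weighted norm, with constants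
  that depend on the \<open>H\<^sup>1\<close> norm only. The weighted norm therefore at most doubles up to time \<open>T \<sim> N\<^sup>2\<close>, and comparing it
  with the \<open>H\<^sup>s\<close> norm loses \<open>N\<^sup>s \<sim> T\<^sup>s\<^sup>/\<^sup>2\<close>. The cases \<open>g = 1, M = 0\<close> and \<open>g = n\<^sup>2, M = 1\<close> of the same identity are
  the conservation of mass and energy, which bound the \<open>H\<^sup>1\<close> norm.
\<close>


section \<open>Summation over lattices and convolution of sequences\<close>

text \<open>The linear term \<open>n\<^sup>2 a\<^sub>n\<close> need not be summable, so the modified
  energy cannot be differentiated directly along an H^s solution. Each single coefficient is
  differentiable, however: finite box sums are differentiated and integrated in time, and dominated
  convergence gives the limit. This works because the resonance function occurs only in the product
  with \<open>M\<close>, which is an alternating sum of weights. All multilinear bounds are tame: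
  the weighted norm enters linearly, and the other factors are measured by the l^1 norm of the
  coefficients, which H^1 controls in one dimension. Hence the constants see only mass and energy.
  The defined energy contains an arbitrarily chosen weak derivative. To bound the sum of
  \<open>n\<^sup>2 |a\<^sub>n|\<^sup>2\<close> by it takes uniqueness of Fourier coefficients,
  Riesz-Fischer and Bessel. The sign of V serves to discard the potential energy at later times. No
  differential inequality is solved: the growth is absorbed into a supremum over [-T, T], with
  \<open>N\<^sup>2\<close> an affine function of 1 + T.\<close>

abbreviation in_l1 :: "(int \<Rightarrow> complex) \<Rightarrow> bool" where
  "in_l1 x \<equiv> (\<lambda>n. cmod (x n)) summable_on UNIV"

definition l1_norm :: "(int \<Rightarrow> complex) \<Rightarrow> real" where
  "l1_norm x = (\<Sum>\<^sub>\<infinity>n. cmod (x n))"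

definition conv :: "(int \<Rightarrow> complex) \<Rightarrow> (int \<Rightarrow> complex) \<Rightarrow> int \<Rightarrow> complex" where
  "conv x y n = (\<Sum>\<^sub>\<infinity>k. x k * y (n - k))"

lemma has_sum_product_nonneg:
  fixes f :: "'a \<Rightarrow> real" and g :: "'b \<Rightarrow> real"
  assumes "(f has_sum A) UNIV" "(g has_sum B) UNIV" "\<And>x. 0 \<le> f x" "\<And>x. 0 \<le> g x"
  shows "((\<lambda>p. f (fst p) * g (snd p)) has_sum A * B) UNIV"
proof -
  have 1: "((\<lambda>y. f x * g y) has_sum f x * B) UNIV" for x
    by (intro has_sum_cmult_right assms)
  have 2: "((\<lambda>x. f x * B) has_sum A * B) UNIV"
    by (intro has_sum_cmult_left assms)
  have "(\<lambda>p. f (fst p) * g (snd p)) summable_on (UNIV \<times> UNIV)"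
    by (rule summable_on_SigmaI[where g = "\<lambda>x. f x * B"])
       (use 1 2 assms in \<open>auto simp: summable_on_def\<close>)
  then show ?thesis
    using has_sum_SigmaI[where f = "\<lambda>p. f (fst p) * g (snd p)" and g = "\<lambda>x. f x * B"
        and A = UNIV and B = "\<lambda>_. UNIV" and S = "A * B"] 1 2
    by simp
qed

text \<open>Only an inequality, since \<open>h\<close> may miss part of the index set. It bounds
  sums over linearly dependent indices by sums over independent ones.\<close>

lemma nonneg_inj_reindex:
  fixes f :: "'a \<Rightarrow> real" and h :: "'b \<Rightarrow> 'a"
  assumes "f summable_on UNIV" "\<And>x. 0 \<le> f x" "inj h"
  shows "(\<lambda>x. f (h x)) summable_on UNIV" "(\<Sum>\<^sub>\<infinity>x. f (h x)) \<le> infsum f UNIV"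
proof -
  have s: "f summable_on range h"
    using assms(1) summable_on_subset_banach by blast
  then show "(\<lambda>x. f (h x)) summable_on UNIV"
    using summable_on_reindex[OF assms(3), of f] by (simp add: o_def)
  have "(\<Sum>\<^sub>\<infinity>x. f (h x)) = infsum f (range h)"
    using infsum_reindex[OF assms(3), of f] by (simp add: o_def)
  also have "\<dots> \<le> infsum f UNIV"
    by (rule infsum_mono2) (use s assms in auto)
  finally show "(\<Sum>\<^sub>\<infinity>x. f (h x)) \<le> infsum f UNIV" .
qed

lemma norm_infsum_le_infsum:
  fixes f :: "'a \<Rightarrow> 'b::banach"
  assumes "g summable_on A" "\<And>x. x \<in> A \<Longrightarrow> norm (f x) \<le> g x"
  shows "f summable_on A" "norm (infsum f A) \<le> infsum g A"
proof -
  have "(\<lambda>x. norm (f x)) summable_on A"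
    by (rule summable_on_comparison_test[OF assms(1)]) (simp_all add: assms(2))
  then show s: "f summable_on A"
    by (rule abs_summable_summable)
  show "norm (infsum f A) \<le> infsum g A"
    by (rule norm_infsum_le[OF has_sum_infsum[OF s] has_sum_infsum[OF assms(1)] assms(2)])
qed

lemma Cauchy_Schwarz_infsum:
  fixes x y :: "'a \<Rightarrow> real"
  assumes "(\<lambda>i. (x i)\<^sup>2) summable_on A" "(\<lambda>i. (y i)\<^sup>2) summable_on A"
  shows "(\<lambda>i. x i * y i) summable_on A"
    "(\<Sum>\<^sub>\<infinity>i\<in>A. x i * y i)\<^sup>2 \<le> (\<Sum>\<^sub>\<infinity>i\<in>A. (x i)\<^sup>2) * (\<Sum>\<^sub>\<infinity>i\<in>A. (y i)\<^sup>2)"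
proof -
  let ?X = "\<Sum>\<^sub>\<infinity>i\<in>A. (x i)\<^sup>2" and ?Y = "\<Sum>\<^sub>\<infinity>i\<in>A. (y i)\<^sup>2"
  have le: "\<bar>x i * y i\<bar> \<le> (x i)\<^sup>2 + (y i)\<^sup>2" for i
  proof -
    have "0 \<le> \<bar>x i\<bar> * \<bar>y i\<bar>" by simp
    then show ?thesis
      using sum_squares_bound[of "\<bar>x i\<bar>" "\<bar>y i\<bar>"] unfolding abs_mult mult.assoc power2_abs by linarith
  qed
  have sa: "(\<lambda>i. \<bar>x i * y i\<bar>) summable_on A"
    by (rule summable_on_comparison_test[OF summable_on_add[OF assms]]) (use le in auto)
  then show s: "(\<lambda>i. x i * y i) summable_on A"
    using abs_summable_summable[of "\<lambda>i. x i * y i" A] by simp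
  have nn: "0 \<le> ?X" "0 \<le> ?Y"
    by (auto intro: infsum_nonneg)
  have "\<bar>\<Sum>\<^sub>\<infinity>i\<in>A. x i * y i\<bar> \<le> (\<Sum>\<^sub>\<infinity>i\<in>A. \<bar>x i * y i\<bar>)"
    using norm_infsum_le_infsum(2)[OF sa, of "\<lambda>i. x i * y i"] by simp
  also have "\<dots> \<le> sqrt (?X * ?Y)"
  proof (rule infsum_le_finite_sums[OF sa])
    fix F assume F: "finite F" "F \<subseteq> A"
    have "(\<Sum>i\<in>F. \<bar>x i\<bar> * \<bar>y i\<bar>)\<^sup>2 \<le> (\<Sum>i\<in>F. \<bar>x i\<bar>\<^sup>2) * (\<Sum>i\<in>F. \<bar>y i\<bar>\<^sup>2)"
      by (rule Cauchy_Schwarz_ineq_sum)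
    also have "\<dots> \<le> ?X * ?Y"
      by (intro mult_mono) (use F nn in \<open>auto intro!: finite_sum_le_infsum assms sum_nonneg\<close>)
    finally show "(\<Sum>i\<in>F. \<bar>x i * y i\<bar>) \<le> sqrt (?X * ?Y)"
      by (intro real_le_rsqrt) (simp add: abs_mult)
  qed
  finally have "\<bar>\<Sum>\<^sub>\<infinity>i\<in>A. x i * y i\<bar>\<^sup>2 \<le> (sqrt (?X * ?Y))\<^sup>2"
    by (intro power_mono) auto
  then show "(\<Sum>\<^sub>\<infinity>i\<in>A. x i * y i)\<^sup>2 \<le> ?X * ?Y"
    using nn by simp
qed

lemma weighted_Cauchy_Schwarz_infsum:
  fixes x p :: "'a \<Rightarrow> real"
  assumes "p summable_on A" "(\<lambda>i. (x i)\<^sup>2 * p i) summable_on A" "\<And>i. 0 \<le> p i"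
  shows "(\<lambda>i. x i * p i) summable_on A"
    "(\<Sum>\<^sub>\<infinity>i\<in>A. x i * p i)\<^sup>2 \<le> (\<Sum>\<^sub>\<infinity>i\<in>A. (x i)\<^sup>2 * p i) * (\<Sum>\<^sub>\<infinity>i\<in>A. p i)"
proof -
  have eq: "x i * p i = (x i * sqrt (p i)) * sqrt (p i)" for i
    using assms(3) by simp
  have "(\<lambda>i. (x i * sqrt (p i))\<^sup>2) summable_on A" "(\<lambda>i. (sqrt (p i))\<^sup>2) summable_on A"
    using assms by (simp_all add: power_mult_distrib)
  from Cauchy_Schwarz_infsum[OF this] show "(\<lambda>i. x i * p i) summable_on A"
    "(\<Sum>\<^sub>\<infinity>i\<in>A. x i * p i)\<^sup>2 \<le> (\<Sum>\<^sub>\<infinity>i\<in>A. (x i)\<^sup>2 * p i) * (\<Sum>\<^sub>\<infinity>i\<in>A. p i)"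
    unfolding eq using assms(3) by (simp_all add: power_mult_distrib)
qed

lemma l1_norm_nonneg: "0 \<le> l1_norm x"
  by (simp add: l1_norm_def infsum_nonneg)

lemma cmod_le_l1_norm: "in_l1 x \<Longrightarrow> cmod (x n) \<le> l1_norm x"
  unfolding l1_norm_def using finite_sum_le_infsum[of "\<lambda>n. cmod (x n)" UNIV "{n}"] by simp

text \<open>The shear (n, k) -> (k, n - k) is injective and leads to the product family of
  \<open>f\<close> and \<open>g\<close>, whose sum factorises; the iterated sum follows by
  Fubini.\<close>

lemma conv_real_summable:
  fixes f g :: "int \<Rightarrow> real"
  assumes "f summable_on UNIV" "g summable_on UNIV" "\<And>x. 0 \<le> f x" "\<And>x. 0 \<le> g x"
  shows "(\<lambda>(n, k). f k * g (n - k)) summable_on UNIV"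
    "(\<lambda>k. f k * g (n - k)) summable_on UNIV"
    "(\<lambda>n. \<Sum>\<^sub>\<infinity>k. f k * g (n - k)) summable_on UNIV"
    "(\<Sum>\<^sub>\<infinity>n. \<Sum>\<^sub>\<infinity>k. f k * g (n - k)) \<le> infsum f UNIV * infsum g UNIV"
proof -
  let ?h = "\<lambda>(n, k). (k, n - k) :: int \<times> int"
  have inj: "inj ?h" by (auto simp: inj_def)
  have hs: "((\<lambda>p. f (fst p) * g (snd p)) has_sum infsum f UNIV * infsum g UNIV) UNIV"
    by (intro has_sum_product_nonneg has_sum_infsum assms)
  note * = nonneg_inj_reindex[OF has_sum_imp_summable[OF hs] _ inj]
  show 1: "(\<lambda>(n, k). f k * g (n - k)) summable_on UNIV"
    using *(1) assms by (simp add: case_prod_unfold)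
  then have one': "(\<lambda>(n, k). f k * g (n - k)) summable_on (UNIV \<times> UNIV)" by simp
  show "(\<lambda>k. f k * g (n - k)) summable_on UNIV"
    using summable_on_SigmaD1[OF one'] by simp
  show "(\<lambda>n. \<Sum>\<^sub>\<infinity>k. f k * g (n - k)) summable_on UNIV"
    using summable_on_Sigma_banach[OF one'] by simp
  have "(\<Sum>\<^sub>\<infinity>n. \<Sum>\<^sub>\<infinity>k. f k * g (n - k)) = infsum (\<lambda>(n, k). f k * g (n - k)) (UNIV \<times> UNIV)"
    using infsum_Sigma'_banach[OF one'] by simp
  also have "\<dots> \<le> infsum f UNIV * infsum g UNIV"
    using *(2) assms infsumI[OF hs] by (simp add: case_prod_unfold)
  finally show "(\<Sum>\<^sub>\<infinity>n. \<Sum>\<^sub>\<infinity>k. f k * g (n - k)) \<le> infsum f UNIV * infsum g UNIV" .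
qed

lemma conv_summable:
  assumes "in_l1 x" "in_l1 y"
  shows "(\<lambda>(n, k). x k * y (n - k)) summable_on UNIV"
    "(\<lambda>k. x k * y (n - k)) summable_on UNIV"
    "(\<lambda>k. cmod (x k) * cmod (y (n - k))) summable_on UNIV"
    "cmod (conv x y n) \<le> (\<Sum>\<^sub>\<infinity>k. cmod (x k) * cmod (y (n - k)))"
proof -
  note * = conv_real_summable[OF assms]
  show "(\<lambda>(n, k). x k * y (n - k)) summable_on UNIV"
    by (rule norm_infsum_le_infsum[OF *(1)]) (auto simp: norm_mult)
  show b: "(\<lambda>k. cmod (x k) * cmod (y (n - k))) summable_on UNIV"
    by (rule *(2)) auto
  from norm_infsum_le_infsum[OF b, of "\<lambda>k. x k * y (n - k)"]
  show "(\<lambda>k. x k * y (n - k)) summable_on UNIV"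
    "cmod (conv x y n) \<le> (\<Sum>\<^sub>\<infinity>k. cmod (x k) * cmod (y (n - k)))"
    by (auto simp: norm_mult conv_def)
qed

lemma conv_l1:
  assumes "in_l1 x" "in_l1 y"
  shows "in_l1 (conv x y)" "l1_norm (conv x y) \<le> l1_norm x * l1_norm y"
proof -
  note * = conv_real_summable[OF assms, simplified]
  show 1: "in_l1 (conv x y)"
    by (rule summable_on_comparison_test[OF *(3)]) (use conv_summable(4)[OF assms] in auto)
  have "l1_norm (conv x y) \<le> (\<Sum>\<^sub>\<infinity>n. \<Sum>\<^sub>\<infinity>k. cmod (x k) * cmod (y (n - k)))"
    unfolding l1_norm_def by (rule infsum_mono[OF 1 *(3)]) (rule conv_summable(4)[OF assms])
  also have "\<dots> \<le> l1_norm x * l1_norm y"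
    unfolding l1_norm_def by (rule *(4))
  finally show "l1_norm (conv x y) \<le> l1_norm x * l1_norm y" .
qed

lemma l1_diff:
  assumes "in_l1 x" "in_l1 y"
  shows "in_l1 (\<lambda>n. x n - y n)" "l1_norm (\<lambda>n. x n - y n) \<le> l1_norm x + l1_norm y"
    "in_l1 (\<lambda>n. x n + y n)" "l1_norm (\<lambda>n. x n + y n) \<le> l1_norm x + l1_norm y"
proof -
  note a = summable_on_add[OF assms]
  show 1: "in_l1 (\<lambda>n. x n - y n)" "in_l1 (\<lambda>n. x n + y n)"
    by (auto intro!: summable_on_comparison_test[OF a] norm_triangle_ineq norm_triangle_ineq4)
  show "l1_norm (\<lambda>n. x n - y n) \<le> l1_norm x + l1_norm y"
    "l1_norm (\<lambda>n. x n + y n) \<le> l1_norm x + l1_norm y"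
    unfolding l1_norm_def infsum_add[OF assms, symmetric]
    by (intro infsum_mono 1 a norm_triangle_ineq norm_triangle_ineq4)+
qed

lemma conv_diff:
  assumes "in_l1 x" "in_l1 y" "in_l1 x'" "in_l1 y'"
  shows "conv x y n - conv x' y' n
    = conv (\<lambda>n. x n - x' n) y n + conv x' (\<lambda>n. y n - y' n) n"
proof -
  let ?d = "\<lambda>n. x n - x' n" and ?e = "\<lambda>n. y n - y' n"
  have d: "in_l1 ?d" and e: "in_l1 ?e" by (intro l1_diff assms)+
  note s = conv_summable(2)
  have "conv x y n = (\<Sum>\<^sub>\<infinity>k. ?d k * y (n - k) + x' k * y (n - k))"
    unfolding conv_def by (simp add: algebra_simps)
  also have "\<dots> = conv ?d y n + conv x' y n"
    unfolding conv_def by (rule infsum_add[OF s[OF d assms(2)] s[OF assms(3,2)]])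
  finally have 1: "conv x y n = conv ?d y n + conv x' y n" .
  have "conv x' y n = (\<Sum>\<^sub>\<infinity>k. x' k * ?e (n - k) + x' k * y' (n - k))"
    unfolding conv_def by (simp add: algebra_simps)
  also have "\<dots> = conv x' ?e n + conv x' y' n"
    unfolding conv_def by (rule infsum_add[OF s[OF assms(3) e] s[OF assms(3,4)]])
  finally show ?thesis using 1 by simp
qed

text \<open>A bilinear Lipschitz estimate, from which the continuity of the nonlinearity in time
  will follow.\<close>

lemma conv_diff_l1:
  assumes "in_l1 x" "in_l1 y" "in_l1 x'" "in_l1 y'"
  shows "l1_norm (\<lambda>n. conv x y n - conv x' y' n)
    \<le> l1_norm (\<lambda>n. x n - x' n) * l1_norm y + l1_norm x' * l1_norm (\<lambda>n. y n - y' n)"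
  unfolding conv_diff[OF assms]
  by (intro order.trans[OF l1_diff(4)] add_mono conv_l1 l1_diff assms)

section \<open>Weighted l^2 norms and multilinear estimates for quasi-subadditive weights\<close>

definition wt_sum :: "(int \<Rightarrow> real) \<Rightarrow> (int \<Rightarrow> complex) \<Rightarrow> real" where
  "wt_sum w x = (\<Sum>\<^sub>\<infinity>n. w n * (cmod (x n))\<^sup>2)"

abbreviation in_wt :: "(int \<Rightarrow> real) \<Rightarrow> (int \<Rightarrow> complex) \<Rightarrow> bool" where
  "in_wt w x \<equiv> (\<lambda>n. w n * (cmod (x n))\<^sup>2) summable_on UNIV"

text \<open>Quadruples of frequencies on the hyperplane of the quartic form are encoded by their
  first three entries. Any three of the four frequencies are free coordinates there.\<close>

abbreviation i1 :: "int \<times> int \<times> int \<Rightarrow> int" where "i1 p \<equiv> fst p"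
abbreviation i2 :: "int \<times> int \<times> int \<Rightarrow> int" where "i2 p \<equiv> fst (snd p)"
abbreviation i3 :: "int \<times> int \<times> int \<Rightarrow> int" where "i3 p \<equiv> snd (snd p)"
abbreviation i4 :: "int \<times> int \<times> int \<Rightarrow> int" where "i4 p \<equiv> fst p - fst (snd p) + snd (snd p)"

lemma sum_list_inj_reindex:
  fixes \<phi> :: "'a \<Rightarrow> real"
  assumes "\<phi> summable_on UNIV" "\<And>x. 0 \<le> \<phi> x" "\<forall>h\<in>set hs. inj h"
  shows "(\<lambda>p. \<Sum>h\<leftarrow>hs. \<phi> (h p)) summable_on UNIV \<and>
    (\<Sum>\<^sub>\<infinity>p. \<Sum>h\<leftarrow>hs. \<phi> (h p)) \<le> length hs * infsum \<phi> UNIV"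
  using assms(3)
proof (induction hs)
  case (Cons h hs)
  then have IH: "(\<lambda>p. \<Sum>h\<leftarrow>hs. \<phi> (h p)) summable_on UNIV"
    "(\<Sum>\<^sub>\<infinity>p. \<Sum>h\<leftarrow>hs. \<phi> (h p)) \<le> length hs * infsum \<phi> UNIV" and h: "inj h"
    by auto
  note h = nonneg_inj_reindex[OF assms(1,2) h]
  show ?case
    using summable_on_add[OF h(1) IH(1)] infsum_add[OF h(1) IH(1)] h(2) IH(2)
    by (simp add: algebra_simps)
qed simp

text \<open>Of the two factors in \<open>r\<^sup>2\<close>, one is spread over the other entries by
  the first hypothesis. Each resulting product such as (r a)(s b) is split by 2xy \<le> x^2 + y^2,
  which leaves one squared entry with its own weight and two entries without weight.\<close>

lemma square_le_pairs:
  fixes a b c d r s t u Q :: real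
  assumes "r \<le> Q * (s + t + u)" "0 \<le> r" "0 \<le> Q" "0 \<le> a" "0 \<le> b" "0 \<le> c" "0 \<le> d"
  shows "2 * (r\<^sup>2 * (a * b * c * d)) \<le> Q * ((r\<^sup>2 * a\<^sup>2 + s\<^sup>2 * b\<^sup>2) * (c * d)
    + (r\<^sup>2 * a\<^sup>2 + t\<^sup>2 * c\<^sup>2) * (b * d) + (r\<^sup>2 * a\<^sup>2 + u\<^sup>2 * d\<^sup>2) * (b * c))"
proof -
  have am: "2 * (x * y) * z \<le> (x\<^sup>2 + y\<^sup>2) * z" if "0 \<le> z" for x y z :: real
    using sum_squares_bound[of x y] that by (intro mult_right_mono) auto
  have "r\<^sup>2 * (a * b * c * d) \<le> r * (Q * (s + t + u)) * (a * b * c * d)"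
    unfolding power2_eq_square using assms by (intro mult_right_mono mult_left_mono) auto
  also have "2 * \<dots> = Q * (2 * ((r * a) * (s * b)) * (c * d) + 2 * ((r * a) * (t * c)) * (b * d)
      + 2 * ((r * a) * (u * d)) * (b * c))"
    by (simp add: algebra_simps)
  also have "\<dots> \<le> Q * (((r * a)\<^sup>2 + (s * b)\<^sup>2) * (c * d) + ((r * a)\<^sup>2 + (t * c)\<^sup>2) * (b * d)
      + ((r * a)\<^sup>2 + (u * d)\<^sup>2) * (b * c))"
    using assms by (intro mult_left_mono add_mono am) auto
  finally show ?thesis by (simp add: power_mult_distrib)
qed

text \<open>\<open>\<theta>\<close> is the square root of the weight that enters the norms; for a
  Sobolev weight it is a power of the bracket, subadditive up to the constant \<open>L\<close>.
  Evenness lets differences of frequencies be treated like sums.\<close>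

locale subadd_weight =
  fixes \<theta> :: "int \<Rightarrow> real" and L :: real
  assumes ge1: "1 \<le> \<theta> n" and even: "\<theta> (- n) = \<theta> n"
    and L_ge1: "1 \<le> L" and add: "\<theta> (k + l) \<le> L * (\<theta> k + \<theta> l)"
begin

abbreviation "w \<equiv> \<lambda>n. (\<theta> n)\<^sup>2"

lemma nonneg: "0 \<le> \<theta> n" using ge1[of n] by linarith

text \<open>A tame product estimate: subadditivity puts the weight on one of the two factors, while
  the other is measured in l^1.\<close>

lemma conv_wt:
  assumes "in_l1 x" "in_l1 y" "in_wt w x" "in_wt w y"
  shows "in_wt w (conv x y)"
    "wt_sum w (conv x y) \<le> 2 * L\<^sup>2 * (wt_sum w x * (l1_norm y)\<^sup>2 + (l1_norm x)\<^sup>2 * wt_sum w y)"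
proof -
  let ?X = "\<lambda>n. cmod (x n)" and ?Y = "\<lambda>n. cmod (y n)"
  let ?P = "\<lambda>n. \<Sum>\<^sub>\<infinity>k. (w k * (?X k)\<^sup>2) * ?Y (n - k)"
  let ?Q = "\<lambda>n. \<Sum>\<^sub>\<infinity>k. ?X k * (w (n - k) * (?Y (n - k))\<^sup>2)"
  note P = conv_real_summable[OF assms(3) assms(2), simplified]
  note Q = conv_real_summable[OF assms(1) assms(4), simplified]
  have X1: "(\<lambda>k. ?X k) summable_on UNIV" and Y1: "(\<lambda>k. ?Y (n - k)) summable_on UNIV" for n
  proof -
    have "inj (\<lambda>k. n - k)" by (auto simp: inj_def)
    from nonneg_inj_reindex(1)[OF assms(2) _ this] show "(\<lambda>k. ?Y (n - k)) summable_on UNIV" by simp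
  qed (use assms in simp)
  have Yn: "(\<Sum>\<^sub>\<infinity>k. ?Y (n - k)) \<le> l1_norm y" for n
  proof -
    have "inj (\<lambda>k. n - k)" by (auto simp: inj_def)
    from nonneg_inj_reindex(2)[OF assms(2) _ this] show ?thesis by (simp add: l1_norm_def)
  qed
  have Pn: "0 \<le> ?P n" for n
    by (auto intro!: infsum_nonneg)
  have bound: "w n * (cmod (conv x y n))\<^sup>2 \<le> 2 * L\<^sup>2 * (l1_norm y * ?P n + l1_norm x * ?Q n)" for n
  proof -
    \<comment> \<open>The unweighted factor serves as the summation weight in Cauchy-Schwarz, so it
      leaves in l^1 and the other factor stays squared with its weight.\<close>
    let ?a = "\<lambda>k. (\<theta> k * ?X k) * ?Y (n - k)" and ?b = "\<lambda>k. (\<theta> (n - k) * ?Y (n - k)) * ?X k"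
    have pa: "(\<lambda>k. (\<theta> k * ?X k)\<^sup>2 * ?Y (n - k)) summable_on UNIV"
      using P(2)[of n] by (simp add: power_mult_distrib)
    have pb: "(\<lambda>k. (\<theta> (n - k) * ?Y (n - k))\<^sup>2 * ?X k) summable_on UNIV"
      using Q(2)[of n] by (simp add: power_mult_distrib mult.commute)
    note a = weighted_Cauchy_Schwarz_infsum[OF Y1 pa] and b = weighted_Cauchy_Schwarz_infsum[OF X1 pb]
    have a2: "(infsum ?a UNIV)\<^sup>2 \<le> l1_norm y * ?P n"
    proof -
      have "(infsum ?a UNIV)\<^sup>2 \<le> ?P n * (\<Sum>\<^sub>\<infinity>k. ?Y (n - k))"
        using a(2) by (simp add: power_mult_distrib)
      also have "\<dots> \<le> ?P n * l1_norm y" by (intro mult_left_mono Yn Pn)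
      finally show ?thesis by (simp add: mult.commute)
    qed
    have b2: "(infsum ?b UNIV)\<^sup>2 \<le> l1_norm x * ?Q n"
      using b(2) by (simp add: power_mult_distrib l1_norm_def mult_ac)
    have s: "(\<lambda>k. ?a k + ?b k) summable_on UNIV"
      by (intro summable_on_add a(1) b(1)) auto
    have "\<theta> n * cmod (conv x y n) \<le> \<theta> n * (\<Sum>\<^sub>\<infinity>k. ?X k * ?Y (n - k))"
      by (intro mult_left_mono conv_summable assms nonneg)
    also have "\<dots> = (\<Sum>\<^sub>\<infinity>k. \<theta> n * (?X k * ?Y (n - k)))"
      by (intro infsum_cmult_right[symmetric] conv_summable assms)
    also have "\<dots> \<le> (\<Sum>\<^sub>\<infinity>k. L * (?a k + ?b k))"
    proof (rule infsum_mono)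
      show "(\<lambda>k. \<theta> n * (?X k * ?Y (n - k))) summable_on UNIV"
        by (intro summable_on_cmult_right conv_summable assms)
      show "(\<lambda>k. L * (?a k + ?b k)) summable_on UNIV"
        by (intro summable_on_cmult_right s)
      fix k
      have "\<theta> n \<le> L * (\<theta> k + \<theta> (n - k))" using add[of k "n - k"] by simp
      then have "\<theta> n * (?X k * ?Y (n - k)) \<le> L * (\<theta> k + \<theta> (n - k)) * (?X k * ?Y (n - k))"
        by (intro mult_right_mono) auto
      then show "\<theta> n * (?X k * ?Y (n - k)) \<le> L * (?a k + ?b k)"
        by (simp add: algebra_simps)
    qed
    also have "\<dots> = L * (infsum ?a UNIV + infsum ?b UNIV)"
      by (subst infsum_cmult_right[OF s], subst infsum_add) (use a(1) b(1) in auto)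
    finally have le: "\<theta> n * cmod (conv x y n) \<le> L * (infsum ?a UNIV + infsum ?b UNIV)" .
    have "w n * (cmod (conv x y n))\<^sup>2 = (\<theta> n * cmod (conv x y n))\<^sup>2"
      by (simp add: power_mult_distrib)
    also have "\<dots> \<le> (L * (infsum ?a UNIV + infsum ?b UNIV))\<^sup>2"
      by (intro power_mono le) (auto simp: nonneg)
    also have "\<dots> \<le> L\<^sup>2 * (2 * (infsum ?a UNIV)\<^sup>2 + 2 * (infsum ?b UNIV)\<^sup>2)"
      unfolding power_mult_distrib
      by (intro mult_left_mono) (use sum_squares_bound[of "infsum ?a UNIV" "infsum ?b UNIV"] in \<open>auto simp: power2_sum\<close>)
    also have "\<dots> \<le> L\<^sup>2 * (2 * (l1_norm y * ?P n) + 2 * (l1_norm x * ?Q n))"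
      using a2 b2 by (intro mult_left_mono) auto
    finally show ?thesis by (simp add: algebra_simps)
  qed
  have S: "(\<lambda>n. 2 * L\<^sup>2 * (l1_norm y * ?P n + l1_norm x * ?Q n)) summable_on UNIV"
    by (intro summable_on_cmult_right summable_on_add P(3) Q(3))
  show 1: "in_wt w (conv x y)"
    by (rule summable_on_comparison_test[OF S]) (use bound in auto)
  have "wt_sum w (conv x y) \<le> (\<Sum>\<^sub>\<infinity>n. 2 * L\<^sup>2 * (l1_norm y * ?P n + l1_norm x * ?Q n))"
    unfolding wt_sum_def by (rule infsum_mono[OF 1 S bound])
  also have "\<dots> = 2 * L\<^sup>2 * (l1_norm y * infsum ?P UNIV + l1_norm x * infsum ?Q UNIV)"
    by (subst infsum_cmult_right, intro summable_on_add summable_on_cmult_right P(3) Q(3), 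
        subst infsum_add, intro summable_on_cmult_right P(3), intro summable_on_cmult_right Q(3),
        simp add: infsum_cmult_right P(3) Q(3))
  also have "\<dots> \<le> 2 * L\<^sup>2 * (l1_norm y * (wt_sum w x * l1_norm y) + l1_norm x * (l1_norm x * wt_sum w y))"
    by (intro mult_left_mono add_mono) (use P(4) Q(4) in \<open>auto simp: l1_norm_def wt_sum_def infsum_nonneg\<close>)
  finally show "wt_sum w (conv x y) \<le> 2 * L\<^sup>2 * (wt_sum w x * (l1_norm y)\<^sup>2 + (l1_norm x)\<^sup>2 * wt_sum w y)"
    by (simp add: power2_eq_square algebra_simps)
qed

lemma sub3:
  "\<theta> (k - l + m) \<le> L\<^sup>2 * (\<theta> k + \<theta> l + \<theta> m)"
proof -
  have "\<theta> (k - l + m) \<le> L * (\<theta> (k - l) + \<theta> m)" using add[of "k - l" m] by simp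
  also have "\<dots> \<le> L * (L * (\<theta> k + \<theta> l) + L * \<theta> m)"
    using add[of k "- l"] even[of l] L_ge1 nonneg[of m] mult_right_mono[of 1 L "\<theta> m"]
    by (intro mult_left_mono add_mono) auto
  finally show ?thesis by (simp add: power2_eq_square algebra_simps)
qed

text \<open>By \<open>square_le_pairs\<close> every term is dominated by products of one squared
  weighted entry with two unweighted ones. Three of the frequencies being free, each such product
  sums to at most the weighted norm times the square of the l^1 norm.\<close>

lemma quadrilinear_bound:
  fixes \<alpha> :: "int \<Rightarrow> real"
  assumes \<alpha>: "\<And>n. 0 \<le> \<alpha> n" and sum: "\<alpha> summable_on UNIV" and wsum: "(\<lambda>n. w n * (\<alpha> n)\<^sup>2) summable_on UNIV"
  defines "\<Xi> \<equiv> \<lambda>p. (w (i1 p) + w (i2 p) + w (i3 p) + w (i4 p)) * (\<alpha> (i1 p) * \<alpha> (i2 p) * \<alpha> (i3 p) * \<alpha> (i4 p))"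
  shows "\<Xi> summable_on UNIV"
    "infsum \<Xi> UNIV \<le> 12 * L\<^sup>2 * ((\<Sum>\<^sub>\<infinity>n. w n * (\<alpha> n)\<^sup>2) * (infsum \<alpha> UNIV)\<^sup>2)"
proof -
  let ?f = "\<lambda>n. w n * (\<alpha> n)\<^sup>2"
  let ?W = "infsum ?f UNIV" and ?A = "infsum \<alpha> UNIV"
  define \<phi> where "\<phi> q = ?f (i1 q) * (\<alpha> (i2 q) * \<alpha> (i3 q))" for q
  have "(\<phi> has_sum ?W * (?A * ?A)) UNIV"
    unfolding \<phi>_def
    using has_sum_product_nonneg[of ?f ?W "\<lambda>q. \<alpha> (fst q) * \<alpha> (snd q)" "?A * ?A"]
      has_sum_product_nonneg[of \<alpha> ?A \<alpha> ?A] \<alpha> sum wsum by simp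
  then have \<phi>: "\<phi> summable_on UNIV" "infsum \<phi> UNIV = ?W * (?A * ?A)"
    by (auto simp: has_sum_iff)
  \<comment> \<open>Four choices of the weighted frequency times three choices of two others: hence
    the constant 12. Each product arises twice from the four uses of \<open>square_le_pairs\<close>,
    which matches the factor 2 there.\<close>
  define hs where "hs = [\<lambda>p. (i1 p, i2 p, i3 p), \<lambda>p. (i1 p, i2 p, i4 p), \<lambda>p. (i1 p, i3 p, i4 p),
    \<lambda>p. (i2 p, i1 p, i3 p), \<lambda>p. (i2 p, i1 p, i4 p), \<lambda>p. (i2 p, i3 p, i4 p),
    \<lambda>p. (i3 p, i1 p, i2 p), \<lambda>p. (i3 p, i1 p, i4 p), \<lambda>p. (i3 p, i2 p, i4 p),
    \<lambda>p. (i4 p, i1 p, i2 p), \<lambda>p. (i4 p, i1 p, i3 p), \<lambda>p. (i4 p, i2 p, i3 p)]"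
  have inj: "\<forall>h\<in>set hs. inj h"
    unfolding hs_def by (auto simp: inj_def prod_eq_iff)
  have len: "length hs = 12" by (simp add: hs_def)
  note T = sum_list_inj_reindex[OF \<phi>(1) _ inj]
  have \<phi>0: "0 \<le> \<phi> q" for q by (simp add: \<phi>_def \<alpha>)
  let ?T = "\<lambda>p. \<Sum>h\<leftarrow>hs. \<phi> (h p)"
  have le: "\<Xi> p \<le> L\<^sup>2 * ?T p" for p
  proof -
    let ?a = "\<alpha> (i1 p)" and ?b = "\<alpha> (i2 p)" and ?c = "\<alpha> (i3 p)" and ?d = "\<alpha> (i4 p)"
    let ?r = "\<theta> (i1 p)" and ?s = "\<theta> (i2 p)" and ?t = "\<theta> (i3 p)" and ?u = "\<theta> (i4 p)"
    have 1: "?r \<le> L\<^sup>2 * (?s + ?t + ?u)" using sub3[of "i2 p" "i3 p" "i4 p"] by simp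
    have 2: "?s \<le> L\<^sup>2 * (?r + ?t + ?u)" using sub3[of "i1 p" "i4 p" "i3 p"] by (simp add: ac_simps)
    have 3: "?t \<le> L\<^sup>2 * (?r + ?s + ?u)" using sub3[of "i2 p" "i1 p" "i4 p"] by (simp add: ac_simps)
    have 4: "?u \<le> L\<^sup>2 * (?r + ?s + ?t)" using sub3[of "i1 p" "i2 p" "i3 p"] by simp
    have "2 * \<Xi> p \<le> 2 * (L\<^sup>2 * ?T p)"
      using square_le_pairs[OF 1, of ?a ?b ?c ?d] square_le_pairs[OF 2, of ?b ?a ?c ?d]
        square_le_pairs[OF 3, of ?c ?a ?b ?d] square_le_pairs[OF 4, of ?d ?a ?b ?c]
      unfolding \<Xi>_def hs_def \<phi>_def
      by (simp add: \<alpha> nonneg algebra_simps)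
    then show ?thesis by simp
  qed
  have s: "(\<lambda>p. L\<^sup>2 * ?T p) summable_on UNIV"
    using T \<phi>0 by (intro summable_on_cmult_right) auto
  show 1: "\<Xi> summable_on UNIV"
    by (rule summable_on_comparison_test[OF s le]) (simp add: \<Xi>_def \<alpha>)
  have "infsum \<Xi> UNIV \<le> (\<Sum>\<^sub>\<infinity>p. L\<^sup>2 * ?T p)"
    by (rule infsum_mono[OF 1 s le])
  also have "\<dots> = L\<^sup>2 * infsum ?T UNIV"
    using T \<phi>0 by (intro infsum_cmult_right) auto
  also have "\<dots> \<le> L\<^sup>2 * (12 * infsum \<phi> UNIV)"
    using T \<phi>0 len by (intro mult_left_mono) auto
  finally show "infsum \<Xi> UNIV \<le> 12 * L\<^sup>2 * (?W * ?A\<^sup>2)"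
    by (simp add: \<phi>(2) power2_eq_square mult_ac)
qed

end

section \<open>Fourier series on the circle\<close>

definition cexp :: "int \<Rightarrow> real \<Rightarrow> complex" where
  "cexp n x = cis (of_int n * x)"

lemma exp_eq_cexp: "exp (\<i> * of_int n * of_real x) = cexp n x"
  by (simp add: cexp_def cis_conv_exp mult.assoc)

lemma exp_minus_eq_cexp: "exp (- \<i> * of_int n * of_real x) = cexp (- n) x"
  by (simp add: cexp_def cis_conv_exp mult.assoc)

lemma norm_cexp [simp]: "cmod (cexp n x) = 1" by (simp add: cexp_def)

lemma cexp_0 [simp]: "cexp 0 x = 1"
  by (simp add: cexp_def)

lemma cexp_add: "cexp (m + n) x = cexp m x * cexp n x"
  by (simp add: cexp_def cis_mult distrib_right)

lemma cexp_diff_arg: "cexp n (x - y) = cexp n x * cexp (- n) y"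
  by (simp add: cexp_def cis_mult right_diff_distrib)

lemma cnj_cexp: "cnj (cexp n x) = cexp (- n) x"
  by (simp add: cexp_def cis_cnj)

lemma cexp_periodic: "cexp n (x + 2 * pi) = cexp n x"
proof -
  have "cis (of_int n * (2 * pi)) = 1"
    using cis_multiple_2pi[of "of_int n"] by (simp add: mult_ac)
  then show ?thesis by (simp add: cexp_def distrib_left cis_mult[symmetric])
qed

lemma continuous_on_cexp [continuous_intros]: "continuous_on A (cexp n)"
  unfolding cexp_def[abs_def] by (intro continuous_intros)

lemma has_vector_derivative_cexp:
  "((cexp n) has_vector_derivative (\<i> * of_int n * cexp n x)) (at x within A)"
  unfolding cexp_def[abs_def] cis_conv_exp
  by (auto intro!: derivative_eq_intros has_vector_derivative_real_field simp: mult_ac)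

lemma borel_measurable_circle: "continuous_on UNIV f \<Longrightarrow> f \<in> borel_measurable circle_measure"
  for f :: "real \<Rightarrow> 'a::euclidean_space"
  by (rule continuous_imp_measurable_on_sets_lebesgue) (auto intro: continuous_on_subset)

lemma measurable_cexp [measurable]: "cexp n \<in> borel_measurable circle_measure"
  by (intro borel_measurable_circle continuous_intros)

lemma fourier_coeff_cexp: "fourier_coeff f n = (LINT x|circle_measure. f x * cexp (- n) x)"
  unfolding fourier_coeff_def exp_minus_eq_cexp ..

lemma integrable_mult_bounded:
  fixes f g :: "'a \<Rightarrow> complex"
  assumes f: "integrable M f" and [measurable]: "g \<in> borel_measurable M" and B: "AE x in M. cmod (g x) \<le> B"
  shows "integrable M (\<lambda>x. f x * g x)"
proof (rule Bochner_Integration.integrable_bound)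
  show "integrable M (\<lambda>x. of_real B * f x)" using f by simp
  show "(\<lambda>x. f x * g x) \<in> borel_measurable M" using f by measurable
  show "AE x in M. norm (f x * g x) \<le> norm (of_real B * f x)"
    using B
  proof eventually_elim
    case (elim x)
    then have "cmod (f x) * cmod (g x) \<le> cmod (f x) * B" "0 \<le> B"
      using order.trans[OF norm_ge_zero elim] by (auto intro: mult_left_mono)
    then show ?case by (simp add: norm_mult mult.commute)
  qed
qed

lemma integrable_mult_cexp: "integrable circle_measure f \<Longrightarrow> integrable circle_measure (\<lambda>x. f x * cexp n x)"
  by (rule integrable_mult_bounded[where B = 1]) auto

lemma fourier_coeff_mult_cexp: "fourier_coeff (\<lambda>x. f x * cexp m x) n = fourier_coeff f (n - m)"
  unfolding fourier_coeff_cexp by (simp add: mult.assoc flip: cexp_add)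

lemma fourier_coeff_linear:
  assumes "integrable circle_measure f" "integrable circle_measure g"
  shows "fourier_coeff (\<lambda>x. f x + g x) n = fourier_coeff f n + fourier_coeff g n"
    "fourier_coeff (\<lambda>x. f x - g x) n = fourier_coeff f n - fourier_coeff g n"
  unfolding fourier_coeff_cexp distrib_right left_diff_distrib
  using assms by (simp_all add: integrable_mult_cexp)

lemma fourier_coeff_cmult: "fourier_coeff (\<lambda>x. c * f x) n = c * fourier_coeff f n"
  unfolding fourier_coeff_cexp by (simp add: mult.assoc)

lemma fourier_coeff_cong_AE:
  assumes "f \<in> borel_measurable circle_measure" "g \<in> borel_measurable circle_measure"
    "AE x in circle_measure. f x = g x"
  shows "fourier_coeff f n = fourier_coeff g n"
  unfolding fourier_coeff_cexp
  by (rule integral_cong_AE) (use assms in \<open>auto elim: eventually_mono\<close>)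

lemma norm_fourier_coeff_le:
  assumes "integrable circle_measure f"
  shows "cmod (fourier_coeff f n) \<le> (LINT x|circle_measure. cmod (f x))"
  unfolding fourier_coeff_cexp
  using integral_norm_bound[of circle_measure "\<lambda>x. f x * cexp (- n) x"] by (simp add: norm_mult)

lemma integrable_circle: "continuous_on UNIV f \<Longrightarrow> integrable circle_measure f"
  for f :: "real \<Rightarrow> 'a::euclidean_space"
  by (rule continuous_imp_integrable_real) (auto intro: continuous_on_subset)

lemma integral_circle: "continuous_on UNIV f \<Longrightarrow> (LINT x|circle_measure. f x) = integral {0..2*pi} f"
  for f :: "real \<Rightarrow> 'a::euclidean_space"
  by (rule lebesgue_integral_eq_integral) (auto intro: integrable_circle)

lemma integral_circle_deriv:
  fixes f :: "real \<Rightarrow> complex"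
  assumes "\<And>x. (f has_vector_derivative f' x) (at x)" "continuous_on UNIV f'" "f (2 * pi) = f 0"
  shows "(LINT x|circle_measure. f' x) = 0"
proof -
  have "(f' has_integral (f (2 * pi) - f 0)) {0..2 * pi}"
    by (rule fundamental_theorem_of_calculus)
       (use assms in \<open>auto intro: has_vector_derivative_at_within\<close>)
  then show ?thesis
    using assms by (simp add: integral_circle integral_unique)
qed

lemma integral_cexp: "(LINT x|circle_measure. cexp n x) = (if n = 0 then 2 * pi else 0)"
proof (cases "n = 0")
  case True
  then show ?thesis
    using integral_circle[of "\<lambda>_. 1::complex"] by (simp add: scaleR_conv_of_real)
next
  case False
  let ?f = "\<lambda>x. cexp n x / (\<i> * of_int n)"
  have "(?f has_vector_derivative cexp n x) (at x)" for x
    using False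
    by (auto intro!: derivative_eq_intros has_vector_derivative_cexp has_vector_derivative_divide
        simp: field_simps)
  from integral_circle_deriv[OF this] show ?thesis
    using False cexp_periodic[of n 0] by (simp add: continuous_intros)
qed

definition box_int :: "nat \<Rightarrow> int set" where "box_int R = {- int R..int R}"

lemma finite_box_int [simp]: "finite (box_int R)" by (simp add: box_int_def)

text \<open>Unordered sums come without a sequence of partial sums; the boxes supply one, so that
  dominated convergence for sequences applies.\<close>

lemma filterlim_box_int: "filterlim box_int (finite_subsets_at_top UNIV) sequentially"
  unfolding filterlim_finite_subsets_at_top
proof safe
  fix X :: "int set" assume X: "finite X"
  then obtain b where b: "\<forall>x\<in>X. \<bar>x\<bar> \<le> b"
    by (metis finite_imageI Max_ge imageI)
  show "\<forall>\<^sub>F R in sequentially. finite (box_int R) \<and> X \<subseteq> box_int R \<and> box_int R \<subseteq> UNIV"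
    using eventually_ge_at_top[of "nat b"]
  proof eventually_elim
    case (elim R)
    have "x \<in> box_int R" if "x \<in> X" for x
      using b[rule_format, OF that] elim by (auto simp: box_int_def)
    then show ?case by auto
  qed
qed

lemma has_sum_box_int:
  fixes f :: "int \<Rightarrow> 'a::{comm_monoid_add, topological_space}"
  shows "(f has_sum S) UNIV \<Longrightarrow> (\<lambda>R. \<Sum>n\<in>box_int R. f n) \<longlonglongrightarrow> S"
  unfolding has_sum_def by (rule filterlim_compose[OF _ filterlim_box_int])

text \<open>Fourier inversion; 1/(2 pi) compensates for the unnormalised coefficients.\<close>

definition synth :: "(int \<Rightarrow> complex) \<Rightarrow> real \<Rightarrow> complex" where
  "synth a x = of_real (1 / (2 * pi)) * (\<Sum>\<^sub>\<infinity>n. a n * cexp n x)"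

lemma synth_summable: "in_l1 a \<Longrightarrow> (\<lambda>n. a n * cexp n x) summable_on UNIV"
  by (rule norm_infsum_le_infsum(1)) (auto simp: norm_mult)

lemma norm_synth_le: "in_l1 a \<Longrightarrow> cmod (synth a x) \<le> l1_norm a"
proof -
  assume a: "in_l1 a"
  have "cmod (\<Sum>\<^sub>\<infinity>n. a n * cexp n x) \<le> l1_norm a"
    unfolding l1_norm_def by (rule norm_infsum_le_infsum(2)[OF a]) (auto simp: norm_mult)
  moreover have "1 \<le> 2 * pi" using pi_gt3 by simp
  ultimately show ?thesis
    using l1_norm_nonneg[of a] mult_mono[of "1 / (2*pi)" 1 "cmod (\<Sum>\<^sub>\<infinity>n. a n * cexp n x)" "l1_norm a"]
    by (simp add: synth_def norm_mult norm_divide)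
qed

lemma synth_partial: "in_l1 a \<Longrightarrow> (\<lambda>R. of_real (1 / (2 * pi)) * (\<Sum>n\<in>box_int R. a n * cexp n x)) \<longlonglongrightarrow> synth a x"
  unfolding synth_def by (intro tendsto_intros has_sum_box_int has_sum_infsum synth_summable)

lemma measurable_synth [measurable]:
  assumes "in_l1 a"
  shows "synth a \<in> borel_measurable circle_measure"
proof (rule borel_measurable_LIMSEQ_metric)
  show "(\<lambda>x. of_real (1 / (2 * pi)) * (\<Sum>n\<in>box_int R. a n * cexp n x)) \<in> borel_measurable circle_measure" for R
    by measurable
qed (rule synth_partial[OF assms])

lemma integrable_mult_synth:
  "in_l1 a \<Longrightarrow> integrable circle_measure f \<Longrightarrow> integrable circle_measure (\<lambda>x. f x * synth a x)"
  by (rule integrable_mult_bounded[where B = "l1_norm a"]) (auto simp: norm_synth_le)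

text \<open>A Parseval identity between absolutely summable coefficients and a merely integrable
  function, as needed for a potential in L^1. The partial sums are bounded by the l^1 norm, so a
  multiple of |f| dominates the integrands.\<close>

lemma integral_mult_synth:
  assumes a: "in_l1 a" and f: "integrable circle_measure f"
  shows "(LINT x|circle_measure. f x * synth a x) = of_real (1 / (2 * pi)) * (\<Sum>\<^sub>\<infinity>n. a n * fourier_coeff f (- n))"
proof -
  let ?s = "\<lambda>R x. f x * (of_real (1 / (2 * pi)) * (\<Sum>n\<in>box_int R. a n * cexp n x))"
  note fc = integrable_mult_cexp[OF f]
  have f_meas [measurable]: "f \<in> borel_measurable circle_measure" using f by simp
  have bd: "cmod (\<Sum>n\<in>box_int R. a n * cexp n x) \<le> l1_norm a" for R x
  proof -
    have "cmod (\<Sum>n\<in>box_int R. a n * cexp n x) \<le> (\<Sum>n\<in>box_int R. cmod (a n))"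
      by (intro sum_norm_le) (simp add: norm_mult)
    also have "\<dots> \<le> l1_norm a"
      unfolding l1_norm_def by (rule finite_sum_le_infsum[OF a]) auto
    finally show ?thesis .
  qed
  have "(\<lambda>R. LINT x|circle_measure. ?s R x) \<longlonglongrightarrow> (LINT x|circle_measure. f x * synth a x)"
  proof (rule integral_dominated_convergence[where w = "\<lambda>x. l1_norm a * cmod (f x)"])
    show "(\<lambda>x. f x * synth a x) \<in> borel_measurable circle_measure" using a by measurable
    show "AE x in circle_measure. (\<lambda>R. ?s R x) \<longlonglongrightarrow> f x * synth a x"
      by (intro AE_I2 tendsto_mult_left synth_partial a)
    show "AE x in circle_measure. norm (?s R x) \<le> l1_norm a * cmod (f x)" for R
    proof (rule AE_I2)
      fix x
      have "1 \<le> 2 * pi" using pi_gt3 by simp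
      then have "1 / (2 * pi) * cmod (\<Sum>n\<in>box_int R. a n * cexp n x) \<le> 1 * l1_norm a"
        using bd[where R = R and x = x] by (intro mult_mono) auto
      from mult_left_mono[OF this norm_ge_zero[of "f x"]]
      show "norm (?s R x) \<le> l1_norm a * cmod (f x)"
        by (simp add: norm_mult norm_divide mult_ac)
    qed
  qed (use f in auto)
  also have "(\<lambda>R. LINT x|circle_measure. ?s R x)
    = (\<lambda>R. of_real (1 / (2 * pi)) * (\<Sum>n\<in>box_int R. a n * fourier_coeff f (- n)))"
  proof
    fix R
    have "?s R x = of_real (1 / (2 * pi)) * (\<Sum>n\<in>box_int R. a n * (f x * cexp n x))" for x
      by (simp add: sum_distrib_left mult_ac)
    then show "(LINT x|circle_measure. ?s R x)
      = of_real (1 / (2 * pi)) * (\<Sum>n\<in>box_int R. a n * fourier_coeff f (- n))"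
      using fc by (simp add: fourier_coeff_cexp)
  qed
  finally have 1: "(\<lambda>R. of_real (1 / (2 * pi)) * (\<Sum>n\<in>box_int R. a n * fourier_coeff f (- n)))
    \<longlonglongrightarrow> (LINT x|circle_measure. f x * synth a x)" .
  have "(\<lambda>n. a n * fourier_coeff f (- n)) summable_on UNIV"
  proof (rule norm_infsum_le_infsum(1))
    show "(\<lambda>n. cmod (a n) * (LINT x|circle_measure. cmod (f x))) summable_on UNIV"
      by (rule summable_on_cmult_left[OF a])
  qed (auto simp: norm_mult intro!: mult_left_mono norm_fourier_coeff_le f)
  then have "(\<lambda>R. of_real (1 / (2 * pi)) * (\<Sum>n\<in>box_int R. a n * fourier_coeff f (- n)))
    \<longlonglongrightarrow> of_real (1 / (2 * pi)) * (\<Sum>\<^sub>\<infinity>n. a n * fourier_coeff f (- n))"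
    by (intro tendsto_mult_left has_sum_box_int has_sum_infsum)
  from LIMSEQ_unique[OF 1 this] show ?thesis .
qed

lemma fourier_coeff_const_cexp: "fourier_coeff (cexp m) n = (if n = m then 2 * pi else 0)"
  unfolding fourier_coeff_cexp by (simp add: integral_cexp flip: cexp_add)

lemma integrable_synth: "in_l1 a \<Longrightarrow> integrable circle_measure (synth a)"
  using integrable_mult_synth[of a "\<lambda>_. 1"] integrable_circle[of "\<lambda>_. 1::complex"] by simp

lemma fourier_coeff_synth: assumes "in_l1 a" shows "fourier_coeff (synth a) n = a n"
proof -
  have "fourier_coeff (synth a) n = (LINT x|circle_measure. cexp (- n) x * synth a x)"
    by (simp add: fourier_coeff_cexp mult.commute)
  also have "\<dots> = of_real (1 / (2 * pi)) * (\<Sum>\<^sub>\<infinity>m. a m * fourier_coeff (cexp (- n)) (- m))"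
    by (rule integral_mult_synth[OF assms]) (intro integrable_circle continuous_intros)
  also have "(\<lambda>m. a m * fourier_coeff (cexp (- n)) (- m)) = (\<lambda>m. if m = n then 2 * pi * a n else 0)"
    by (auto simp: fourier_coeff_const_cexp fun_eq_iff)
  also have "(\<Sum>\<^sub>\<infinity>m. if m = n then 2 * pi * a n else 0) = 2 * pi * a n"
    using infsum_cong_neutral[of "{n}" UNIV "\<lambda>m. if m = n then 2 * pi * a n else 0"
        "\<lambda>m. if m = n then 2 * pi * a n else 0"] by simp
  finally show ?thesis by simp
qed

section \<open>Uniqueness of Fourier coefficients\<close>

definition null_coeffs :: "(real \<Rightarrow> complex) \<Rightarrow> bool" where
  "null_coeffs h \<longleftrightarrow> integrable circle_measure h \<and> (\<forall>n. fourier_coeff h n = 0)"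

lemma null_coeffs_integral: "null_coeffs h \<Longrightarrow> (LINT x|circle_measure. h x) = 0"
  using fourier_coeff_cexp[of h 0] by (simp add: null_coeffs_def)

lemma null_coeffs_closed:
  assumes "null_coeffs f"
  shows "null_coeffs (\<lambda>x. c * f x)" "null_coeffs (\<lambda>x. f x * cexp n x)"
    "null_coeffs g \<Longrightarrow> null_coeffs (\<lambda>x. f x + g x)"
  using assms fourier_coeff_cmult[of c f]
  by (auto simp: null_coeffs_def fourier_coeff_linear fourier_coeff_mult_cexp integrable_mult_cexp)

text \<open>On the unit circle a real linear functional is a combination of \<open>cexp 1\<close>
  and \<open>cexp (- 1)\<close>, and multiplication by these only shifts the coefficients. Products
  of polynomials are handled by applying the induction hypothesis twice, hence the generalisation
  over \<open>h\<close>.\<close>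

lemma null_coeffs_polynomial:
  assumes "real_polynomial_function p"
  shows "null_coeffs h \<Longrightarrow> null_coeffs (\<lambda>x. h x * of_real (p (cis x)))"
  using assms
proof (induction arbitrary: h rule: real_polynomial_function.induct)
  case (linear f)
  have *: "of_real (f (cis x)) = cexp 1 x * ((f 1 - \<i> * f \<i>) / 2) + cexp (- 1) x * ((f 1 + \<i> * f \<i>) / 2)" for x
  proof -
    have "cis x = cos x *\<^sub>R 1 + sin x *\<^sub>R \<i>" by (simp add: complex_eq_iff)
    then have "f (cis x) = cos x * f 1 + sin x * f \<i>"
      using linear(1) by (simp add: linear_simps)
    then show ?thesis by (simp add: cexp_def complex_eq_iff field_simps)
  qed
  have "h x * of_real (f (cis x)) = ((f 1 - \<i> * f \<i>) / 2) * (h x * cexp 1 x) + ((f 1 + \<i> * f \<i>) / 2) * (h x * cexp (- 1) x)" for x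
    unfolding * by (simp add: algebra_simps)
  then show ?case
    by (simp only:) (intro null_coeffs_closed linear(2))
next
  case (const c)
  then show ?case
    using fourier_coeff_cmult[of "of_real c" h] by (simp add: null_coeffs_def mult.commute)
next
  case (add f g)
  then show ?case
    using fourier_coeff_linear(1)[of "\<lambda>x. h x * of_real (f (cis x))" "\<lambda>x. h x * of_real (g (cis x))"]
    by (simp add: null_coeffs_def distrib_left)
next
  case (mult f g)
  from mult.IH(2)[OF mult.IH(1)[OF mult.prems]] show ?case by (simp add: mult.assoc)
qed

text \<open>The argument function jumps at the positive axis, but the equal endpoint values hide the
  jump. Continuity is obtained from closed preimages, which are images of compact sets under
  \<open>cis\<close>.\<close>

lemma continuous_on_circle_factor:
  fixes \<phi> :: "real \<Rightarrow> real"
  assumes \<phi>: "continuous_on {0..2 * pi} \<phi>" "\<phi> 0 = \<phi> (2 * pi)"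
  obtains q where "continuous_on (sphere 0 1) q" "\<And>x. x \<in> {0..2 * pi} \<Longrightarrow> q (cis x) = \<phi> x"
proof
  let ?q = "\<lambda>z. \<phi> (Arg2pi z)"
  show q: "?q (cis x) = \<phi> x" if "x \<in> {0..2 * pi}" for x
  proof (cases "x = 2 * pi")
    case True
    then show ?thesis using \<phi>(2) Arg2pi_exp[of 0] by simp
  next
    case False
    then have "Arg2pi (cis x) = x"
      using that Arg2pi_exp[of "\<i> * of_real x"] by (simp add: cis_conv_exp)
    then show ?thesis by simp
  qed
  have cis_on: "cis ` {0..2 * pi} = sphere 0 1"
  proof
    show "sphere 0 1 \<subseteq> cis ` {0..2 * pi}"
    proof
      fix z :: complex assume "z \<in> sphere 0 1"
      then have "cis (Arg2pi z) = z"
        by (simp add: cis_conv_exp complex_norm_eq_1_exp)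
      then show "z \<in> cis ` {0..2 * pi}"
        using Arg2pi[of z] by (intro image_eqI[of _ _ "Arg2pi z"]) auto
    qed
  qed auto
  show "continuous_on (sphere 0 1) ?q"
    unfolding continuous_on_closed_vimage[OF closed_sphere]
  proof (intro allI impI)
    fix B :: "real set" assume "closed B"
    have "?q -` B \<inter> sphere 0 1 = cis ` ({0..2 * pi} \<inter> \<phi> -` B)"
      unfolding cis_on[symmetric] using q by auto
    moreover have "compact ({0..2 * pi} \<inter> \<phi> -` B)"
      unfolding compact_eq_bounded_closed
      using continuous_closed_preimage[OF \<phi>(1) closed_atLeastAtMost \<open>closed B\<close>]
        bounded_subset[OF bounded_closed_interval[of 0 "2 * pi"]]
      by simp
    moreover have "continuous_on ({0..2 * pi} \<inter> \<phi> -` B) cis"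
      by (intro continuous_intros)
    ultimately show "closed (?q -` B \<inter> sphere 0 1)"
      using compact_imp_closed[OF compact_continuous_image] by simp
  qed
qed

text \<open>By Stone-Weierstrass on the unit circle, a periodic continuous function is uniformly
  close to a polynomial in \<open>cis x\<close>, against which \<open>h\<close> integrates to
  0.\<close>

lemma null_coeffs_continuous:
  fixes \<phi> :: "real \<Rightarrow> real"
  assumes h: "null_coeffs h" and \<phi>: "continuous_on {0..2 * pi} \<phi>" "\<phi> 0 = \<phi> (2 * pi)"
  shows "(LINT x|circle_measure. h x * of_real (\<phi> x)) = 0"
proof -
  obtain q where q: "continuous_on (sphere 0 1) q" "\<And>x. x \<in> {0..2 * pi} \<Longrightarrow> q (cis x) = \<phi> x"
    using continuous_on_circle_factor[OF \<phi>] by blast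
  have ih: "integrable circle_measure h" using h by (simp add: null_coeffs_def)
  have m: "(\<lambda>x. complex_of_real (\<phi> x)) \<in> borel_measurable circle_measure"
    by (rule continuous_imp_measurable_on_sets_lebesgue) (auto intro!: continuous_intros \<phi>)
  obtain B where B: "\<And>x. x \<in> {0..2 * pi} \<Longrightarrow> \<bar>\<phi> x\<bar> \<le> B"
    using compact_imp_bounded[OF compact_continuous_image[OF \<phi>(1) compact_Icc]]
    unfolding bounded_iff by (metis imageI real_norm_def)
  have ihp: "integrable circle_measure (\<lambda>x. h x * of_real (\<phi> x))"
    by (rule integrable_mult_bounded[OF ih m, of B]) (intro AE_I2, simp add: B)
  have "cmod (LINT x|circle_measure. h x * of_real (\<phi> x)) \<le> e * (1 + (LINT x|circle_measure. cmod (h x)))"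
    if e: "e > 0" for e
  proof -
    obtain p where p: "real_polynomial_function p" "\<And>z. z \<in> sphere 0 1 \<Longrightarrow> \<bar>q z - p z\<bar> < e"
      using Stone_Weierstrass_real_polynomial_function[OF compact_sphere q(1) e] by blast
    have np: "null_coeffs (\<lambda>x. h x * of_real (p (cis x)))"
      by (rule null_coeffs_polynomial[OF p(1) h])
    then have inp: "integrable circle_measure (\<lambda>x. h x * of_real (p (cis x)))"
      by (simp add: null_coeffs_def)
    have "(LINT x|circle_measure. h x * of_real (\<phi> x))
      = (LINT x|circle_measure. h x * of_real (\<phi> x) - h x * of_real (p (cis x)))"
      using ihp inp null_coeffs_integral[OF np] by simp
    also have "cmod \<dots> \<le> (LINT x|circle_measure. e * cmod (h x))"
    proof (rule order.trans[OF integral_norm_bound], rule integral_mono)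
      show "integrable circle_measure (\<lambda>x. cmod (h x * of_real (\<phi> x) - h x * of_real (p (cis x))))"
        using ihp inp by simp
      show "integrable circle_measure (\<lambda>x. e * cmod (h x))" using ih by simp
      fix x assume "x \<in> space circle_measure"
      then have x: "x \<in> {0..2 * pi}" by simp
      have "\<bar>\<phi> x - p (cis x)\<bar> \<le> e"
        using p(2)[of "cis x"] q(2)[OF x] by simp
      from mult_left_mono[OF this norm_ge_zero[of "h x"]]
      show "cmod (h x * of_real (\<phi> x) - h x * of_real (p (cis x))) \<le> e * cmod (h x)"
        by (simp add: norm_mult mult.commute flip: right_diff_distrib of_real_diff)
    qed
    also have "\<dots> \<le> e * (1 + (LINT x|circle_measure. cmod (h x)))"
      using e by simp
    finally show ?thesis .
  qed
  then have "cmod (LINT x|circle_measure. h x * of_real (\<phi> x)) \<le> 0"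
  proof -
    assume *: "\<And>e. e > 0 \<Longrightarrow> cmod (LINT x|circle_measure. h x * of_real (\<phi> x)) \<le> e * (1 + (LINT x|circle_measure. cmod (h x)))"
    \<comment> \<open>The summand 1 keeps the factor positive, so that the tolerance may be rescaled
      by it.\<close>
    let ?c = "1 + (LINT x|circle_measure. cmod (h x))"
    have c: "?c > 0" by (simp add: add_pos_nonneg)
    show ?thesis
    proof (rule field_le_epsilon)
      fix e :: real assume "e > 0"
      then show "cmod (LINT x|circle_measure. h x * of_real (\<phi> x)) \<le> 0 + e"
        using *[of "e / ?c"] c by simp
    qed
  qed
  then show ?thesis by simp
qed

text \<open>A bounded measurable function is an almost-everywhere limit of continuous ones, and |h|
  dominates the products once the approximants are clipped to [-1, 1].\<close>

lemma null_coeffs_bounded: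
  fixes \<psi> :: "real \<Rightarrow> real"
  assumes h: "null_coeffs h" and \<psi>: "\<psi> \<in> borel_measurable circle_measure" "\<And>x. \<bar>\<psi> x\<bar> \<le> 1"
  shows "(LINT x|circle_measure. h x * of_real (\<psi> x)) = 0"
proof -
  let ?I = "{0..2 * pi} :: real set"
  have ih: "integrable circle_measure h" using h by (simp add: null_coeffs_def)
  have "(\<lambda>x. if x \<in> ?I then \<psi> x else 0) \<in> borel_measurable (lebesgue_on UNIV)"
    using \<psi>(1) by (subst borel_measurable_if_lebesgue_on) auto
  then have "(\<lambda>x. if x \<in> ?I then \<psi> x else 0) \<in> borel_measurable lebesgue"
    by (simp add: lebesgue_on_UNIV_eq)
  then have "(\<lambda>x. if x \<in> ?I then \<psi> x else 0) measurable_on UNIV"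
    by (rule lebesgue_measurable_imp_measurable_on_real) simp
  then obtain N g where N: "negligible N" and g: "\<And>n. continuous_on UNIV (g n)"
    and lim: "\<And>x. x \<notin> N \<Longrightarrow> (\<lambda>n. g n x) \<longlonglongrightarrow> (if x \<in> ?I then \<psi> x else 0)"
    unfolding measurable_on_def by auto
  \<comment> \<open>A ramp that vanishes at both endpoints and tends to 1 inside. It makes the
    approximants periodic at the cost of two points.\<close>
  define k where "k n x = min 1 (min (real n * x) (real n * (2 * pi - x)))" for n x
  define G where "G n x = max (- 1) (min 1 (g n x)) * k n x" for n x
  have cont: "continuous_on ?I (G n)" for n
    unfolding G_def k_def by (intro continuous_intros continuous_on_subset[OF g]) auto
  have G0: "G n 0 = 0" "G n (2 * pi) = 0" for n
    by (auto simp: G_def k_def)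
  have Gb: "\<bar>G n x\<bar> \<le> 1" if "x \<in> ?I" for n x
  proof -
    have "\<bar>k n x\<bar> \<le> 1" using that by (auto simp: k_def abs_le_iff min_def mult_nonneg_nonneg)
    then show ?thesis unfolding G_def abs_mult by (intro mult_le_one) auto
  qed
  have lim2: "(\<lambda>n. G n x) \<longlonglongrightarrow> \<psi> x" if "x \<notin> N" "x \<in> ?I" "x \<noteq> 0" "x \<noteq> 2 * pi" for x
  proof -
    have x: "0 < x" "0 < 2 * pi - x" using that by auto
    have "eventually (\<lambda>n. k n x = 1) sequentially"
    proof -
      obtain M where M: "1 / x < real M" "1 / (2 * pi - x) < real M"
        by (meson less_le_trans linorder_le_cases reals_Archimedean2 order.strict_trans2)
      show ?thesis
        using eventually_ge_at_top[of M]
      proof eventually_elim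
        case (elim n)
        then have "1 / x \<le> real n" "1 / (2 * pi - x) \<le> real n" using M by linarith+
        then show ?case using x by (simp add: k_def field_simps)
      qed
    qed
    then have "(\<lambda>n. k n x) \<longlonglongrightarrow> 1" by (rule tendsto_eventually)
    moreover have "(\<lambda>n. max (- 1) (min 1 (g n x))) \<longlonglongrightarrow> max (- 1) (min 1 (\<psi> x))"
      using lim[OF that(1)] that(2) by (intro tendsto_intros) simp
    ultimately have "(\<lambda>n. G n x) \<longlonglongrightarrow> max (- 1) (min 1 (\<psi> x)) * 1"
      unfolding G_def by (rule tendsto_mult[rotated])
    moreover have "max (- 1) (min 1 (\<psi> x)) = \<psi> x" using \<psi>(2)[of x] by auto
    ultimately show ?thesis by simp
  qed
  have "(\<lambda>n. LINT x|circle_measure. h x * of_real (G n x)) \<longlonglongrightarrow> (LINT x|circle_measure. h x * of_real (\<psi> x))"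
  proof (rule integral_dominated_convergence[where w = "\<lambda>x. cmod (h x)"])
    show "(\<lambda>x. h x * of_real (\<psi> x)) \<in> borel_measurable circle_measure"
      using ih \<psi>(1) by measurable
    show "(\<lambda>x. h x * of_real (G n x)) \<in> borel_measurable circle_measure" for n
    proof -
      have "G n \<in> borel_measurable circle_measure"
        by (rule continuous_imp_measurable_on_sets_lebesgue[OF cont]) simp
      then show ?thesis using ih by measurable
    qed
    show "AE x in circle_measure. norm (h x * of_real (G n x)) \<le> cmod (h x)" for n
      using Gb by (intro AE_I2) (auto simp: norm_mult mult_left_le)
    have "negligible (N \<union> {0, 2 * pi})"
      using N by (simp add: negligible_Un_eq)
    then have "AE x in lebesgue. x \<notin> N \<union> {0, 2 * pi}"
      using AE_not_in unfolding negligible_iff_null_sets by blast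
    then have "AE x in circle_measure. x \<notin> N \<union> {0, 2 * pi}"
      by (subst AE_restrict_space_iff) (simp, elim eventually_mono, blast)
    then show "AE x in circle_measure. (\<lambda>n. h x * of_real (G n x)) \<longlonglongrightarrow> h x * of_real (\<psi> x)"
    proof (rule AE_mp, intro AE_I2 impI)
      fix x assume "x \<in> space circle_measure" "x \<notin> N \<union> {0, 2 * pi}"
      then show "(\<lambda>n. h x * of_real (G n x)) \<longlonglongrightarrow> h x * of_real (\<psi> x)"
        by (intro tendsto_mult_left tendsto_of_real lim2) auto
    qed
  qed (use ih in auto)
  moreover have "(LINT x|circle_measure. h x * of_real (G n x)) = 0" for n
    by (rule null_coeffs_continuous[OF h cont]) (simp add: G0)
  ultimately show ?thesis by (simp add: LIMSEQ_const_iff)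
qed

text \<open>\<open>h\<close> is only integrable, so it cannot be tested against itself. The bounded
  function r/(1 + |r|), with r the real or imaginary part, has the same sign, and the product is
  nonnegative with integral 0.\<close>

lemma null_coeffs_AE: assumes h: "null_coeffs h" shows "AE x in circle_measure. h x = 0"
proof -
  have ih: "integrable circle_measure h" using h by (simp add: null_coeffs_def)
  have hm [measurable]: "h \<in> borel_measurable circle_measure" using ih by simp
  have part: "AE x in circle_measure. r (h x) = 0"
    if r: "r = Re \<or> r = Im" for r
  proof -
    let ?\<psi> = "\<lambda>x. r (h x) / (1 + \<bar>r (h x)\<bar>)"
    have [measurable]: "(\<lambda>x. r (h x)) \<in> borel_measurable circle_measure"
      using r by (auto intro: measurable_compose[OF hm])
    have \<psi>: "?\<psi> \<in> borel_measurable circle_measure" by measurable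
    have \<psi>1: "\<bar>?\<psi> x\<bar> \<le> 1" for x by (simp add: field_simps add_pos_nonneg)
    have int: "integrable circle_measure (\<lambda>x. h x * of_real (?\<psi> x))"
      by (rule integrable_mult_bounded[OF ih, where B = 1])
         (use \<psi> in measurable, intro AE_I2, use \<psi>1 in \<open>simp add: norm_of_real del: of_real_divide\<close>)
    have bl: "bounded_linear r" using r bounded_linear_Re bounded_linear_Im by auto
    have rm: "r (z * of_real c) = r z * c" for z c using r by auto
    have "(LINT x|circle_measure. r (h x) * ?\<psi> x) = r (LINT x|circle_measure. h x * of_real (?\<psi> x))"
      using integral_bounded_linear[OF bl int] by (simp add: rm del: of_real_divide)
    also have "\<dots> = 0"
      using null_coeffs_bounded[OF h \<psi> \<psi>1] linear_0[OF bounded_linear.linear[OF bl]] by simp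
    finally have "(LINT x|circle_measure. r (h x) * ?\<psi> x) = 0" .
    moreover have "integrable circle_measure (\<lambda>x. r (h x) * ?\<psi> x)"
      using integrable_bounded_linear[OF bl int] by (simp add: rm del: of_real_divide)
    ultimately have "AE x in circle_measure. r (h x) * ?\<psi> x = 0"
      by (subst (asm) integral_nonneg_eq_0_iff_AE) (auto intro!: divide_nonneg_nonneg)
    then show ?thesis
      by eventually_elim (auto simp: add_nonneg_eq_0_iff)
  qed
  show ?thesis
    using part[of Re] part[of Im] by (auto simp: complex_eq_iff elim: eventually_elim2)
qed

text \<open>It identifies a function with the sum of its absolutely convergent Fourier series, and
  the chosen weak derivative with the one constructed from coefficients.\<close>

theorem fourier_coeff_unique:
  assumes "integrable circle_measure f" "integrable circle_measure g" "\<And>n. fourier_coeff f n = fourier_coeff g n"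
  shows "AE x in circle_measure. f x = g x"
proof -
  have "null_coeffs (\<lambda>x. f x - g x)"
    using assms by (simp add: null_coeffs_def fourier_coeff_linear)
  from null_coeffs_AE[OF this] show ?thesis by simp
qed

lemma AE_eq_synth:
  assumes "integrable circle_measure f" "in_l1 (fourier_coeff f)"
  shows "AE x in circle_measure. f x = synth (fourier_coeff f) x"
  by (rule fourier_coeff_unique) (use assms in \<open>auto simp: integrable_synth fourier_coeff_synth\<close>)

section \<open>Products, convolutions and the Hartree nonlinearity in Fourier space\<close>

lemma synth_cmult: "synth (\<lambda>n. c * a n) x = c * synth a x"
  unfolding synth_def mult.assoc by (simp add: infsum_cmult_right')

lemma in_l1_cmult: "in_l1 a \<Longrightarrow> in_l1 (\<lambda>n. c * a n)"
  by (simp add: norm_mult summable_on_cmult_right)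

text \<open>The left side carries two factors 1/(2 pi) and \<open>synth\<close> only one; the other
  goes into the coefficients.\<close>

lemma synth_mult:
  assumes a: "in_l1 a" and b: "in_l1 b"
  shows "synth a x * synth b x = synth (\<lambda>n. of_real (1 / (2 * pi)) * conv a b n) x"
proof -
  let ?a = "\<lambda>n. a n * cexp n x" and ?b = "\<lambda>n. b n * cexp n x"
  have l: "in_l1 ?a" "in_l1 ?b" using a b by (auto simp: norm_mult)
  have eq: "?a k * ?b (n - k) = a k * b (n - k) * cexp n x" for n k
    using cexp_add[of k "n - k" x] by (simp add: mult_ac)
  have "(\<lambda>(n, k). ?a k * ?b (n - k)) summable_on UNIV \<times> UNIV"
    using conv_summable(1)[OF l] by simp
  note sw = infsum_swap_banach[OF this]
  have shift: "(\<Sum>\<^sub>\<infinity>n. ?b (n - k)) = infsum ?b UNIV" for k :: int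
    by (rule infsum_reindex_bij_witness[of UNIV "\<lambda>n. n + k" "\<lambda>n. n - k"]) auto
  have "(\<Sum>\<^sub>\<infinity>n. conv a b n * cexp n x) = (\<Sum>\<^sub>\<infinity>n. \<Sum>\<^sub>\<infinity>k. ?a k * ?b (n - k))"
    unfolding eq conv_def
    by (intro infsum_cong infsum_cmult_left[symmetric] conv_summable a b)
  also have "\<dots> = (\<Sum>\<^sub>\<infinity>k. \<Sum>\<^sub>\<infinity>n. ?a k * ?b (n - k))"
    by (rule sw)
  also have "\<dots> = (\<Sum>\<^sub>\<infinity>k. ?a k * infsum ?b UNIV)"
    by (simp add: infsum_cmult_right' shift)
  also have "\<dots> = infsum ?a UNIV * infsum ?b UNIV"
    by (rule infsum_cmult_left')
  finally have "infsum ?a UNIV * infsum ?b UNIV = (\<Sum>\<^sub>\<infinity>n. conv a b n * cexp n x)" ..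
  then show ?thesis
    unfolding synth_cmult by (simp add: synth_def)
qed

text \<open>The Fourier coefficients of the complex conjugate of a function: conjugation reverses
  frequencies.\<close>

definition cnj_seq :: "(int \<Rightarrow> complex) \<Rightarrow> int \<Rightarrow> complex" where
  "cnj_seq a n = cnj (a (- n))"

lemma cnj_synth: "cnj (synth a x) = synth (cnj_seq a) x"
proof -
  have "cnj (\<Sum>\<^sub>\<infinity>n. a n * cexp n x) = (\<Sum>\<^sub>\<infinity>n. cnj (a n) * cexp (- n) x)"
    by (simp add: cnj_cexp flip: infsum_cnj)
  also have "\<dots> = (\<Sum>\<^sub>\<infinity>n. cnj_seq a n * cexp n x)"
    unfolding cnj_seq_def by (rule infsum_reindex_bij_witness[of UNIV uminus uminus]) auto
  finally show ?thesis by (simp add: synth_def)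
qed

lemma cnj_seq_l1: "in_l1 (cnj_seq a) \<longleftrightarrow> in_l1 a" "l1_norm (cnj_seq a) = l1_norm a"
proof -
  show "in_l1 (cnj_seq a) \<longleftrightarrow> in_l1 a"
    unfolding cnj_seq_def by (rule summable_on_reindex_bij_witness[of UNIV uminus uminus]) auto
  show "l1_norm (cnj_seq a) = l1_norm a"
    unfolding cnj_seq_def l1_norm_def by (rule infsum_reindex_bij_witness[of UNIV uminus uminus]) auto
qed

section \<open>Reflection on the circle and convolution with the potential\<close>

lemma has_integral_circle_reflect:
  fixes G :: "real \<Rightarrow> 'a::euclidean_space"
  assumes per: "on_circle G" and G: "G integrable_on {0..2 * pi}"
  shows "((\<lambda>y. G (x - y)) has_integral integral {0..2 * pi} G) {0..2 * pi}"
proof -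
  interpret per: periodic_fun_simple G "2 * pi" by (rule per)
  define k where "k = \<lfloor>x / (2 * pi)\<rfloor>"
  \<comment> \<open>Reduction of \<open>x\<close> modulo the period. The reflected integral is then
    cut at \<open>r\<close>, and periodicity moves the piece beyond \<open>r\<close> back into the
    period.\<close>
  define r where "r = x - of_int k * (2 * pi)"
  have "of_int k \<le> x / (2 * pi)" "x / (2 * pi) < of_int k + 1"
    by (auto simp: k_def)
  then have r: "0 \<le> r" "r \<le> 2 * pi"
    by (auto simp: r_def field_simps)
  have Gx: "G (x - y) = G (r - y)" for y
  proof -
    have "G (x - y) = G ((r - y) + of_int k * (2 * pi))" by (simp add: r_def)
    then show ?thesis by (simp only: per.plus_of_int)
  qed
  have refl: "((\<lambda>y. G (c - y)) has_integral integral {a..b} G) {c - b..c - a}"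
    if "a \<le> b" "0 \<le> a" "b \<le> 2 * pi" for a b c
  proof -
    have "(G has_integral integral {a..b} G) (cbox a b)"
      using integrable_subinterval_real[OF G, of a b] that by auto
    from has_integral_affinity[OF this, of "-1" c]
    have "((\<lambda>y. G (c - y)) has_integral integral {a..b} G) ((\<lambda>y. c - y) ` {a..b})"
      by simp
    moreover have "(\<lambda>y. c - y) ` {a..b} = {c - b..c - a}"
      using that image_diff_atLeastAtMost[of c a b] by simp
    ultimately show ?thesis by simp
  qed
  have "((\<lambda>y. G (r - y)) has_integral integral {0..r} G) {0..r}"
    using refl[of 0 r r] r by simp
  moreover have "((\<lambda>y. G (r - y)) has_integral integral {r..2 * pi} G) {r..2 * pi}"
  proof -
    have "G (r + 2 * pi - y) = G (r - y)" for y
      using per.plus_period[of "r - y"] by (simp add: algebra_simps)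
    then show ?thesis using refl[of r "2 * pi" "r + 2 * pi"] r by simp
  qed
  ultimately have "((\<lambda>y. G (r - y)) has_integral integral {0..r} G + integral {r..2 * pi} G) {0..2 * pi}"
    by (rule has_integral_combine[OF r])
  also have "integral {0..r} G + integral {r..2 * pi} G = integral {0..2 * pi} G"
    by (rule Henstock_Kurzweil_Integration.integral_combine[OF r G])
  finally show ?thesis by (simp add: Gx)
qed

lemma integrable_circle_iff:
  fixes G :: "real \<Rightarrow> 'a::euclidean_space"
  shows "integrable circle_measure G \<longleftrightarrow> G absolutely_integrable_on {0..2 * pi}"
  by (simp add: integrable_restrict_space set_integrable_def)

lemma circle_reflect:
  fixes G :: "real \<Rightarrow> 'a::euclidean_space"
  assumes per: "on_circle G" and G: "integrable circle_measure G"
  shows "integrable circle_measure (\<lambda>y. G (x - y))"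
    "(LINT y|circle_measure. G (x - y)) = (LINT y|circle_measure. G y)"
proof -
  have Gi: "G integrable_on {0..2 * pi}" "(\<lambda>y. norm (G y)) integrable_on {0..2 * pi}"
    using G unfolding integrable_circle_iff absolutely_integrable_on_def by auto
  interpret per: periodic_fun_simple G "2 * pi" by (rule per)
  have per2: "on_circle (\<lambda>y. norm (G y))"
    by unfold_locales (simp add: per.plus_1)
  note h = has_integral_circle_reflect[OF per Gi(1), of x] has_integral_circle_reflect[OF per2 Gi(2), of x]
  show 1: "integrable circle_measure (\<lambda>y. G (x - y))"
    unfolding integrable_circle_iff absolutely_integrable_on_def using h by blast
  have "(LINT y|circle_measure. G (x - y)) = integral {0..2 * pi} (\<lambda>y. G (x - y))"
    by (rule lebesgue_integral_eq_integral[OF 1]) simp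
  also have "\<dots> = integral {0..2 * pi} G" by (rule integral_unique[OF h(1)])
  also have "\<dots> = (LINT y|circle_measure. G y)"
    by (rule lebesgue_integral_eq_integral[OF G, symmetric]) simp
  finally show "(LINT y|circle_measure. G (x - y)) = (LINT y|circle_measure. G y)" .
qed

lemma on_circle_compose: "on_circle f \<Longrightarrow> on_circle (\<lambda>x. h (f x))"
  unfolding periodic_fun_simple_def periodic_fun_def by metis

context
  fixes V :: "real \<Rightarrow> real"
  assumes V: "V \<in> L1_circle"
begin

text \<open>The real part gives a real-valued multiplier by definition; for even V nothing is lost,
  the coefficients being real.\<close>

definition "potential_coeff n = Re (fourier_coeff (\<lambda>x. of_real (V x)) n)"

lemma V_int: "integrable circle_measure V" and V_per: "on_circle V"
  using V by (auto simp: L1_circle_def)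

lemma V_intc: "integrable circle_measure (\<lambda>x. complex_of_real (V x))"
  using V_int by simp

lemma V_plus: "V (x + 2 * pi) = V x"
proof -
  interpret periodic_fun_simple V "2 * pi" by (rule V_per)
  show ?thesis by (rule plus_period)
qed

lemma V_cexp_per: "on_circle (\<lambda>x. complex_of_real (V x) * cexp n x)"
  by unfold_locales (simp add: V_plus cexp_periodic)

lemma V_reflect_coeff:
  "integrable circle_measure (\<lambda>y. complex_of_real (V (x - y)))"
  "fourier_coeff (\<lambda>y. of_real (V (x - y))) (- n) = cexp n x * fourier_coeff (\<lambda>y. of_real (V y)) n"
proof -
  show "integrable circle_measure (\<lambda>y. complex_of_real (V (x - y)))"
    using circle_reflect(1)[OF V_per V_int] by simp
  have "fourier_coeff (\<lambda>y. of_real (V (x - y))) (- n)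
    = (LINT y|circle_measure. cexp n x * (of_real (V (x - y)) * cexp (- n) (x - y)))"
  proof -
    have "cexp n y = cexp n x * cexp (- n) (x - y)" for y
      using cexp_add[of n "- n" x] unfolding cexp_diff_arg by (simp flip: mult.assoc)
    then have "of_real (V (x - y)) * cexp (- (- n)) y = cexp n x * (of_real (V (x - y)) * cexp (- n) (x - y))" for y
      by (metis minus_minus mult.left_commute)
    then show ?thesis unfolding fourier_coeff_cexp by (rule Bochner_Integration.integral_cong[OF refl])
  qed
  also have "\<dots> = cexp n x * (LINT y|circle_measure. of_real (V (x - y)) * cexp (- n) (x - y))"
    by simp
  also have "(LINT y|circle_measure. of_real (V (x - y)) * cexp (- n) (x - y)) = fourier_coeff (\<lambda>y. of_real (V y)) n"
    unfolding fourier_coeff_cexp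
    by (rule circle_reflect(2)[OF V_cexp_per integrable_mult_cexp[OF V_intc]])
  finally show "fourier_coeff (\<lambda>y. of_real (V (x - y))) (- n) = cexp n x * fourier_coeff (\<lambda>y. of_real (V y)) n" .
qed

lemma cnj_fourier_coeff_real: "cnj (fourier_coeff (\<lambda>x. complex_of_real (f x)) n) = fourier_coeff (\<lambda>x. of_real (f x)) (- n)"
  unfolding fourier_coeff_cexp Bochner_Integration.integral_cnj[symmetric] by (simp add: cnj_cexp)

text \<open>Evenness identifies the coefficients at n and -n, while V being real makes them
  conjugate to each other; hence they are real.\<close>

lemma potential_coeff:
  assumes even: "AE x in circle_measure. V (- x) = V x"
  shows "fourier_coeff (\<lambda>x. of_real (V x)) n = of_real (potential_coeff n)"
    "potential_coeff (- n) = potential_coeff n"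
    "\<bar>potential_coeff n\<bar> \<le> (LINT x|circle_measure. \<bar>V x\<bar>)"
proof -
  let ?v = "fourier_coeff (\<lambda>x. of_real (V x))"
  have "?v (- n) = fourier_coeff (\<lambda>y. of_real (V (0 - y))) (- n)"
    by (rule fourier_coeff_cong_AE)
       (use even V_intc V_reflect_coeff(1)[of 0] in \<open>auto elim: eventually_mono\<close>)
  also have "\<dots> = ?v n" using V_reflect_coeff(2)[of 0 n] by (simp add: cexp_def)
  finally have e: "?v (- n) = ?v n" .
  then have "cnj (?v n) = ?v n" by (simp add: cnj_fourier_coeff_real)
  then show r: "?v n = of_real (potential_coeff n)"
    by (simp add: potential_coeff_def complex_eq_iff)
  show "potential_coeff (- n) = potential_coeff n"
    by (simp add: potential_coeff_def e)
  have "\<bar>potential_coeff n\<bar> = cmod (?v n)" by (simp add: r)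
  also have "\<dots> \<le> (LINT x|circle_measure. \<bar>V x\<bar>)"
    using norm_fourier_coeff_le[OF V_intc, of n] by simp
  finally show "\<bar>potential_coeff n\<bar> \<le> (LINT x|circle_measure. \<bar>V x\<bar>)" .
qed

text \<open>The convolution theorem, valid at every \<open>x\<close>: for fixed \<open>x\<close> the
  convolution is a Parseval pairing of the reflected translate of V with \<open>w\<close>, and the
  null set where \<open>w\<close> differs from its series does not affect an integral.\<close>

lemma circle_conv_synth:
  assumes b: "in_l1 b" and w: "AE y in circle_measure. of_real (w y) = synth b y"
    and even: "AE x in circle_measure. V (- x) = V x"
    and wm: "w \<in> borel_measurable circle_measure"
  shows "of_real (circle_conv V w x) = synth (\<lambda>n. of_real (potential_coeff n) * b n) x"
proof -
  have "of_real (circle_conv V w x) = (LINT y|circle_measure. complex_of_real (V (x - y) * w y))"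
    unfolding circle_conv_def by (rule integral_complex_of_real[symmetric])
  also have "\<dots> = (LINT y|circle_measure. of_real (V (x - y)) * synth b y)"
  proof (rule integral_cong_AE)
    have vm: "(\<lambda>y. V (x - y)) \<in> borel_measurable circle_measure"
      using circle_reflect(1)[OF V_per V_int] by blast
    then show "(\<lambda>y. complex_of_real (V (x - y) * w y)) \<in> borel_measurable circle_measure"
      using wm by measurable
    show "(\<lambda>y. of_real (V (x - y)) * synth b y) \<in> borel_measurable circle_measure"
      using vm b by measurable
    show "AE y in circle_measure. complex_of_real (V (x - y) * w y) = of_real (V (x - y)) * synth b y"
      using w by eventually_elim simp
  qed
  also have "\<dots> = of_real (1 / (2 * pi)) * (\<Sum>\<^sub>\<infinity>n. b n * fourier_coeff (\<lambda>y. of_real (V (x - y))) (- n))"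
    by (rule integral_mult_synth[OF b V_reflect_coeff(1)])
  also have "\<dots> = synth (\<lambda>n. of_real (potential_coeff n) * b n) x"
    unfolding synth_def V_reflect_coeff(2) potential_coeff(1)[OF even] by (simp add: mult_ac)
  finally show ?thesis .
qed

text \<open>V is nonnegative only almost everywhere, and the same is needed of y -> V(x - y). The
  negative part of V has integral 0, and so does its reflected translate.\<close>

lemma circle_conv_nonneg:
  assumes "AE x in circle_measure. 0 \<le> V x" "\<And>y. 0 \<le> w y"
  shows "0 \<le> circle_conv V w x"
proof -
  let ?G = "\<lambda>x. max 0 (- V x)"
  have per: "on_circle ?G" by (rule on_circle_compose[OF V_per])
  have int: "integrable circle_measure ?G" using V_int by simp
  have "(LINT y|circle_measure. ?G y) = (LINT y|circle_measure. 0)"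
    by (rule integral_cong_AE) (use V_int assms(1) in \<open>auto elim: eventually_mono\<close>)
  then have "(LINT y|circle_measure. ?G (x - y)) = 0"
    using circle_reflect(2)[OF per int, of x] by simp
  then have "AE y in circle_measure. ?G (x - y) = 0"
    using circle_reflect(1)[OF per int, of x] by (subst (asm) integral_nonneg_eq_0_iff_AE) auto
  then have "AE y in circle_measure. 0 \<le> V (x - y) * w y"
    by eventually_elim (use assms(2) in \<open>auto intro!: mult_nonneg_nonneg simp: max_def split: if_splits\<close>)
  then show ?thesis unfolding circle_conv_def by (rule integral_nonneg_AE)
qed

end

section \<open>Nonlinearity, mass and potential energy in Fourier coefficients\<close>

text \<open>The Fourier coefficients of (V * |f|^2) f, if \<open>a\<close> and \<open>v\<close> are
  those of f and V. Each of the two pointwise products contributes a factor 1/(2 pi).\<close>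

definition hartree_seq :: "(int \<Rightarrow> real) \<Rightarrow> (int \<Rightarrow> complex) \<Rightarrow> int \<Rightarrow> complex" where
  "hartree_seq v a n = of_real (1 / (2 * pi)) *
     conv (\<lambda>n. of_real (v n) * (of_real (1 / (2 * pi)) * conv a (cnj_seq a) n)) a n"

lemma square_summable: "in_l1 a \<Longrightarrow> (\<lambda>n. (cmod (a n))\<^sup>2) summable_on UNIV"
  by (rule summable_on_comparison_test[OF summable_on_cmult_right[of "\<lambda>n. cmod (a n)" UNIV "l1_norm a"]])
     (auto simp: power2_eq_square intro!: mult_right_mono cmod_le_l1_norm)

lemma conv_cnj_seq_0: "conv x (cnj_seq y) 0 = (\<Sum>\<^sub>\<infinity>n. x n * cnj (y n))"
  by (simp add: conv_def cnj_seq_def)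

lemma in_l1_bounded_mult:
  assumes "in_l1 x" "\<And>n. \<bar>v n\<bar> \<le> B"
  shows "in_l1 (\<lambda>n. of_real (v n) * x n)" "l1_norm (\<lambda>n. of_real (v n) * x n) \<le> B * l1_norm x"
proof -
  have le: "cmod (of_real (v n) * x n) \<le> B * cmod (x n)" for n
    unfolding norm_mult using assms(2)[of n] by (intro mult_right_mono) auto
  have s: "(\<lambda>n. B * cmod (x n)) summable_on UNIV"
    by (rule summable_on_cmult_right[OF assms(1)])
  show 1: "in_l1 (\<lambda>n. of_real (v n) * x n)"
    by (rule summable_on_comparison_test[OF s le]) auto
  show "l1_norm (\<lambda>n. of_real (v n) * x n) \<le> B * l1_norm x"
    unfolding l1_norm_def infsum_cmult_right[OF assms(1), symmetric]
    by (rule infsum_mono[OF 1 s le])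
qed

locale hartree_potential =
  fixes V :: "real \<Rightarrow> real"
  assumes V: "V \<in> L1_circle"
    and V_nonneg: "AE x in circle_measure. 0 \<le> V x"
    and V_even: "AE x in circle_measure. V (- x) = V x"
begin

abbreviation "v \<equiv> potential_coeff V"

lemmas v_even = potential_coeff(2)[OF V V_even] and v_bound = potential_coeff(3)[OF V V_even]

lemma hartree_seq_l1: "in_l1 a \<Longrightarrow> in_l1 (hartree_seq v a)"
  unfolding hartree_seq_def
  by (intro in_l1_cmult conv_l1 in_l1_bounded_mult(1)[OF _ v_bound]) (auto simp: cnj_seq_l1)

context
  fixes f :: "real \<Rightarrow> complex" and a :: "int \<Rightarrow> complex"
  assumes f_int: "integrable circle_measure f" and a_def: "a = fourier_coeff f" and a_l1: "in_l1 a"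
begin

abbreviation "dens \<equiv> \<lambda>n. of_real (1 / (2 * pi)) * conv a (cnj_seq a) n"

lemma f_meas [measurable]: "f \<in> borel_measurable circle_measure" using f_int by simp

lemma f_eq: "AE x in circle_measure. f x = synth a x"
  using AE_eq_synth[OF f_int] a_l1 by (simp add: a_def)

lemma dens_l1: "in_l1 dens"
  by (intro in_l1_cmult conv_l1) (auto simp: a_l1 cnj_seq_l1)

lemma density_eq: "AE x in circle_measure. of_real ((cmod (f x))\<^sup>2) = synth dens x"
  using f_eq
proof eventually_elim
  case (elim x)
  have "of_real ((cmod (f x))\<^sup>2) = synth a x * synth (cnj_seq a) x"
    unfolding elim cnj_synth[symmetric] by (simp only: complex_norm_square)
  also have "\<dots> = synth dens x"
    by (rule synth_mult) (auto simp: a_l1 cnj_seq_l1)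
  finally show ?case .
qed

lemma convolution_eq:
  "of_real (circle_conv V (\<lambda>y. (cmod (f y))\<^sup>2) x) = synth (\<lambda>n. of_real (v n) * dens n) x"
  by (rule circle_conv_synth[OF V dens_l1 density_eq V_even]) measurable

lemma nonlinearity_eq: "AE x in circle_measure. hartree_nonlinearity V f x = synth (hartree_seq v a) x"
  using f_eq
proof eventually_elim
  case (elim x)
  show ?case
    unfolding hartree_nonlinearity_def convolution_eq elim hartree_seq_def
    by (rule synth_mult[OF in_l1_bounded_mult(1)[OF dens_l1 v_bound] a_l1])
qed

lemma fourier_coeff_nonlinearity: "fourier_coeff (hartree_nonlinearity V f) = hartree_seq v a"
proof
  fix n
  have "fourier_coeff (hartree_nonlinearity V f) n = fourier_coeff (synth (hartree_seq v a)) n"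
  proof (rule fourier_coeff_cong_AE[OF _ _ nonlinearity_eq])
    have "in_l1 (\<lambda>n. of_real (v n) * dens n)" by (rule in_l1_bounded_mult(1)[OF dens_l1 v_bound])
    then show "hartree_nonlinearity V f \<in> borel_measurable circle_measure"
      unfolding hartree_nonlinearity_def convolution_eq by measurable
    show "synth (hartree_seq v a) \<in> borel_measurable circle_measure"
      by (rule measurable_synth[OF hartree_seq_l1[OF a_l1]])
  qed
  then show "fourier_coeff (hartree_nonlinearity V f) n = hartree_seq v a n"
    by (simp add: fourier_coeff_synth hartree_seq_l1 a_l1)
qed

text \<open>An integral over the circle is a zeroth coefficient, and convolution with
  \<open>cnj_seq a\<close> at 0 is the l^2 pairing with \<open>a\<close>.\<close>

lemma integral_mult_cnj:
  assumes b: "in_l1 b" and g: "AE x in circle_measure. g x = synth b x * cnj (synth a x)"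
    and [measurable]: "g \<in> borel_measurable circle_measure"
  shows "(LINT x|circle_measure. g x) = of_real (1 / (2 * pi)) * (\<Sum>\<^sub>\<infinity>n. b n * cnj (a n))"
proof -
  let ?c = "\<lambda>n. of_real (1 / (2 * pi)) * conv b (cnj_seq a) n"
  have c: "in_l1 ?c" by (intro in_l1_cmult conv_l1 b) (simp add: cnj_seq_l1 a_l1)
  have "(LINT x|circle_measure. g x) = fourier_coeff g 0" by (simp add: fourier_coeff_cexp)
  also have "\<dots> = fourier_coeff (synth ?c) 0"
  proof (rule fourier_coeff_cong_AE)
    show "AE x in circle_measure. g x = synth ?c x"
      using g by eventually_elim (simp only: cnj_synth synth_mult[OF b] cnj_seq_l1 a_l1)
  qed (use c in measurable)
  also have "\<dots> = of_real (1 / (2 * pi)) * (\<Sum>\<^sub>\<infinity>n. b n * cnj (a n))"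
    by (simp only: fourier_coeff_synth[OF c] conv_cnj_seq_0)
  finally show ?thesis .
qed

lemma mass_eq: "mass f = 1 / (2 * pi) * (\<Sum>\<^sub>\<infinity>n. (cmod (a n))\<^sup>2)"
proof -
  have "complex_of_real (mass f) = (LINT x|circle_measure. of_real ((cmod (f x))\<^sup>2))"
    unfolding mass_def by (rule integral_complex_of_real[symmetric])
  also have "\<dots> = of_real (1 / (2 * pi)) * (\<Sum>\<^sub>\<infinity>n. a n * cnj (a n))"
  proof (rule integral_mult_cnj[OF a_l1])
    show "AE x in circle_measure. complex_of_real ((cmod (f x))\<^sup>2) = synth a x * cnj (synth a x)"
      using f_eq by eventually_elim (simp only: complex_norm_square)
  qed measurable
  also have "(\<Sum>\<^sub>\<infinity>n. a n * cnj (a n)) = of_real (\<Sum>\<^sub>\<infinity>n. (cmod (a n))\<^sup>2)"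
    by (simp only: complex_norm_square[symmetric]
        infsumI[OF has_sum_of_real[OF has_sum_infsum[OF square_summable[OF a_l1]]]])
  finally show ?thesis by (simp only: of_real_mult[symmetric] of_real_eq_iff)
qed

text \<open>The sign is read off in physical space, where V \<ge> 0; the multiplier \<open>v\<close>
  itself may take negative values.\<close>

lemma potential_energy_eq:
  defines "P \<equiv> LINT x|circle_measure. circle_conv V (\<lambda>y. (cmod (f y))\<^sup>2) x * (cmod (f x))\<^sup>2"
  shows "of_real P = of_real (1 / (2 * pi)) * (\<Sum>\<^sub>\<infinity>n. hartree_seq v a n * cnj (a n))" "0 \<le> P"
proof -
  have d: "in_l1 (\<lambda>n. of_real (v n) * dens n)" by (rule in_l1_bounded_mult(1)[OF dens_l1 v_bound])
  have eq: "complex_of_real (circle_conv V (\<lambda>y. (cmod (f y))\<^sup>2) x * (cmod (f x))\<^sup>2)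
    = synth (\<lambda>n. of_real (v n) * dens n) x * of_real ((cmod (f x))\<^sup>2)" for x
    by (simp only: of_real_mult convolution_eq)
  have "complex_of_real P = (LINT x|circle_measure. complex_of_real (circle_conv V (\<lambda>y. (cmod (f y))\<^sup>2) x * (cmod (f x))\<^sup>2))"
    unfolding P_def by (rule integral_complex_of_real[symmetric])
  also have "\<dots> = of_real (1 / (2 * pi)) * (\<Sum>\<^sub>\<infinity>n. hartree_seq v a n * cnj (a n))"
  proof (rule integral_mult_cnj[OF hartree_seq_l1[OF a_l1]])
    show "AE x in circle_measure. complex_of_real (circle_conv V (\<lambda>y. (cmod (f y))\<^sup>2) x * (cmod (f x))\<^sup>2)
      = synth (hartree_seq v a) x * cnj (synth a x)"
      using f_eq
    proof eventually_elim
      case (elim x)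
      have "synth (hartree_seq v a) x = synth (\<lambda>n. of_real (v n) * dens n) x * synth a x"
        unfolding hartree_seq_def by (rule synth_mult[OF d a_l1, symmetric])
      then show ?case by (subst eq) (simp only: elim complex_norm_square mult.assoc)
    qed
    show "(\<lambda>x. complex_of_real (circle_conv V (\<lambda>y. (cmod (f y))\<^sup>2) x * (cmod (f x))\<^sup>2)) \<in> borel_measurable circle_measure"
      unfolding eq using d by measurable
  qed
  finally show "of_real P = of_real (1 / (2 * pi)) * (\<Sum>\<^sub>\<infinity>n. hartree_seq v a n * cnj (a n))" .
  show "0 \<le> P"
    unfolding P_def
    by (intro integral_nonneg_AE AE_I2 mult_nonneg_nonneg circle_conv_nonneg[OF V V_nonneg]) auto
qed

end

end

section \<open>Symmetries of the quartic form\<close>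

definition quad :: "(int \<Rightarrow> complex) \<Rightarrow> (int \<Rightarrow> complex) \<Rightarrow> (int \<Rightarrow> complex) \<Rightarrow> (int \<Rightarrow> complex) \<Rightarrow> int \<times> int \<times> int \<Rightarrow> complex" where
  "quad x y z u p = x (i1 p) * cnj (y (i2 p)) * z (i3 p) * cnj (u (i4 p))"

text \<open>The exchange of (n1, n2) with (n3, n4). It changes n1 - n2 into its negative, which is
  where the evenness of \<open>v\<close> enters.\<close>

definition quad_swap :: "int \<times> int \<times> int \<Rightarrow> int \<times> int \<times> int" where
  "quad_swap p = (i3 p, i4 p, i1 p)"

text \<open>The reversal of the order of n1, ..., n4. It exchanges conjugated and unconjugated
  entries and preserves n1 - n2.\<close>

definition quad_flip :: "int \<times> int \<times> int \<Rightarrow> int \<times> int \<times> int" where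
  "quad_flip p = (i4 p, i3 p, i2 p)"

lemma infsum_minus:
  fixes f g :: "'a \<Rightarrow> 'b::banach"
  assumes "f summable_on A" "g summable_on A"
  shows "(\<lambda>x. f x - g x) summable_on A" "(\<Sum>\<^sub>\<infinity>x\<in>A. f x - g x) = infsum f A - infsum g A"
proof -
  have g: "(\<lambda>x. - g x) summable_on A" using assms(2) by (simp add: summable_on_uminus)
  show "(\<lambda>x. f x - g x) summable_on A" "(\<Sum>\<^sub>\<infinity>x\<in>A. f x - g x) = infsum f A - infsum g A"
    using summable_on_add[OF assms(1) g] infsum_add[OF assms(1) g] by (simp_all add: infsum_uminus)
qed

lemma infsum_quad_swap: "(\<Sum>\<^sub>\<infinity>p. f (quad_swap p)) = infsum f UNIV"
  by (rule infsum_reindex_bij_witness[of UNIV quad_swap quad_swap]) (auto simp: quad_swap_def)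

lemma infsum_quad_flip: "(\<Sum>\<^sub>\<infinity>p. f (quad_flip p)) = infsum f UNIV"
  by (rule infsum_reindex_bij_witness[of UNIV quad_flip quad_flip]) (auto simp: quad_flip_def)

definition box3 :: "nat \<Rightarrow> (int \<times> int \<times> int) set" where
  "box3 R = box_int R \<times> box_int R \<times> box_int R"

lemma finite_box3 [simp]: "finite (box3 R)" by (simp add: box3_def)

lemma has_sum_box3:
  fixes f :: "int \<times> int \<times> int \<Rightarrow> 'a::{comm_monoid_add, topological_space}"
  assumes "(f has_sum S) UNIV"
  shows "(\<lambda>R. \<Sum>p\<in>box3 R. f p) \<longlonglongrightarrow> S"
proof -
  have "filterlim box3 (finite_subsets_at_top UNIV) sequentially"
    unfolding filterlim_finite_subsets_at_top
  proof safe
    fix X :: "(int \<times> int \<times> int) set" assume X: "finite X"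
    let ?Y = "i1 ` X \<union> i2 ` X \<union> i3 ` X"
    have "finite ?Y" using X by simp
    then have "\<forall>\<^sub>F R in sequentially. finite (box_int R) \<and> ?Y \<subseteq> box_int R \<and> box_int R \<subseteq> UNIV"
      using filterlim_box_int[unfolded filterlim_finite_subsets_at_top, rule_format, of ?Y] by blast
    then show "\<forall>\<^sub>F R in sequentially. finite (box3 R) \<and> X \<subseteq> box3 R \<and> box3 R \<subseteq> UNIV"
    proof eventually_elim
      case (elim R)
      have "p \<in> box3 R" if "p \<in> X" for p
        unfolding box3_def mem_Times_iff using elim that by blast
      then show ?case by auto
    qed
  qed
  then show ?thesis
    using assms unfolding has_sum_def by (rule filterlim_compose[rotated])
qed

text \<open>From here on the potential is known only through an even bounded multiplier.\<close>

locale hartree_coeffs =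
  fixes v :: "int \<Rightarrow> real" and B :: real
  assumes v_even: "v (- n) = v n" and v_bound: "\<bar>v n\<bar> \<le> B"
begin

abbreviation "vq \<equiv> \<lambda>p. complex_of_real (v (i1 p - i2 p))"

lemma B_nonneg: "0 \<le> B" using v_bound[of 0] by linarith

lemma vq_swap: "vq (quad_swap p) = vq p"
  using v_even[of "i1 p - i2 p"] by (simp add: quad_swap_def)

lemma vq_flip: "vq (quad_flip p) = vq p"
  by (simp add: quad_flip_def)

text \<open>The square of 1/(2 pi), from the two products in \<open>hartree_seq\<close>.\<close>

definition "cst = 1 / (4 * pi\<^sup>2)"

lemma cst: "0 < cst" "cst \<le> 1"
proof -
  have "1 * 1 \<le> pi * pi" using pi_gt3 by (intro mult_mono) auto
  then show "cst \<le> 1" by (simp add: cst_def power2_eq_square field_simps)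
qed (simp add: cst_def)

text \<open>The free entry \<open>y\<close> makes this usable for three purposes: the potential
  energy (\<open>y = a\<close>), the derivative of a weighted norm (\<open>y\<close> a weight times
  \<open>a\<close>), and the derivative of the potential energy (\<open>y\<close> the
  forcing).\<close>

lemma trilinear_form:
  assumes a: "in_l1 a"
    and s: "(\<lambda>p. cmod (quad a a a y p)) summable_on UNIV"
  shows "(\<lambda>p. vq p * quad a a a y p) summable_on UNIV"
    "(\<lambda>n. hartree_seq v a n * cnj (y n)) summable_on UNIV"
    "(\<Sum>\<^sub>\<infinity>n. hartree_seq v a n * cnj (y n)) = of_real cst * (\<Sum>\<^sub>\<infinity>p. vq p * quad a a a y p)"
proof -
  have le: "norm (vq p * quad a a a y p) \<le> B * cmod (quad a a a y p)" for p
    unfolding norm_mult using v_bound by (intro mult_right_mono) auto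
  show sq: "(\<lambda>p. vq p * quad a a a y p) summable_on UNIV"
    by (rule norm_infsum_le_infsum(1)[OF summable_on_cmult_right[OF s] le])
  \<comment> \<open>In the triple (n, k, j), n is the output frequency n4, k = n1 - n2 is where
    \<open>v\<close> is evaluated, and j = n1.\<close>
  let ?h = "\<lambda>q. (i3 q, i3 q - i2 q, i1 q - i2 q)"
  let ?f = "\<lambda>n k j. of_real (v k) * (a j * cnj_seq a (k - j)) * a (n - k) * cnj (y n)"
  have f_eq: "(\<lambda>(n, k, j). ?f n k j) q = (\<lambda>p. vq p * quad a a a y p) (?h q)" for q
    by (simp add: quad_def cnj_seq_def case_prod_unfold)
  have sf: "(\<lambda>(n, k, j). ?f n k j) summable_on UNIV \<times> UNIV"
    and sum_f: "infsum (\<lambda>(n, k, j). ?f n k j) (UNIV \<times> UNIV) = (\<Sum>\<^sub>\<infinity>p. vq p * quad a a a y p)"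
  proof -
    let ?g = "\<lambda>p. (i4 p, i1 p - i2 p, i1 p)"
    show "(\<lambda>(n, k, j). ?f n k j) summable_on UNIV \<times> UNIV"
      using sq summable_on_reindex_bij_witness[of UNIV ?g ?h UNIV "\<lambda>p. vq p * quad a a a y p" "\<lambda>(n, k, j). ?f n k j"] f_eq
      by auto
    show "infsum (\<lambda>(n, k, j). ?f n k j) (UNIV \<times> UNIV) = (\<Sum>\<^sub>\<infinity>p. vq p * quad a a a y p)"
      using infsum_reindex_bij_witness[of UNIV ?g ?h UNIV "\<lambda>p. vq p * quad a a a y p" "\<lambda>(n, k, j). ?f n k j"] f_eq
      by auto
  qed
  have inner: "infsum (\<lambda>(k, j). ?f n k j) (UNIV \<times> UNIV) = (\<Sum>\<^sub>\<infinity>k. of_real (v k) * conv a (cnj_seq a) k * a (n - k)) * cnj (y n)" for n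
  proof -
    have "(\<lambda>(k, j). ?f n k j) summable_on UNIV \<times> UNIV"
      using summable_on_SigmaD1[of "\<lambda>n q. (\<lambda>(k, j). ?f n k j) q" UNIV "\<lambda>_. UNIV" n] sf by simp
    then have "infsum (\<lambda>(k, j). ?f n k j) (UNIV \<times> UNIV) = (\<Sum>\<^sub>\<infinity>k. \<Sum>\<^sub>\<infinity>j. ?f n k j)"
      using infsum_Sigma'_banach[of "\<lambda>k j. ?f n k j" UNIV "\<lambda>_. UNIV"] by simp
    also have "\<dots> = (\<Sum>\<^sub>\<infinity>k. of_real (v k) * conv a (cnj_seq a) k * a (n - k) * cnj (y n))"
      by (simp add: conv_def infsum_cmult_left' infsum_cmult_right')
    finally show ?thesis by (simp add: infsum_cmult_left')
  qed
  have key: "hartree_seq v a n * cnj (y n) = of_real cst * infsum (\<lambda>(k, j). ?f n k j) (UNIV \<times> UNIV)" for n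
  proof -
    have "hartree_seq v a n = of_real (1 / (2 * pi)) * (of_real (1 / (2 * pi)) * (\<Sum>\<^sub>\<infinity>k. of_real (v k) * conv a (cnj_seq a) k * a (n - k)))"
    proof -
      have "conv (\<lambda>n. of_real (v n) * (of_real (1 / (2 * pi)) * conv a (cnj_seq a) n)) a n
        = (\<Sum>\<^sub>\<infinity>k. of_real (1 / (2 * pi)) * (of_real (v k) * conv a (cnj_seq a) k * a (n - k)))"
        unfolding conv_def[of _ a n] by (rule infsum_cong) (simp only: mult_ac)
      then show ?thesis unfolding hartree_seq_def by (simp only: infsum_cmult_right')
    qed
    moreover have "complex_of_real (1 / (2 * pi)) * of_real (1 / (2 * pi)) = of_real cst"
      by (simp only: of_real_mult[symmetric]) (simp add: cst_def power2_eq_square)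
    ultimately show ?thesis unfolding inner by (simp only: mult.assoc[symmetric])
  qed
  have sf': "(\<lambda>n. infsum (\<lambda>(k, j). ?f n k j) (UNIV \<times> UNIV)) summable_on UNIV"
    using summable_on_Sigma_banach[of "\<lambda>n q. (\<lambda>(k, j). ?f n k j) q" UNIV "\<lambda>_. UNIV"] sf by simp
  then show "(\<lambda>n. hartree_seq v a n * cnj (y n)) summable_on UNIV"
    unfolding key by (rule summable_on_cmult_right)
  have "(\<Sum>\<^sub>\<infinity>n. infsum (\<lambda>(k, j). ?f n k j) (UNIV \<times> UNIV)) = (\<Sum>\<^sub>\<infinity>p. vq p * quad a a a y p)"
    using infsum_Sigma'_banach[of "\<lambda>n q. (\<lambda>(k, j). ?f n k j) q" UNIV "\<lambda>_. UNIV"] sf sum_f by simp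
  then show "(\<Sum>\<^sub>\<infinity>n. hartree_seq v a n * cnj (y n)) = of_real cst * (\<Sum>\<^sub>\<infinity>p. vq p * quad a a a y p)"
    unfolding key by (simp only: infsum_cmult_right')
qed

text \<open>
  \<open>quad_swap\<close> preserves and \<open>quad_flip\<close> conjugates the quartic form, and they move \<open>n\<^sub>4\<close> to the other
  three positions; so the weight \<open>g(n\<^sub>4)\<close> may be replaced by an alternating sum, which vanishes on resonances.
\<close>

lemma symmetrize:
  fixes g :: "int \<Rightarrow> real"
  assumes "\<And>j. j \<in> {i1, i2, i3, i4} \<Longrightarrow> (\<lambda>p. g (j p) * cmod (quad a a a a p)) summable_on UNIV"
  defines "D \<equiv> \<lambda>p. g (i1 p) - g (i2 p) + g (i3 p) - g (i4 p)"
  shows "Im (\<Sum>\<^sub>\<infinity>p. of_real (D p) * (vq p * quad a a a a p))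
    = - 4 * Im (\<Sum>\<^sub>\<infinity>p. of_real (g (i4 p)) * (vq p * quad a a a a p))"
proof -
  let ?f = "\<lambda>j p. of_real (g (j p)) * (vq p * quad a a a a p)"
  let ?Z = "infsum (?f i4) UNIV"
  have s: "?f j summable_on UNIV" if "j \<in> {i1, i2, i3, i4}" for j
  proof (rule norm_infsum_le_infsum(1))
    have "(\<lambda>p. \<bar>g (j p)\<bar> * cmod (quad a a a a p)) summable_on UNIV"
      using assms(1)[OF that, THEN summable_on_iff_abs_summable_on_real[THEN iffD1]] by (simp add: abs_mult)
    then show "(\<lambda>p. B * (\<bar>g (j p)\<bar> * cmod (quad a a a a p))) summable_on UNIV"
      by (rule summable_on_cmult_right)
    show "norm (?f j p) \<le> B * (\<bar>g (j p)\<bar> * cmod (quad a a a a p))" for p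
    proof -
      have "norm (?f j p) = \<bar>v (i1 p - i2 p)\<bar> * (\<bar>g (j p)\<bar> * cmod (quad a a a a p))"
        by (simp add: norm_mult mult_ac)
      also have "\<dots> \<le> B * (\<bar>g (j p)\<bar> * cmod (quad a a a a p))"
        by (intro mult_right_mono v_bound) auto
      finally show ?thesis .
    qed
  qed
  have q_swap: "quad a a a a (quad_swap p) = quad a a a a p" for p
    by (simp add: quad_def quad_swap_def)
  have q_flip: "quad a a a a (quad_flip p) = cnj (quad a a a a p)" for p
    by (simp add: quad_def quad_flip_def)
  have "infsum (?f i2) UNIV = (\<Sum>\<^sub>\<infinity>p. ?f i4 (quad_swap p))"
    unfolding vq_swap q_swap by (simp add: quad_swap_def)
  then have 2: "infsum (?f i2) UNIV = ?Z" by (simp only: infsum_quad_swap[of "?f i4"])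
  have "infsum (?f i1) UNIV = (\<Sum>\<^sub>\<infinity>p. cnj (?f i4 (quad_flip p)))"
    unfolding vq_flip q_flip by (simp add: quad_flip_def)
  also have "\<dots> = cnj ?Z" by (simp only: infsum_cnj infsum_quad_flip[of "?f i4"])
  finally have 1: "infsum (?f i1) UNIV = cnj ?Z" .
  have "infsum (?f i3) UNIV = (\<Sum>\<^sub>\<infinity>p. ?f i1 (quad_swap p))"
    unfolding vq_swap q_swap by (simp add: quad_swap_def)
  then have 3: "infsum (?f i3) UNIV = cnj ?Z" by (simp only: infsum_quad_swap[of "?f i1"] 1)
  have "(\<Sum>\<^sub>\<infinity>p. of_real (D p) * (vq p * quad a a a a p))
    = (\<Sum>\<^sub>\<infinity>p. (?f i1 p - ?f i2 p) + (?f i3 p - ?f i4 p))"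
    by (simp add: D_def algebra_simps)
  also have "\<dots> = (\<Sum>\<^sub>\<infinity>p. ?f i1 p - ?f i2 p) + (\<Sum>\<^sub>\<infinity>p. ?f i3 p - ?f i4 p)"
    by (intro infsum_add infsum_minus(1) s) auto
  also have "\<dots> = (cnj ?Z - ?Z) + (cnj ?Z - ?Z)"
    using infsum_minus(2)[OF s s, of i1 i2] infsum_minus(2)[OF s s, of i3 i4]
    by (simp only: 1 2 3 insert_iff simp_thms)
  finally show ?thesis by simp
qed

text \<open>The four terms are images of the last one under the symmetries, two of them conjugated,
  so the sum is four times a real part. Since \<open>b\<close> is -i times the nonlinearity, the
  form pairs the nonlinearity with itself and equals i times a real number. This is the last step
  towards conservation of energy.\<close>

lemma quartic_derivative_real_part:
  assumes a: "in_l1 a" and b: "b = (\<lambda>n. - \<i> * hartree_seq v a n)"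
    and s: "(\<lambda>p. cmod (quad a a a b p)) summable_on UNIV"
  shows "Re (\<Sum>\<^sub>\<infinity>p. vq p * (quad b a a a p + quad a b a a p + quad a a b a p + quad a a a b p)) = 0"
proof -
  let ?f = "\<lambda>p. vq p * quad a a a b p"
  let ?Z = "infsum ?f UNIV"
  note t = trilinear_form[OF a s]
  have 2: "vq p * quad a b a a p = ?f (quad_swap p)" for p
    unfolding vq_swap by (simp add: quad_def quad_swap_def)
  have 1: "vq p * quad b a a a p = cnj (?f (quad_flip p))" for p
    unfolding vq_flip by (simp add: quad_def quad_flip_def)
  have 3: "vq p * quad a a b a p = cnj (?f (quad_flip (quad_swap p)))" for p
    unfolding vq_flip vq_swap by (simp add: quad_def quad_flip_def quad_swap_def)
  have bij: "bij quad_swap" "bij quad_flip"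
    by (auto intro!: involuntory_imp_bij simp: quad_swap_def quad_flip_def)
  have sw: "(\<lambda>p. ?f (quad_swap p)) summable_on UNIV" and fl: "(\<lambda>p. ?f (quad_flip p)) summable_on UNIV"
    using t(1) summable_on_reindex_bij_betw[OF bij(1), of ?f] summable_on_reindex_bij_betw[OF bij(2), of ?f] by auto
  have fs: "(\<lambda>p. ?f (quad_flip (quad_swap p))) summable_on UNIV"
    using fl summable_on_reindex_bij_betw[OF bij(1), of "\<lambda>p. ?f (quad_flip p)"] by auto
  have "(\<Sum>\<^sub>\<infinity>p. vq p * (quad b a a a p + quad a b a a p + quad a a b a p + quad a a a b p))
    = (\<Sum>\<^sub>\<infinity>p. (cnj (?f (quad_flip p)) + ?f (quad_swap p)) + (cnj (?f (quad_flip (quad_swap p))) + ?f p))"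
    unfolding distrib_left 1 2 3 by (simp only: add.assoc)
  also have "\<dots> = (\<Sum>\<^sub>\<infinity>p. cnj (?f (quad_flip p)) + ?f (quad_swap p))
    + (\<Sum>\<^sub>\<infinity>p. cnj (?f (quad_flip (quad_swap p))) + ?f p)"
    by (intro infsum_add summable_on_add sw t(1) summable_on_cnj_iff[THEN iffD2] fl fs)
  also have "\<dots> = (cnj ?Z + ?Z) + (cnj ?Z + ?Z)"
  proof -
    have "(\<Sum>\<^sub>\<infinity>p. cnj (?f (quad_flip p)) + ?f (quad_swap p)) = cnj ?Z + ?Z"
      using infsum_add[OF summable_on_cnj_iff[THEN iffD2, OF fl] sw]
      by (simp only: infsum_cnj infsum_quad_flip[of ?f] infsum_quad_swap[of ?f])
    moreover have "(\<Sum>\<^sub>\<infinity>p. cnj (?f (quad_flip (quad_swap p))) + ?f p) = cnj ?Z + ?Z"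
      using infsum_add[OF summable_on_cnj_iff[THEN iffD2, OF fs] t(1)]
      by (simp only: infsum_cnj infsum_quad_flip[of ?f] infsum_quad_swap[of "\<lambda>p. ?f (quad_flip p)"])
    ultimately show ?thesis by (simp only:)
  qed
  finally have eq: "(\<Sum>\<^sub>\<infinity>p. vq p * (quad b a a a p + quad a b a a p + quad a a b a p + quad a a a b p))
    = (cnj ?Z + ?Z) + (cnj ?Z + ?Z)" .
  have "of_real cst * ?Z = (\<Sum>\<^sub>\<infinity>n. hartree_seq v a n * cnj (b n))"
    by (rule t(3)[symmetric])
  also have "\<dots> = (\<Sum>\<^sub>\<infinity>n. \<i> * of_real ((cmod (hartree_seq v a n))\<^sup>2))"
    by (simp add: b complex_norm_square mult_ac del: of_real_power)
  also have "\<dots> = \<i> * of_real (\<Sum>\<^sub>\<infinity>n. (cmod (hartree_seq v a n))\<^sup>2)"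
  proof -
    have "(\<lambda>n. of_real ((cmod (hartree_seq v a n))\<^sup>2)) = (\<lambda>n. - \<i> * (hartree_seq v a n * cnj (b n)))"
      unfolding b by (simp add: complex_norm_square mult_ac del: of_real_power)
    then have "(\<lambda>n. complex_of_real ((cmod (hartree_seq v a n))\<^sup>2)) summable_on UNIV"
      using summable_on_cmult_right[OF t(2), of "- \<i>"] by (simp only:)
    then have "(\<lambda>n. (cmod (hartree_seq v a n))\<^sup>2) summable_on UNIV"
      using summable_on_Re by fastforce
    from infsumI[OF has_sum_of_real[OF has_sum_infsum[OF this]]] show ?thesis
      by (simp add: infsum_cmult_right' del: of_real_power)
  qed
  finally have "of_real cst * ?Z = \<i> * of_real (\<Sum>\<^sub>\<infinity>n. (cmod (hartree_seq v a n))\<^sup>2)" .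
  then have "Re (of_real cst * ?Z) = 0" by (simp del: of_real_power)
  then have "Re ?Z = 0" using cst by simp
  then show ?thesis unfolding eq by simp
qed

end

section \<open>Weighted estimates and the modified energy\<close>

lemma cnj_seq_wt:
  assumes "\<And>n. w (- n) = w n"
  shows "in_wt w (cnj_seq a) \<longleftrightarrow> in_wt w a" "wt_sum w (cnj_seq a) = wt_sum w a"
proof -
  show "in_wt w (cnj_seq a) \<longleftrightarrow> in_wt w a"
    unfolding cnj_seq_def by (rule summable_on_reindex_bij_witness[of UNIV uminus uminus]) (auto simp: assms)
  show "wt_sum w (cnj_seq a) = wt_sum w a"
    unfolding cnj_seq_def wt_sum_def by (rule infsum_reindex_bij_witness[of UNIV uminus uminus]) (auto simp: assms)
qed

lemma wt_bounded_mult: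
  assumes "in_wt w x" "\<And>n. cmod (c n) \<le> C" "\<And>n. 0 \<le> w n"
  shows "in_wt w (\<lambda>n. c n * x n)" "wt_sum w (\<lambda>n. c n * x n) \<le> C\<^sup>2 * wt_sum w x"
proof -
  have le: "w n * (cmod (c n * x n))\<^sup>2 \<le> C\<^sup>2 * (w n * (cmod (x n))\<^sup>2)" for n
  proof -
    have "(cmod (c n))\<^sup>2 * (w n * (cmod (x n))\<^sup>2) \<le> C\<^sup>2 * (w n * (cmod (x n))\<^sup>2)"
      using assms(2,3) by (intro mult_right_mono power_mono) auto
    then show ?thesis by (simp add: norm_mult power_mult_distrib mult_ac)
  qed
  have s: "(\<lambda>n. C\<^sup>2 * (w n * (cmod (x n))\<^sup>2)) summable_on UNIV"
    by (rule summable_on_cmult_right[OF assms(1)])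
  show 1: "in_wt w (\<lambda>n. c n * x n)"
    by (rule summable_on_comparison_test[OF s le]) (auto simp: assms(3))
  show "wt_sum w (\<lambda>n. c n * x n) \<le> C\<^sup>2 * wt_sum w x"
    unfolding wt_sum_def infsum_cmult_right[OF assms(1), symmetric]
    by (rule infsum_mono[OF 1 s le])
qed

lemma l1_norm_cmult_le: "in_l1 x \<Longrightarrow> cmod c \<le> C \<Longrightarrow> l1_norm (\<lambda>n. c * x n) \<le> C * l1_norm x"
  by (simp add: l1_norm_def norm_mult infsum_cmult_right' mult_right_mono infsum_nonneg)

lemma inv_2pi_le_1: "cmod (complex_of_real (1 / (2 * pi))) \<le> 1"
  using pi_gt3 by (simp add: norm_divide field_simps)

lemma wt_sum_nonneg: "(\<And>n. 0 \<le> w n) \<Longrightarrow> 0 \<le> wt_sum w x"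
  by (auto simp: wt_sum_def intro!: infsum_nonneg)

context hartree_coeffs
begin

lemma hartree_seq_bound:
  assumes a: "in_l1 a"
  shows "in_l1 (hartree_seq v a)" "l1_norm (hartree_seq v a) \<le> B * (l1_norm a) ^ 3"
proof -
  let ?x = "conv a (cnj_seq a)"
  let ?y = "\<lambda>n. of_real (1 / (2 * pi)) * ?x n"
  let ?z = "\<lambda>n. of_real (v n) * ?y n"
  have a': "in_l1 (cnj_seq a)" by (simp add: cnj_seq_l1 a)
  have x: "in_l1 ?x" "l1_norm ?x \<le> l1_norm a * l1_norm a"
    using conv_l1[OF a a'] by (auto simp: cnj_seq_l1)
  have y: "in_l1 ?y" "l1_norm ?y \<le> l1_norm a * l1_norm a"
    using in_l1_cmult[OF x(1), of "of_real (1 / (2 * pi))"] l1_norm_cmult_le[OF x(1) inv_2pi_le_1] x(2) by auto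
  have z: "in_l1 ?z" "l1_norm ?z \<le> B * (l1_norm a * l1_norm a)"
    using in_l1_bounded_mult[where v = v, OF y(1) v_bound] mult_left_mono[OF y(2) B_nonneg] by auto
  have c: "in_l1 (conv ?z a)" "l1_norm (conv ?z a) \<le> B * (l1_norm a * l1_norm a) * l1_norm a"
    using conv_l1[OF z(1) a] mult_right_mono[OF z(2) l1_norm_nonneg[of a]] by auto
  show "in_l1 (hartree_seq v a)"
    unfolding hartree_seq_def by (rule in_l1_cmult[OF c(1)])
  show "l1_norm (hartree_seq v a) \<le> B * (l1_norm a) ^ 3"
    unfolding hartree_seq_def using l1_norm_cmult_le[OF c(1) inv_2pi_le_1] c(2)
    by (simp add: power3_eq_cube mult_ac)
qed

end

locale weighted_coeffs = hartree_coeffs v B + subadd_weight \<theta> L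
  for v :: "int \<Rightarrow> real" and B :: real and \<theta> :: "int \<Rightarrow> real" and L :: real
begin

lemma hartree_seq_wt:
  assumes a: "in_l1 a" and aw: "in_wt w a"
  shows "in_wt w (hartree_seq v a)"
    "wt_sum w (hartree_seq v a) \<le> 10 * L ^ 4 * B\<^sup>2 * (l1_norm a) ^ 4 * wt_sum w a"
proof -
  let ?K = "l1_norm a" and ?S = "wt_sum w a"
  let ?x = "conv a (cnj_seq a)"
  let ?y = "\<lambda>n. of_real (1 / (2 * pi)) * ?x n"
  let ?z = "\<lambda>n. of_real (v n) * ?y n"
  have K: "0 \<le> ?K" and S: "0 \<le> ?S" by (auto simp: l1_norm_nonneg wt_sum_nonneg)
  have a': "in_l1 (cnj_seq a)" by (simp add: cnj_seq_l1 a)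
  have aw': "in_wt w (cnj_seq a)" by (subst cnj_seq_wt) (auto simp: even aw)
  have wS: "wt_sum w (cnj_seq a) = ?S" by (rule cnj_seq_wt) (simp add: even)
  have x: "in_wt w ?x" "wt_sum w ?x \<le> 4 * L\<^sup>2 * (?S * ?K\<^sup>2)"
    using conv_wt[OF a a' aw aw'] by (simp_all add: wS cnj_seq_l1 mult_ac)
  have y: "in_wt w ?y" "wt_sum w ?y \<le> 4 * L\<^sup>2 * (?S * ?K\<^sup>2)"
    using wt_bounded_mult[OF x(1) inv_2pi_le_1] x(2) by auto
  have z: "in_wt w ?z" "wt_sum w ?z \<le> B\<^sup>2 * (4 * L\<^sup>2 * (?S * ?K\<^sup>2))"
    using wt_bounded_mult[OF y(1), of "\<lambda>n. of_real (v n)" B] v_bound mult_left_mono[OF y(2), of "B\<^sup>2"] by auto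
  have x1: "in_l1 ?x" "l1_norm ?x \<le> ?K * ?K" using conv_l1[OF a a'] by (auto simp: cnj_seq_l1)
  have y1: "in_l1 ?y" "l1_norm ?y \<le> ?K * ?K"
    using in_l1_cmult[OF x1(1), of "of_real (1 / (2 * pi))"] l1_norm_cmult_le[OF x1(1) inv_2pi_le_1] x1(2) by auto
  have z1: "in_l1 ?z" "l1_norm ?z \<le> B * (?K * ?K)"
    using in_l1_bounded_mult[where v = v, OF y1(1) v_bound] mult_left_mono[OF y1(2) B_nonneg] by auto
  have c: "in_wt w (conv ?z a)" by (rule conv_wt[OF z1(1) a z(1) aw])
  have "wt_sum w (conv ?z a) \<le> 2 * L\<^sup>2 * (wt_sum w ?z * ?K\<^sup>2 + (l1_norm ?z)\<^sup>2 * ?S)"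
    by (rule conv_wt[OF z1(1) a z(1) aw])
  also have "\<dots> \<le> 2 * L\<^sup>2 * (B\<^sup>2 * (4 * L\<^sup>2 * (?S * ?K\<^sup>2)) * ?K\<^sup>2 + (B * (?K * ?K))\<^sup>2 * ?S)"
    using z(2) z1(2) K S by (intro mult_left_mono add_mono mult_right_mono power_mono l1_norm_nonneg) auto
  also have "\<dots> = (8 * (L\<^sup>2 * L\<^sup>2) + 2 * L\<^sup>2) * (B\<^sup>2 * ?K ^ 4 * ?S)"
    by (simp add: algebra_simps power2_eq_square power4_eq_xxxx)
  \<comment> \<open>Since L \<ge> 1, the term with \<open>L\<^sup>2\<close> is absorbed by the one
    with its square: 8 + 2 = 10.\<close>
  also have "\<dots> \<le> (10 * (L\<^sup>2 * L\<^sup>2)) * (B\<^sup>2 * ?K ^ 4 * ?S)"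
  proof (rule mult_right_mono)
    have "1 * L\<^sup>2 \<le> L\<^sup>2 * L\<^sup>2" using L_ge1 by (intro mult_right_mono) auto
    then show "8 * (L\<^sup>2 * L\<^sup>2) + 2 * L\<^sup>2 \<le> 10 * (L\<^sup>2 * L\<^sup>2)" by simp
  qed (use S in auto)
  also have "\<dots> = 10 * L ^ 4 * B\<^sup>2 * ?K ^ 4 * ?S"
    by (simp add: power2_eq_square power4_eq_xxxx mult_ac)
  finally have c2: "wt_sum w (conv ?z a) \<le> 10 * L ^ 4 * B\<^sup>2 * ?K ^ 4 * ?S" .
  show "in_wt w (hartree_seq v a)"
    unfolding hartree_seq_def by (rule wt_bounded_mult[OF c inv_2pi_le_1]) auto
  have "wt_sum w (hartree_seq v a) \<le> 1\<^sup>2 * wt_sum w (conv ?z a)"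
    unfolding hartree_seq_def by (rule wt_bounded_mult[OF c inv_2pi_le_1]) auto
  then show "wt_sum w (hartree_seq v a) \<le> 10 * L ^ 4 * B\<^sup>2 * ?K ^ 4 * ?S"
    using c2 by simp
qed

end

section \<open>The modified energy and its derivative along the flow\<close>

definition resonance :: "int \<times> int \<times> int \<Rightarrow> real" where
  "resonance p = (of_int (i1 p))\<^sup>2 - (of_int (i2 p))\<^sup>2 + (of_int (i3 p))\<^sup>2 - (of_int (i4 p))\<^sup>2"

text \<open>\<open>M\<close> is the quotient of the alternating sum of \<open>g\<close> by the resonance function; it is the multiplier of the
  quartic correction that turns the weighted norm into the modified energy.\<close>

locale energy_weight = weighted_coeffs v B \<theta> L
  for v :: "int \<Rightarrow> real" and B :: real and \<theta> :: "int \<Rightarrow> real" and L :: real +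
  fixes g :: "int \<Rightarrow> real" and M :: "int \<times> int \<times> int \<Rightarrow> real" and \<mu> :: real
  assumes g_bound: "\<bar>g n\<bar> \<le> w n"
    and M_bound: "\<bar>M p\<bar> \<le> \<mu> * (w (i1 p) + w (i2 p) + w (i3 p) + w (i4 p))"
    and M_resonance: "M p * resonance p = g (i1 p) - g (i2 p) + g (i3 p) - g (i4 p)"
begin

abbreviation "W \<equiv> \<lambda>p. w (i1 p) + w (i2 p) + w (i3 p) + w (i4 p)"

lemma W_ge: "4 \<le> W p"
proof -
  have "1 \<le> w n" for n using ge1[of n] by (simp add: one_le_power)
  from add_mono[OF add_mono[OF add_mono[OF this[of "i1 p"] this[of "i2 p"]] this[of "i3 p"]] this[of "i4 p"]]
  show ?thesis by simp
qed

lemma \<mu>_nonneg: "0 \<le> \<mu>"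
proof (rule ccontr)
  assume "\<not> 0 \<le> \<mu>"
  then have "\<mu> * W (0, 0, 0) < 0" using W_ge[of "(0, 0, 0)"] by (intro mult_neg_pos) auto
  then show False using M_bound[of "(0, 0, 0)"] by linarith
qed

definition "quartic a p = of_real (M p) * (vq p * quad a a a a p)"

text \<open>The product rule with \<open>b\<close> in each slot in turn. With \<open>b\<close> the
  nonlinear part of the time derivative, it is what remains of the derivative of
  \<open>quartic\<close> once the linear evolution is split off.\<close>

definition "quartic_deriv a b p =
  of_real (M p) * (vq p * (quad b a a a p + quad a b a a p + quad a a b a p + quad a a a b p))"

text \<open>The factor \<open>cst / 2\<close> is dictated by cancellation: differentiating |a|^2
  gives 2, averaging over the four positions in \<open>symmetrize\<close> gives -1/4, so the
  weighted norm contributes -(cst/2) Im R. The linear flow contributes Re(-i R) = Im R for the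
  correction.\<close>

definition "modified_energy a =
  (\<Sum>\<^sub>\<infinity>n. g n * (cmod (a n))\<^sup>2) + cst / 2 * Re (\<Sum>\<^sub>\<infinity>p. quartic a p)"

text \<open>The bound on finite sums is uniform in the set, as dominated convergence along boxes
  requires.\<close>

lemma dominated_quad:
  fixes f :: "int \<times> int \<times> int \<Rightarrow> 'b::banach"
  assumes \<alpha>: "\<alpha> summable_on UNIV" "in_wt w (\<lambda>n. of_real (\<alpha> n))" "\<And>n. 0 \<le> \<alpha> n"
    and f: "\<And>p. norm (f p) \<le> C * (W p * (\<alpha> (i1 p) * \<alpha> (i2 p) * \<alpha> (i3 p) * \<alpha> (i4 p)))" and C: "0 \<le> C"
  shows "f summable_on UNIV" "(\<lambda>p. norm (f p)) summable_on UNIV"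
    "norm (infsum f UNIV) \<le> C * (12 * L\<^sup>2 * (wt_sum w (\<lambda>n. of_real (\<alpha> n)) * (infsum \<alpha> UNIV)\<^sup>2))"
    "finite X \<Longrightarrow> norm (sum f X) \<le> C * (12 * L\<^sup>2 * (wt_sum w (\<lambda>n. of_real (\<alpha> n)) * (infsum \<alpha> UNIV)\<^sup>2))"
proof -
  have w\<alpha>: "(\<lambda>n. w n * (\<alpha> n)\<^sup>2) summable_on UNIV" using \<alpha>(2) by simp
  let ?\<Xi> = "\<lambda>p. W p * (\<alpha> (i1 p) * \<alpha> (i2 p) * \<alpha> (i3 p) * \<alpha> (i4 p))"
  note Q = quadrilinear_bound[OF \<alpha>(3,1) w\<alpha>]
  have s: "(\<lambda>p. C * ?\<Xi> p) summable_on UNIV" by (rule summable_on_cmult_right[OF Q(1)])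
  have le: "(\<Sum>\<^sub>\<infinity>p. C * ?\<Xi> p) \<le> C * (12 * L\<^sup>2 * (wt_sum w (\<lambda>n. of_real (\<alpha> n)) * (infsum \<alpha> UNIV)\<^sup>2))"
    unfolding infsum_cmult_right[OF Q(1)] using Q(2) C by (intro mult_left_mono) (auto simp: wt_sum_def)
  note n = norm_infsum_le_infsum[OF s f]
  show "f summable_on UNIV" by (rule n)
  show "(\<lambda>p. norm (f p)) summable_on UNIV" by (rule summable_on_comparison_test[OF s f]) auto
  show "norm (infsum f UNIV) \<le> C * (12 * L\<^sup>2 * (wt_sum w (\<lambda>n. of_real (\<alpha> n)) * (infsum \<alpha> UNIV)\<^sup>2))"
    using n(2) le by linarith
  assume X: "finite X"
  have "norm (sum f X) \<le> (\<Sum>p\<in>X. C * ?\<Xi> p)" by (rule sum_norm_le) (rule f)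
  also have "\<dots> \<le> (\<Sum>\<^sub>\<infinity>p. C * ?\<Xi> p)"
    by (rule finite_sum_le_infsum[OF s X]) (auto intro!: mult_nonneg_nonneg C \<alpha>(3) add_nonneg_nonneg)
  finally show "norm (sum f X) \<le> C * (12 * L\<^sup>2 * (wt_sum w (\<lambda>n. of_real (\<alpha> n)) * (infsum \<alpha> UNIV)\<^sup>2))"
    using le by linarith
qed

lemma norm_quad_le:
  assumes "\<And>n. cmod (x n) \<le> \<alpha> n" "\<And>n. cmod (y n) \<le> \<alpha> n" "\<And>n. cmod (z n) \<le> \<alpha> n" "\<And>n. cmod (u n) \<le> \<alpha> n"
  shows "cmod (quad x y z u p) \<le> \<alpha> (i1 p) * \<alpha> (i2 p) * \<alpha> (i3 p) * \<alpha> (i4 p)"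
proof -
  have \<alpha>: "0 \<le> \<alpha> n" for n using order.trans[OF norm_ge_zero assms(1)] .
  show ?thesis
    unfolding quad_def norm_mult complex_mod_cnj
    by (intro mult_mono assms mult_nonneg_nonneg \<alpha>) auto
qed

lemma quartic_bound:
  assumes a: "in_l1 a" "in_wt w a"
  shows "quartic a summable_on UNIV"
    "cmod (infsum (quartic a) UNIV) \<le> \<mu> * B * (12 * L\<^sup>2 * (wt_sum w a * (l1_norm a)\<^sup>2))"
proof -
  let ?\<alpha> = "\<lambda>n. cmod (a n)"
  have "norm (quartic a p) \<le> \<mu> * B * (W p * (?\<alpha> (i1 p) * ?\<alpha> (i2 p) * ?\<alpha> (i3 p) * ?\<alpha> (i4 p)))" for p
  proof -
    have "norm (quartic a p) = \<bar>M p\<bar> * (\<bar>v (i1 p - i2 p)\<bar> * cmod (quad a a a a p))"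
      by (simp add: quartic_def norm_mult)
    also have "\<dots> \<le> (\<mu> * W p) * (B * (?\<alpha> (i1 p) * ?\<alpha> (i2 p) * ?\<alpha> (i3 p) * ?\<alpha> (i4 p)))"
      using \<mu>_nonneg W_ge[of p] B_nonneg by (intro mult_mono M_bound v_bound norm_quad_le) auto
    finally show ?thesis by (simp only: mult_ac)
  qed
  note d = dominated_quad[OF a(1) _ _ this mult_nonneg_nonneg[OF \<mu>_nonneg B_nonneg]]
  show "quartic a summable_on UNIV" by (rule d(1)) (use a in auto)
  show "cmod (infsum (quartic a) UNIV) \<le> \<mu> * B * (12 * L\<^sup>2 * (wt_sum w a * (l1_norm a)\<^sup>2))"
    using d(3) a by (simp add: wt_sum_def l1_norm_def)
qed

text \<open>One sequence that dominates every entry of the quartic form and of its time derivative, so that a single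
  application of \<open>quadrilinear_bound\<close> covers all terms.\<close>

definition "majorant a n = cmod (a n) + cmod (hartree_seq v a n)"

lemma majorant:
  assumes a: "in_l1 a" "in_wt w a"
  shows "majorant a summable_on UNIV" "in_wt w (\<lambda>n. of_real (majorant a n))"
    "infsum (majorant a) UNIV \<le> l1_norm a + B * (l1_norm a) ^ 3"
    "wt_sum w (\<lambda>n. of_real (majorant a n)) \<le> 2 * (1 + 10 * L ^ 4 * B\<^sup>2 * (l1_norm a) ^ 4) * wt_sum w a"
    "0 \<le> majorant a n" "cmod (a n) \<le> majorant a n" "cmod (hartree_seq v a n) \<le> majorant a n"
proof -
  note F = hartree_seq_bound[OF a(1)] and Fw = hartree_seq_wt[OF a]
  show "majorant a summable_on UNIV"
    unfolding majorant_def by (intro summable_on_add a F)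
  have "infsum (majorant a) UNIV = l1_norm a + l1_norm (hartree_seq v a)"
    unfolding majorant_def l1_norm_def by (intro infsum_add a F)
  then show "infsum (majorant a) UNIV \<le> l1_norm a + B * (l1_norm a) ^ 3" using F(2) by simp
  let ?h = "\<lambda>n. 2 * (w n * (cmod (a n))\<^sup>2 + w n * (cmod (hartree_seq v a n))\<^sup>2)"
  have h: "?h summable_on UNIV" by (intro summable_on_cmult_right summable_on_add a Fw)
  have le: "w n * (cmod (of_real (majorant a n)))\<^sup>2 \<le> ?h n" for n
  proof -
    have "(cmod (a n) + cmod (hartree_seq v a n))\<^sup>2 \<le> 2 * ((cmod (a n))\<^sup>2 + (cmod (hartree_seq v a n))\<^sup>2)"
      using sum_squares_bound[of "cmod (a n)" "cmod (hartree_seq v a n)"] by (simp add: power2_sum)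
    from mult_left_mono[OF this, of "w n"]
    have "w n * (cmod (a n) + cmod (hartree_seq v a n))\<^sup>2 \<le> ?h n"
      by (simp add: distrib_left mult.left_commute)
    moreover have "cmod (of_real (majorant a n)) = cmod (a n) + cmod (hartree_seq v a n)"
      by (simp add: majorant_def del: of_real_add)
    ultimately show ?thesis by (simp only:)
  qed
  show s: "in_wt w (\<lambda>n. of_real (majorant a n))"
    by (rule summable_on_comparison_test[OF h le]) auto
  have "wt_sum w (\<lambda>n. of_real (majorant a n)) \<le> infsum ?h UNIV"
    unfolding wt_sum_def by (rule infsum_mono[OF s h le])
  also have "\<dots> = 2 * (wt_sum w a + wt_sum w (hartree_seq v a))"
    unfolding wt_sum_def by (subst infsum_cmult_right') (simp add: infsum_add[OF a(2) Fw(1)])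
  also have "\<dots> \<le> 2 * (1 + 10 * L ^ 4 * B\<^sup>2 * (l1_norm a) ^ 4) * wt_sum w a"
    using Fw(2) by (simp add: algebra_simps)
  finally show "wt_sum w (\<lambda>n. of_real (majorant a n)) \<le> 2 * (1 + 10 * L ^ 4 * B\<^sup>2 * (l1_norm a) ^ 4) * wt_sum w a" .
qed (auto simp: majorant_def)

text \<open>Linear in \<open>S\<close>: with \<open>K\<close> fixed by the H^1 norm, the derivative
  of the modified energy is at most a multiple of the weighted norm itself.\<close>

definition "majorant_bound K S =
  12 * L\<^sup>2 * (2 * (1 + 10 * L ^ 4 * B\<^sup>2 * K ^ 4) * S * (K + B * K ^ 3)\<^sup>2)"

lemma majorant_bound:
  assumes a: "in_l1 a" "in_wt w a" and K: "l1_norm a \<le> K" and S: "wt_sum w a \<le> S"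
  shows "12 * L\<^sup>2 * (wt_sum w (\<lambda>n. of_real (majorant a n)) * (infsum (majorant a) UNIV)\<^sup>2) \<le> majorant_bound K S"
    "wt_sum w (\<lambda>n. of_real (majorant a n)) \<le> 2 * (1 + 10 * L ^ 4 * B\<^sup>2 * K ^ 4) * S"
proof -
  note m = majorant[OF a]
  have l0: "0 \<le> l1_norm a" "0 \<le> wt_sum w a" by (auto simp: l1_norm_nonneg wt_sum_nonneg)
  then have K0: "0 \<le> K" "0 \<le> S" using K S by linarith+
  have p: "(l1_norm a) ^ k \<le> K ^ k" for k by (intro power_mono K l0)
  have 1: "infsum (majorant a) UNIV \<le> K + B * K ^ 3"
    using m(3) K mult_left_mono[OF p[of 3] B_nonneg] by linarith
  have "2 * (1 + 10 * L ^ 4 * B\<^sup>2 * (l1_norm a) ^ 4) * wt_sum w a \<le> 2 * (1 + 10 * L ^ 4 * B\<^sup>2 * K ^ 4) * S"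
    using S l0 K0 by (intro mult_mono add_mono mult_left_mono p) auto
  then show 2: "wt_sum w (\<lambda>n. of_real (majorant a n)) \<le> 2 * (1 + 10 * L ^ 4 * B\<^sup>2 * K ^ 4) * S"
    using m(4) by linarith
  have "0 \<le> infsum (majorant a) UNIV" by (intro infsum_nonneg m)
  then show "12 * L\<^sup>2 * (wt_sum w (\<lambda>n. of_real (majorant a n)) * (infsum (majorant a) UNIV)\<^sup>2) \<le> majorant_bound K S"
    unfolding majorant_bound_def using K0
    by (intro mult_left_mono mult_mono power_mono 1 2) auto
qed

lemma quartic_deriv_bound:
  assumes a: "in_l1 a" "in_wt w a" "l1_norm a \<le> K" "wt_sum w a \<le> S"
    and b: "b = (\<lambda>n. - \<i> * hartree_seq v a n)"
  shows "quartic_deriv a b summable_on UNIV"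
    "cmod (infsum (quartic_deriv a b) UNIV) \<le> 4 * \<mu> * B * majorant_bound K S"
    "cmod (quartic_deriv a b p) \<le> 4 * \<mu> * B * (W p * (majorant a (i1 p) * majorant a (i2 p) * majorant a (i3 p) * majorant a (i4 p)))"
proof -
  note m = majorant[OF a(1,2)]
  have bm: "cmod (b n) \<le> majorant a n" for n using m(7) by (simp add: b norm_mult)
  let ?P = "\<lambda>p. majorant a (i1 p) * majorant a (i2 p) * majorant a (i3 p) * majorant a (i4 p)"
  show le: "cmod (quartic_deriv a b p) \<le> 4 * \<mu> * B * (W p * ?P p)" for p
  proof -
    have "cmod (quad b a a a p + quad a b a a p + quad a a b a p + quad a a a b p)
      \<le> ?P p + ?P p + ?P p + ?P p"
      by (intro norm_triangle_le add_mono norm_quad_le m bm)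
    then have "cmod (quartic_deriv a b p) \<le> (\<mu> * W p) * (B * (4 * ?P p))"
      unfolding quartic_deriv_def norm_mult norm_of_real
      using \<mu>_nonneg W_ge[of p] B_nonneg by (intro mult_mono M_bound v_bound) auto
    then show ?thesis by (simp only: mult_ac)
  qed
  have c: "0 \<le> 4 * \<mu> * B" using \<mu>_nonneg B_nonneg by simp
  note d = dominated_quad[OF m(1,2,5) le c]
  show "quartic_deriv a b summable_on UNIV" by (rule d(1))
  show "cmod (infsum (quartic_deriv a b) UNIV) \<le> 4 * \<mu> * B * majorant_bound K S"
    using d(3) mult_left_mono[OF majorant_bound(1)[OF a] c] by linarith
qed

text \<open>The two sums on the left are the time derivatives of the quadratic part and of the
  correction. The linear evolution is absent from the first because it only rotates each
  coefficient.\<close>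

lemma energy_derivative_identity:
  assumes a: "in_l1 a" "in_wt w a" and b: "b = (\<lambda>n. - \<i> * hartree_seq v a n)"
  shows "(\<lambda>n. g n * (2 * Im (cnj (a n) * hartree_seq v a n))) summable_on UNIV"
    "(\<lambda>p. quartic_deriv a b p - \<i> * of_real (resonance p) * quartic a p) summable_on UNIV"
    "(\<Sum>\<^sub>\<infinity>n. g n * (2 * Im (cnj (a n) * hartree_seq v a n)))
      + cst / 2 * Re (\<Sum>\<^sub>\<infinity>p. quartic_deriv a b p - \<i> * of_real (resonance p) * quartic a p)
      = cst / 2 * Re (infsum (quartic_deriv a b) UNIV)"
proof -
  let ?F = "hartree_seq v a"
  let ?\<alpha> = "\<lambda>n. cmod (a n)"
  let ?P = "\<lambda>p. ?\<alpha> (i1 p) * ?\<alpha> (i2 p) * ?\<alpha> (i3 p) * ?\<alpha> (i4 p)"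
  let ?D = "\<lambda>p. g (i1 p) - g (i2 p) + g (i3 p) - g (i4 p)"
  \<comment> \<open>The weight is moved into the last entry, so that \<open>trilinear_form\<close>
    produces the multiplier g(n4) that \<open>symmetrize\<close> expects.\<close>
  let ?y = "\<lambda>n. of_real (g n) * a n"
  have \<alpha>w: "in_wt w (\<lambda>n. of_real (?\<alpha> n))" using a by simp
  have q: "cmod (quad a a a a p) = ?P p" for p by (simp add: quad_def norm_mult)
  have gs: "(\<lambda>p. norm (g (j p) * cmod (quad a a a a p))) summable_on UNIV"
    if "j \<in> {i1, i2, i3, i4}" for j
  proof (rule dominated_quad(2)[OF a(1) \<alpha>w, where C = 1])
    show "norm (g (j p) * cmod (quad a a a a p)) \<le> 1 * (W p * ?P p)" for p
    proof -
      have "\<bar>g (j p)\<bar> \<le> w (j p)" by (rule g_bound)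
      also have "\<dots> \<le> W p" using that by auto
      finally show ?thesis unfolding q norm_mult by (auto intro!: mult_right_mono)
    qed
  qed auto
  have gs': "(\<lambda>p. g (j p) * cmod (quad a a a a p)) summable_on UNIV" if "j \<in> {i1, i2, i3, i4}" for j
    by (rule abs_summable_summable[OF gs[OF that]])
  have qy: "cmod (quad a a a ?y p) = \<bar>g (i4 p) * cmod (quad a a a a p)\<bar>" for p
    by (simp add: quad_def norm_mult abs_mult mult_ac)
  have sy: "(\<lambda>p. cmod (quad a a a ?y p)) summable_on UNIV"
    unfolding qy using gs[of i4] by simp
  note t = trilinear_form[OF a(1) sy]
  have im: "g n * (2 * Im (cnj (a n) * ?F n)) = 2 * Im (?F n * cnj (?y n))" for n
    by (simp add: algebra_simps)
  have sIm: "(\<lambda>n. Im (?F n * cnj (?y n))) summable_on UNIV" by (rule summable_on_Im[OF t(2)])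
  show "(\<lambda>n. g n * (2 * Im (cnj (a n) * ?F n))) summable_on UNIV"
    unfolding im by (rule summable_on_cmult_right[OF sIm])
  have "(\<Sum>\<^sub>\<infinity>n. g n * (2 * Im (cnj (a n) * ?F n))) = 2 * Im (\<Sum>\<^sub>\<infinity>n. ?F n * cnj (?y n))"
    unfolding im infsum_cmult_right[OF sIm] infsum_Im[OF t(2)] ..
  also have "\<dots> = 2 * cst * Im (\<Sum>\<^sub>\<infinity>p. vq p * quad a a a ?y p)"
    unfolding t(3) by simp
  also have "(\<lambda>p. vq p * quad a a a ?y p) = (\<lambda>p. of_real (g (i4 p)) * (vq p * quad a a a a p))"
    by (simp add: quad_def fun_eq_iff mult_ac)
  also have "2 * cst * Im (\<Sum>\<^sub>\<infinity>p. of_real (g (i4 p)) * (vq p * quad a a a a p))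
    = - (cst / 2) * Im (\<Sum>\<^sub>\<infinity>p. of_real (?D p) * (vq p * quad a a a a p))"
  proof -
    have "Im (\<Sum>\<^sub>\<infinity>p. of_real (?D p) * (vq p * quad a a a a p))
      = - 4 * Im (\<Sum>\<^sub>\<infinity>p. of_real (g (i4 p)) * (vq p * quad a a a a p))"
      by (rule symmetrize[where g = g and a = a, OF gs'])
    then show ?thesis by simp
  qed
  finally have A: "(\<Sum>\<^sub>\<infinity>n. g n * (2 * Im (cnj (a n) * ?F n)))
    = - (cst / 2) * Im (\<Sum>\<^sub>\<infinity>p. of_real (?D p) * (vq p * quad a a a a p))" .
  let ?R = "\<lambda>p. of_real (?D p) * (vq p * quad a a a a p)"
  \<comment> \<open>The unbounded resonance function disappears into the alternating sum of
    \<open>g\<close>, which \<open>W\<close> dominates; this makes the series summable.\<close>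
  have rq: "of_real (resonance p) * quartic a p = ?R p" for p
    unfolding quartic_def M_resonance[symmetric] by simp
  have Rs: "?R summable_on UNIV"
  proof (rule dominated_quad(1)[OF a(1) \<alpha>w _ _ B_nonneg])
    show "norm (?R p) \<le> B * (W p * ?P p)" for p
    proof -
      have "\<bar>?D p\<bar> \<le> W p"
        using g_bound[of "i1 p"] g_bound[of "i2 p"] g_bound[of "i3 p"] g_bound[of "i4 p"] by linarith
      then have "norm (?R p) \<le> W p * (B * ?P p)"
        unfolding norm_mult norm_of_real q using W_ge[of p] B_nonneg
        by (intro mult_mono v_bound) auto
      then show ?thesis by (simp only: mult.left_commute)
    qed
  qed auto
  have Qs: "quartic_deriv a b summable_on UNIV"
    by (rule quartic_deriv_bound(1)[OF a order.refl order.refl b])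
  have iR: "(\<lambda>p. \<i> * ?R p) summable_on UNIV" by (rule summable_on_cmult_right[OF Rs])
  have eq: "quartic_deriv a b p - \<i> * of_real (resonance p) * quartic a p = quartic_deriv a b p - \<i> * ?R p" for p
    unfolding rq[symmetric] by (simp only: mult.assoc)
  show "(\<lambda>p. quartic_deriv a b p - \<i> * of_real (resonance p) * quartic a p) summable_on UNIV"
    unfolding eq by (rule infsum_minus(1)[OF Qs iR])
  have "Re (\<Sum>\<^sub>\<infinity>p. quartic_deriv a b p - \<i> * of_real (resonance p) * quartic a p)
    = Re (infsum (quartic_deriv a b) UNIV - \<i> * infsum ?R UNIV)"
    unfolding eq infsum_minus(2)[OF Qs iR] infsum_cmult_right[OF Rs] ..
  then show "(\<Sum>\<^sub>\<infinity>n. g n * (2 * Im (cnj (a n) * ?F n)))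
      + cst / 2 * Re (\<Sum>\<^sub>\<infinity>p. quartic_deriv a b p - \<i> * of_real (resonance p) * quartic a p)
      = cst / 2 * Re (infsum (quartic_deriv a b) UNIV)"
    unfolding A by (simp add: algebra_simps)
qed

end

section \<open>Evolution of the modified energy in time\<close>

text \<open>Differentiability is required for each frequency separately, since no summability of the
  derivatives is at hand.\<close>

locale hartree_flow = hartree_coeffs v B
  for v :: "int \<Rightarrow> real" and B :: real +
  fixes a :: "real \<Rightarrow> int \<Rightarrow> complex"
  assumes deriv: "((\<lambda>t. a t n) has_vector_derivative
      (- \<i> * (of_int n)\<^sup>2 * a t n - \<i> * hartree_seq v (a t) n)) (at t)"
    and l1: "in_l1 (a t)"

lemma has_vector_derivative_cnj:
  assumes "(f has_vector_derivative d) F"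
  shows "((\<lambda>t. cnj (f t)) has_vector_derivative cnj d) F"
  by (rule bounded_linear.has_vector_derivative[OF bounded_linear_cnj assms])

lemma has_vector_derivative_quad:
  assumes "\<And>n. ((\<lambda>t. a t n) has_vector_derivative d n) (at t)"
  shows "((\<lambda>t. quad (a t) (a t) (a t) (a t) p) has_vector_derivative
    (quad d (a t) (a t) (a t) p + quad (a t) d (a t) (a t) p + quad (a t) (a t) d (a t) p + quad (a t) (a t) (a t) d p)) (at t)"
  unfolding quad_def
  by (auto intro!: derivative_eq_intros has_vector_derivative_mult has_vector_derivative_cnj assms simp: algebra_simps)

lemma has_vector_derivative_cmod_square:
  assumes "(f has_vector_derivative d) (at t)"
  shows "((\<lambda>t. (cmod (f t))\<^sup>2) has_vector_derivative 2 * Re (cnj (f t) * d)) (at t)"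
proof -
  have "((\<lambda>t. Re (f t * cnj (f t))) has_vector_derivative Re (f t * cnj d + d * cnj (f t))) (at t)"
    by (intro bounded_linear.has_vector_derivative[OF bounded_linear_Re]
        has_vector_derivative_mult has_vector_derivative_cnj assms)
  moreover have "Re (f t * cnj d + d * cnj (f t)) = 2 * Re (cnj (f t) * d)"
    by (simp add: algebra_simps)
  moreover have "Re (z * cnj z) = (cmod z)\<^sup>2" for z
    unfolding complex_norm_square[symmetric] by simp
  ultimately show ?thesis by (simp add: mult_ac)
qed

locale weighted_flow = hartree_flow v B a + energy_weight v B \<theta> L g M \<mu>
  for v B a \<theta> L g M \<mu>
begin

abbreviation "force t \<equiv> \<lambda>n. - \<i> * hartree_seq v (a t) n"

text \<open>Box sums are differentiated and the limit is taken under the time integral. The boxes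
  leave n4 free and are not invariant under \<open>quad_swap\<close> and \<open>quad_flip\<close>,
  so the cancellation is available only in the limit; before it, a bound uniform in the box must
  suffice.\<close>

lemma modified_energy_has_integral:
  assumes t: "t1 \<le> t2"
    and bd: "\<And>t. t \<in> {t1..t2} \<Longrightarrow> in_wt w (a t) \<and> l1_norm (a t) \<le> K \<and> wt_sum w (a t) \<le> S"
  shows "((\<lambda>t. cst / 2 * Re (infsum (quartic_deriv (a t) (force t)) UNIV)) has_integral
    modified_energy (a t2) - modified_energy (a t1)) {t1..t2}"
proof -
  define q' where "q' t p = quartic_deriv (a t) (force t) p - \<i> * of_real (resonance p) * quartic (a t) p" for t p
  define m' where "m' t n = g n * (2 * Im (cnj (a t n) * hartree_seq v (a t) n))" for t n
  define E where "E R t = (\<Sum>n\<in>box_int R. g n * (cmod (a t n))\<^sup>2) + cst / 2 * Re (\<Sum>p\<in>box3 R. quartic (a t) p)" for R t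
  define D where "D R t = (\<Sum>n\<in>box_int R. m' t n) + cst / 2 * Re (\<Sum>p\<in>box3 R. q' t p)" for R t
  define C1 where "C1 = 2 * (1 + 10 * L ^ 4 * B\<^sup>2 * K ^ 4) * S"
  \<comment> \<open>\<open>4 * \<mu> * B\<close> accounts for the four forced terms,
    \<open>B\<close> for the rotating term, where the product of \<open>M\<close> and the resonance
    function is at most \<open>W\<close>.\<close>
  define C2 where "C2 = (4 * \<mu> * B + B) * majorant_bound K S"
  have dm: "((\<lambda>t. g n * (cmod (a t n))\<^sup>2) has_vector_derivative m' t n) (at t)" for n t
  proof -
    have "Re (cnj (a t n) * (- \<i> * (of_int n)\<^sup>2 * a t n - \<i> * hartree_seq v (a t) n))
      = Im (cnj (a t n) * hartree_seq v (a t) n)"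
    proof -
      have "cnj (a t n) * (- \<i> * (of_int n)\<^sup>2 * a t n - \<i> * hartree_seq v (a t) n)
        = - \<i> * of_real ((of_int n)\<^sup>2 * (cmod (a t n))\<^sup>2) - \<i> * (cnj (a t n) * hartree_seq v (a t) n)"
      proof -
        have "(of_int n :: complex)\<^sup>2 = of_real ((of_int n)\<^sup>2)" by simp
        then show ?thesis
          by (simp only: of_real_mult complex_norm_square) (simp only: algebra_simps)
      qed
      then show ?thesis by simp
    qed
    then have "((\<lambda>t. (cmod (a t n))\<^sup>2) has_vector_derivative 2 * Im (cnj (a t n) * hartree_seq v (a t) n)) (at t)"
      using has_vector_derivative_cmod_square[OF deriv[of n t]] by (simp only:)
    from has_vector_derivative_mult_right[OF this, of "g n"] show ?thesis by (simp only: m'_def)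
  qed
  have dq: "((\<lambda>t. quartic (a t) p) has_vector_derivative q' t p) (at t)" for p t
  proof -
    let ?d = "\<lambda>n. - \<i> * (of_int n)\<^sup>2 * a t n - \<i> * hartree_seq v (a t) n"
    let ?a = "a t"
    have "((\<lambda>t. of_real (M p) * (vq p * quad (a t) (a t) (a t) (a t) p)) has_vector_derivative
      of_real (M p) * (vq p * (quad ?d ?a ?a ?a p + quad ?a ?d ?a ?a p + quad ?a ?a ?d ?a p + quad ?a ?a ?a ?d p))) (at t)"
      by (intro has_vector_derivative_mult_right has_vector_derivative_quad deriv)
    moreover have "of_real (M p) * (vq p * (quad ?d ?a ?a ?a p + quad ?a ?d ?a ?a p + quad ?a ?a ?d ?a p + quad ?a ?a ?a ?d p))
      = q' t p"
    proof -
      \<comment> \<open>An entry of frequency n contributes -i n^2, a conjugated one +i n^2;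
        together they give -i times the resonance function.\<close>
      have rot: "quad ?d ?a ?a ?a p + quad ?a ?d ?a ?a p + quad ?a ?a ?d ?a p + quad ?a ?a ?a ?d p
        = (quad (force t) ?a ?a ?a p + quad ?a (force t) ?a ?a p + quad ?a ?a (force t) ?a p + quad ?a ?a ?a (force t) p)
          - \<i> * of_real (resonance p) * quad ?a ?a ?a ?a p" (is "_ = ?Y - ?r * ?X")
        by (simp add: quad_def resonance_def algebra_simps)
      have "m * (u * (Y - r * X)) = m * (u * Y) - r * (m * (u * X))" for m u Y r X :: complex
        by (simp add: algebra_simps)
      then show ?thesis
        unfolding rot q'_def quartic_deriv_def quartic_def .
    qed
    ultimately show ?thesis
      unfolding quartic_def by (simp only:)
  qed
  have dE: "(E R has_vector_derivative D R t) (at t)" for R t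
    unfolding E_def[abs_def] D_def
    by (intro has_vector_derivative_add has_vector_derivative_sum has_vector_derivative_mult_right
        bounded_linear.has_vector_derivative[OF bounded_linear_Re] dm dq)
  have int: "(D R has_integral (E R t2 - E R t1)) {t1..t2}" for R
    by (rule fundamental_theorem_of_calculus[OF t]) (rule has_vector_derivative_at_within[OF dE])
  show ?thesis
  proof (rule has_integral_dominated_convergence[OF int])
    show "(\<lambda>_. C1 + C2) integrable_on {t1..t2}" by (rule integrable_const_ivl)
    show "\<forall>t\<in>{t1..t2}. norm (D R t) \<le> C1 + C2" for R
    proof
      fix t assume "t \<in> {t1..t2}"
      note b = bd[OF this, THEN conjunct1] bd[OF this, THEN conjunct2, THEN conjunct1] bd[OF this, THEN conjunct2, THEN conjunct2]
      note m = majorant[OF l1 b(1)] and mb = majorant_bound[OF l1 b]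
      let ?\<alpha> = "majorant (a t)"
      have "norm (\<Sum>n\<in>box_int R. m' t n) \<le> (\<Sum>n\<in>box_int R. w n * (cmod (of_real (?\<alpha> n)))\<^sup>2)"
      proof (rule sum_norm_le)
        fix n
        have "\<bar>2 * Im (cnj (a t n) * hartree_seq v (a t) n)\<bar> \<le> 2 * (cmod (a t n) * cmod (hartree_seq v (a t) n))"
          using abs_Im_le_cmod[of "cnj (a t n) * hartree_seq v (a t) n"] by (simp add: norm_mult)
        also have "\<dots> \<le> (cmod (a t n) + cmod (hartree_seq v (a t) n))\<^sup>2"
          by (simp add: power2_sum)
        also have "\<dots> = (cmod (of_real (?\<alpha> n)))\<^sup>2"
          unfolding norm_of_real power2_abs majorant_def ..
        finally show "norm (m' t n) \<le> w n * (cmod (of_real (?\<alpha> n)))\<^sup>2"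
          unfolding m'_def real_norm_def abs_mult[of "g n"] by (intro mult_mono g_bound) auto
      qed
      also have "\<dots> \<le> wt_sum w (\<lambda>n. of_real (?\<alpha> n))"
        unfolding wt_sum_def by (rule finite_sum_le_infsum[OF m(2)]) auto
      also have "\<dots> \<le> C1" unfolding C1_def by (rule mb(2))
      finally have 1: "norm (\<Sum>n\<in>box_int R. m' t n) \<le> C1" .
      let ?P = "\<lambda>p. ?\<alpha> (i1 p) * ?\<alpha> (i2 p) * ?\<alpha> (i3 p) * ?\<alpha> (i4 p)"
      have q'le: "norm (q' t p) \<le> (4 * \<mu> * B + B) * (W p * ?P p)" for p
      proof -
        have "norm (\<i> * of_real (resonance p) * quartic (a t) p)
          = \<bar>M p * resonance p\<bar> * (\<bar>v (i1 p - i2 p)\<bar> * cmod (quad (a t) (a t) (a t) (a t) p))"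
          by (simp add: quartic_def norm_mult abs_mult mult_ac)
        also have "\<dots> \<le> W p * (B * ?P p)"
        proof (intro mult_mono v_bound norm_quad_le m)
          show "\<bar>M p * resonance p\<bar> \<le> W p"
            unfolding M_resonance
            using g_bound[of "i1 p"] g_bound[of "i2 p"] g_bound[of "i3 p"] g_bound[of "i4 p"] by linarith
        qed (use W_ge[of p] B_nonneg in auto)
        finally have "norm (\<i> * of_real (resonance p) * quartic (a t) p) \<le> B * (W p * ?P p)"
          by (simp only: mult.left_commute)
        moreover have "norm (quartic_deriv (a t) (force t) p) \<le> 4 * \<mu> * B * (W p * ?P p)"
          by (rule quartic_deriv_bound(3)[OF l1 b refl])
        ultimately show ?thesis
          unfolding q'_def distrib_right by (intro norm_triangle_le_diff add_mono)
      qed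
      have c: "0 \<le> 4 * \<mu> * B + B" using \<mu>_nonneg B_nonneg by simp
      have "norm (\<Sum>p\<in>box3 R. q' t p) \<le> C2"
        using dominated_quad(4)[OF m(1,2,5) q'le c finite_box3, of R] mult_left_mono[OF mb(1) c]
        unfolding C2_def by linarith
      then have "\<bar>Re (\<Sum>p\<in>box3 R. q' t p)\<bar> \<le> C2"
        using abs_Re_le_cmod order.trans by blast
      then have "\<bar>cst / 2 * Re (\<Sum>p\<in>box3 R. q' t p)\<bar> \<le> 1 * C2"
        unfolding abs_mult using cst by (intro mult_mono) auto
      then show "norm (D R t) \<le> C1 + C2"
        using 1 unfolding D_def by (intro norm_triangle_le add_mono) auto
    qed
    show "\<forall>t\<in>{t1..t2}. (\<lambda>R. D R t) \<longlonglongrightarrow> cst / 2 * Re (infsum (quartic_deriv (a t) (force t)) UNIV)"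
    proof
      fix t assume "t \<in> {t1..t2}"
      note b = bd[OF this, THEN conjunct1]
      note e = energy_derivative_identity[OF l1 b refl, folded m'_def q'_def]
      show "(\<lambda>R. D R t) \<longlonglongrightarrow> cst / 2 * Re (infsum (quartic_deriv (a t) (force t)) UNIV)"
        unfolding D_def e(3)[symmetric]
        by (intro tendsto_add tendsto_mult_left tendsto_Re has_sum_box_int has_sum_box3 has_sum_infsum e(1,2))
    qed
    have lim: "(\<lambda>R. E R t) \<longlonglongrightarrow> modified_energy (a t)" if "t \<in> {t1..t2}" for t
    proof -
      note b = bd[OF that, THEN conjunct1]
      have "(\<lambda>n. g n * (cmod (a t n))\<^sup>2) summable_on UNIV"
        by (rule norm_infsum_le_infsum(1)[OF b]) (auto simp: abs_mult intro!: mult_right_mono g_bound)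
      then show ?thesis
        unfolding E_def modified_energy_def
        by (intro tendsto_add tendsto_mult_left tendsto_Re has_sum_box_int has_sum_box3 has_sum_infsum quartic_bound(1) l1 b)
    qed
    show "(\<lambda>R. E R t2 - E R t1) \<longlonglongrightarrow> modified_energy (a t2) - modified_energy (a t1)"
      using t by (intro tendsto_diff lim) auto
  qed
qed

lemma modified_energy_change:
  assumes "t1 \<le> t2"
    and bd: "\<And>t. t \<in> {t1..t2} \<Longrightarrow> in_wt w (a t) \<and> l1_norm (a t) \<le> K \<and> wt_sum w (a t) \<le> S"
  shows "\<bar>modified_energy (a t2) - modified_energy (a t1)\<bar> \<le> 2 * \<mu> * B * majorant_bound K S * (t2 - t1)"
proof -
  let ?f = "\<lambda>t. cst / 2 * Re (infsum (quartic_deriv (a t) (force t)) UNIV)"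
  have fb: "norm (?f t) \<le> 2 * \<mu> * B * majorant_bound K S" if "t \<in> {t1..t2}" for t
  proof -
    note b = bd[OF that, THEN conjunct1] bd[OF that, THEN conjunct2, THEN conjunct1] bd[OF that, THEN conjunct2, THEN conjunct2]
    have "\<bar>Re (infsum (quartic_deriv (a t) (force t)) UNIV)\<bar> \<le> 4 * \<mu> * B * majorant_bound K S"
      using quartic_deriv_bound(2)[OF l1 b refl] abs_Re_le_cmod order.trans by blast
    then have "cst / 2 * \<bar>Re (infsum (quartic_deriv (a t) (force t)) UNIV)\<bar> \<le> 1 / 2 * (4 * \<mu> * B * majorant_bound K S)"
      using cst by (intro mult_mono) auto
    then show ?thesis using cst by (simp add: abs_mult mult_ac)
  qed
  have t1: "t1 \<in> {t1..t2}" using assms(1) by simp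
  have "norm (modified_energy (a t2) - modified_energy (a t1)) \<le> 2 * \<mu> * B * majorant_bound K S * measure lborel (cbox t1 t2)"
  proof (rule has_integral_bound)
    show "0 \<le> 2 * \<mu> * B * majorant_bound K S" using order.trans[OF norm_ge_zero fb[OF t1]] .
    show "(?f has_integral modified_energy (a t2) - modified_energy (a t1)) (cbox t1 t2)"
      using modified_energy_has_integral[OF assms] by simp
  qed (use fb in auto)
  then show ?thesis using assms(1) by simp
qed

end

section \<open>Second differences of Sobolev weights\<close>

text \<open>The mean value inequality twice: first for \<open>f'\<close> with step \<open>h\<close>,
  then for y -> f(y + h) - f(y) with step \<open>k\<close>. By convexity all points stay in [-r, r],
  the only place where \<open>f''\<close> is controlled.\<close>

lemma second_difference_bound:
  fixes f f' f'' :: "real \<Rightarrow> real"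
  assumes f: "\<And>x. (f has_real_derivative f' x) (at x)" and f': "\<And>x. (f' has_real_derivative f'' x) (at x)"
    and bd: "\<And>x. \<bar>x\<bar> \<le> r \<Longrightarrow> \<bar>f'' x\<bar> \<le> c"
    and r: "\<bar>x\<bar> \<le> r" "\<bar>x + h\<bar> \<le> r" "\<bar>x + k\<bar> \<le> r" "\<bar>x + h + k\<bar> \<le> r"
  shows "\<bar>f (x + h + k) - f (x + h) - f (x + k) + f x\<bar> \<le> c * \<bar>h\<bar> * \<bar>k\<bar>"
proof -
  have seg: "\<bar>y\<bar> \<le> r \<and> \<bar>y + h\<bar> \<le> r" if "y \<in> closed_segment x (x + k)" for y
  proof -
    obtain u where "0 \<le> u" "u \<le> 1" "y = (1 - u) *\<^sub>R x + u *\<^sub>R (x + k)"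
      using \<open>y \<in> closed_segment x (x + k)\<close> unfolding in_segment by blast
    then have u: "0 \<le> u" "u \<le> 1" "y = (1 - u) * x + u * (x + k)"
      by (simp_all only: real_scaleR_def)
    have "\<bar>y\<bar> \<le> (1 - u) * \<bar>x\<bar> + u * \<bar>x + k\<bar>"
      unfolding u(3) using u by (auto intro!: order.trans[OF abs_triangle_ineq] simp: abs_mult)
    also have "\<dots> \<le> (1 - u) * r + u * r" using u r by (intro add_mono mult_left_mono) auto
    finally have 1: "\<bar>y\<bar> \<le> r" by (simp add: algebra_simps)
    have "y + h = (1 - u) * (x + h) + u * (x + h + k)" unfolding u(3) by (simp add: algebra_simps)
    then have "\<bar>y + h\<bar> \<le> (1 - u) * \<bar>x + h\<bar> + u * \<bar>x + h + k\<bar>"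
      using u by (auto intro!: order.trans[OF abs_triangle_ineq] simp: abs_mult)
    also have "\<dots> \<le> (1 - u) * r + u * r" using u r by (intro add_mono mult_left_mono) auto
    finally show ?thesis using 1 by (simp add: algebra_simps)
  qed
  have f'diff: "norm (f' (y + h) - f' y) \<le> c * norm (y + h - y)" if "\<bar>y\<bar> \<le> r" "\<bar>y + h\<bar> \<le> r" for y
  proof (rule field_differentiable_bound[where S = "{-r..r}"])
    show "convex {-r..r}" by simp
    show "(f' has_field_derivative f'' z) (at z within {-r..r})" for z
      by (rule has_field_derivative_at_within[OF f'])
    show "norm (f'' z) \<le> c" if "z \<in> {-r..r}" for z
      using that by (auto intro: bd)
  qed (use that in auto)
  have "norm ((f ((x + k) + h) - f (x + k)) - (f (x + h) - f x)) \<le> (c * \<bar>h\<bar>) * norm (x + k - x)"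
  proof (rule field_differentiable_bound[where S = "closed_segment x (x + k)" and f = "\<lambda>y. f (y + h) - f y"])
    show "((\<lambda>y. f (y + h) - f y) has_field_derivative f' (z + h) - f' z) (at z within closed_segment x (x + k))" for z
      by (rule has_field_derivative_at_within) (auto intro!: derivative_eq_intros f DERIV_chain2[OF f] simp: DERIV_shift)
    show "norm (f' (z + h) - f' z) \<le> c * \<bar>h\<bar>" if "z \<in> closed_segment x (x + k)" for z
      using f'diff[of z] seg[OF that] by simp
  qed auto
  then show ?thesis by (simp add: algebra_simps)
qed

text \<open>Comparable to 1 for |x| \<le> N and growing like (|x|/N)^(2s) beyond. Each derivative
  costs a factor 1/N, which makes the quartic correction small.\<close>

definition bracket_pow :: "real \<Rightarrow> real \<Rightarrow> real \<Rightarrow> real" where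
  "bracket_pow N s x = (1 + x\<^sup>2 / N\<^sup>2) powr s"

lemma one_plus_pos: "0 < 1 + x\<^sup>2 / (N::real)\<^sup>2"
  by (simp add: add_pos_nonneg)

lemma bracket_pow_deriv:
  assumes "N > 0"
  shows "(bracket_pow N s has_real_derivative 2 * s * x / N\<^sup>2 * bracket_pow N (s - 1) x) (at x)"
proof -
  have "((\<lambda>x. 1 + x\<^sup>2 / N\<^sup>2) has_real_derivative 2 * x / N\<^sup>2) (at x)"
    using assms by (auto intro!: derivative_eq_intros simp: power2_eq_square field_simps)
  from DERIV_fun_powr[OF this one_plus_pos, of s] show ?thesis
    unfolding bracket_pow_def[abs_def] by (simp add: mult_ac)
qed

lemma bracket_pow_deriv2:
  assumes "N > 0"
  shows "((\<lambda>x. 2 * s * x / N\<^sup>2 * bracket_pow N (s - 1) x) has_real_derivative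
    2 * s / N\<^sup>2 * bracket_pow N (s - 1) x + 4 * s * (s - 1) / N\<^sup>2 * (x\<^sup>2 / N\<^sup>2) * bracket_pow N (s - 2) x) (at x)"
proof -
  have s2: "s - 1 - 1 = s - 2" by simp
  have "((\<lambda>x. 2 * s * x / N\<^sup>2) has_real_derivative 2 * s / N\<^sup>2) (at x)"
    using assms by (auto intro!: derivative_eq_intros simp: power2_eq_square field_simps)
  from DERIV_mult[OF this bracket_pow_deriv[OF assms, of "s - 1", unfolded s2]] show ?thesis
    by (rule DERIV_cong) (simp add: power2_eq_square algebra_simps)
qed

text \<open>Bounding x^2/N^2 by 1 + x^2/N^2 restores one power, and a further power is harmless as
  the base is at least 1. For s \<ge> 1 both terms are nonnegative, and 2s + 4s(s - 1) \<le>
  4s^2.\<close>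

lemma bracket_pow_deriv2_bound:
  assumes "N > 0" "1 \<le> s"
  shows "\<bar>2 * s / N\<^sup>2 * bracket_pow N (s - 1) x + 4 * s * (s - 1) / N\<^sup>2 * (x\<^sup>2 / N\<^sup>2) * bracket_pow N (s - 2) x\<bar>
    \<le> 4 * s\<^sup>2 / N\<^sup>2 * bracket_pow N s x"
proof -
  let ?y = "1 + x\<^sup>2 / N\<^sup>2"
  have y: "0 < ?y" "1 \<le> ?y" by (simp_all add: one_plus_pos)
  have 1: "bracket_pow N (s - 1) x \<le> bracket_pow N s x"
    unfolding bracket_pow_def using y by (intro powr_mono) auto
  have "x\<^sup>2 / N\<^sup>2 * bracket_pow N (s - 2) x \<le> ?y * bracket_pow N (s - 2) x"
    by (intro mult_right_mono) (auto simp: bracket_pow_def)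
  also have "\<dots> = bracket_pow N (s - 1) x"
    unfolding bracket_pow_def using y powr_add[of ?y 1 "s - 2"] by (simp add: algebra_simps)
  also have "\<dots> \<le> bracket_pow N s x" by (rule 1)
  finally have 2: "x\<^sup>2 / N\<^sup>2 * bracket_pow N (s - 2) x \<le> bracket_pow N s x" .
  have c: "0 \<le> 2 * s / N\<^sup>2" "0 \<le> 4 * s * (s - 1) / N\<^sup>2" using assms by auto
  have nn: "0 \<le> bracket_pow N q x" for q by (simp add: bracket_pow_def)
  have "\<bar>2 * s / N\<^sup>2 * bracket_pow N (s - 1) x + 4 * s * (s - 1) / N\<^sup>2 * (x\<^sup>2 / N\<^sup>2) * bracket_pow N (s - 2) x\<bar>
    = 2 * s / N\<^sup>2 * bracket_pow N (s - 1) x + 4 * s * (s - 1) / N\<^sup>2 * (x\<^sup>2 / N\<^sup>2 * bracket_pow N (s - 2) x)"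
    unfolding mult.assoc[of "4 * s * (s - 1) / N\<^sup>2"]
    by (rule abs_of_nonneg) (intro add_nonneg_nonneg mult_nonneg_nonneg[OF c(1)] mult_nonneg_nonneg[OF c(2)]
        mult_nonneg_nonneg nn divide_nonneg_nonneg zero_le_power2)
  also have "\<dots> \<le> 2 * s / N\<^sup>2 * bracket_pow N s x + 4 * s * (s - 1) / N\<^sup>2 * bracket_pow N s x"
    using c 1 2 by (intro add_mono mult_left_mono) auto
  also have "\<dots> = (2 * s + 4 * s * (s - 1)) / N\<^sup>2 * bracket_pow N s x"
    by (simp add: add_divide_distrib distrib_right)
  also have "\<dots> \<le> 4 * s\<^sup>2 / N\<^sup>2 * bracket_pow N s x"
    using assms nn by (intro mult_right_mono divide_right_mono) (auto simp: power2_eq_square algebra_simps)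
  finally show ?thesis .
qed

lemma bracket_pow_mono: "0 \<le> s \<Longrightarrow> \<bar>x\<bar> \<le> \<bar>y\<bar> \<Longrightarrow> bracket_pow N s x \<le> bracket_pow N s y"
  unfolding bracket_pow_def
  by (intro powr_mono2 add_left_mono divide_right_mono) (auto simp: abs_le_square_iff add_nonneg_nonneg)

text \<open>The weight is even and increasing in |x|, so its supremum over the hull of the four
  points is attained at the point of largest modulus, which is one of the summands on the
  right.\<close>

lemma bracket_pow_second_difference:
  assumes N: "N > 0" and s: "1 \<le> s"
  shows "\<bar>bracket_pow N s (x + h + k) - bracket_pow N s (x + h) - bracket_pow N s (x + k) + bracket_pow N s x\<bar>
    \<le> 4 * s\<^sup>2 / N\<^sup>2 * (bracket_pow N s (x + h + k) + bracket_pow N s (x + h) + bracket_pow N s (x + k) + bracket_pow N s x) * \<bar>h\<bar> * \<bar>k\<bar>"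
proof -
  let ?b = "bracket_pow N s"
  define r where "r = Max {\<bar>x\<bar>, \<bar>x + h\<bar>, \<bar>x + k\<bar>, \<bar>x + h + k\<bar>}"
  have r: "\<bar>x\<bar> \<le> r" "\<bar>x + h\<bar> \<le> r" "\<bar>x + k\<bar> \<le> r" "\<bar>x + h + k\<bar> \<le> r"
    unfolding r_def by (auto simp: le_max_iff_disj)
  have nn: "0 \<le> ?b y" for y by (simp add: bracket_pow_def)
  have br: "?b r \<le> ?b (x + h + k) + ?b (x + h) + ?b (x + k) + ?b x"
  proof -
    have "r \<in> {\<bar>x\<bar>, \<bar>x + h\<bar>, \<bar>x + k\<bar>, \<bar>x + h + k\<bar>}" unfolding r_def by (rule Max_in) auto
    moreover have "?b \<bar>y\<bar> = ?b y" for y by (simp add: bracket_pow_def)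
    ultimately have "?b r \<in> {?b x, ?b (x + h), ?b (x + k), ?b (x + h + k)}" by auto
    then show ?thesis using nn[of x] nn[of "x + h"] nn[of "x + k"] nn[of "x + h + k"] by auto
  qed
  have "\<bar>?b (x + h + k) - ?b (x + h) - ?b (x + k) + ?b x\<bar> \<le> (4 * s\<^sup>2 / N\<^sup>2 * ?b r) * \<bar>h\<bar> * \<bar>k\<bar>"
  proof (rule second_difference_bound[OF bracket_pow_deriv[OF N] bracket_pow_deriv2[OF N] _ r])
    fix y assume y: "\<bar>y\<bar> \<le> r"
    have "4 * s\<^sup>2 / N\<^sup>2 * ?b y \<le> 4 * s\<^sup>2 / N\<^sup>2 * ?b r"
      using y s by (intro mult_left_mono bracket_pow_mono) auto
    then show "\<bar>2 * s / N\<^sup>2 * bracket_pow N (s - 1) y + 4 * s * (s - 1) / N\<^sup>2 * (y\<^sup>2 / N\<^sup>2) * bracket_pow N (s - 2) y\<bar>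
      \<le> 4 * s\<^sup>2 / N\<^sup>2 * ?b r"
      using bracket_pow_deriv2_bound[OF N s, of y] by linarith
  qed
  also have "\<dots> \<le> (4 * s\<^sup>2 / N\<^sup>2 * (?b (x + h + k) + ?b (x + h) + ?b (x + k) + ?b x)) * \<bar>h\<bar> * \<bar>k\<bar>"
    by (intro mult_right_mono mult_left_mono br) auto
  finally show ?thesis .
qed

text \<open>On resonances the division by \<open>0\<close> gives \<open>0\<close>, which is harmless because the numerator vanishes there as well.\<close>

definition energy_mult :: "(int \<Rightarrow> real) \<Rightarrow> int \<times> int \<times> int \<Rightarrow> real" where
  "energy_mult g p = (g (i1 p) - g (i2 p) + g (i3 p) - g (i4 p)) / resonance p"

lemma resonance_factor: "resonance p = 2 * of_int (i1 p - i2 p) * of_int (i2 p - i3 p)"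
  by (simp add: resonance_def power2_eq_square algebra_simps)

text \<open>If m is the larger of x and y in modulus, then (x + y)^2 \<le> 4 m^2; the power s/2 of 4
  is the constant \<open>2 powr s\<close>.\<close>

lemma sobolev_weight:
  assumes N: "N > 0" and s: "1 \<le> s"
  shows "subadd_weight (\<lambda>n. bracket_pow N (s / 2) (of_int n)) (2 powr s)"
    "(bracket_pow N (s / 2) x)\<^sup>2 = bracket_pow N s x"
proof -
  show "(bracket_pow N (s / 2) x)\<^sup>2 = bracket_pow N s x" for x
    using one_plus_pos[of x N] by (simp add: bracket_pow_def power2_eq_square flip: powr_add)
  show "subadd_weight (\<lambda>n. bracket_pow N (s / 2) (of_int n)) (2 powr s)"
  proof
    show "1 \<le> bracket_pow N (s / 2) (of_int n)" for n
      unfolding bracket_pow_def using s by (intro ge_one_powr_ge_zero) auto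
    show "bracket_pow N (s / 2) (of_int (- n)) = bracket_pow N (s / 2) (of_int n)" for n
      by (simp add: bracket_pow_def)
    show "1 \<le> 2 powr s" using s by (intro ge_one_powr_ge_zero) auto
    fix k l :: int
    let ?x = "real_of_int k" and ?y = "real_of_int l"
    define m where "m = (if \<bar>?x\<bar> \<le> \<bar>?y\<bar> then ?y else ?x)"
    have m: "\<bar>?x + ?y\<bar> \<le> 2 * \<bar>m\<bar>" by (auto simp: m_def)
    have "(?x + ?y)\<^sup>2 \<le> (2 * m)\<^sup>2" using power_mono[OF m, of 2] by (simp add: power_mult_distrib)
    then have "(?x + ?y)\<^sup>2 / N\<^sup>2 \<le> (4 * m\<^sup>2) / N\<^sup>2" by (intro divide_right_mono) (auto simp: power_mult_distrib)
    then have "1 + (?x + ?y)\<^sup>2 / N\<^sup>2 \<le> 4 * (1 + m\<^sup>2 / N\<^sup>2)" by simp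
    then have "bracket_pow N (s / 2) (?x + ?y) \<le> (4 * (1 + m\<^sup>2 / N\<^sup>2)) powr (s / 2)"
      unfolding bracket_pow_def using s by (intro powr_mono2) (auto simp: add_nonneg_nonneg)
    also have "\<dots> = 4 powr (s / 2) * bracket_pow N (s / 2) m"
      unfolding bracket_pow_def by (rule powr_mult)
    also have "(4::real) powr (s / 2) = 2 powr s"
      using powr_powr[of 2 2 "s / 2"] by simp
    also have "bracket_pow N (s / 2) m \<le> bracket_pow N (s / 2) ?x + bracket_pow N (s / 2) ?y"
      by (auto simp: m_def bracket_pow_def)
    finally show "bracket_pow N (s / 2) (of_int (k + l))
      \<le> 2 powr s * (bracket_pow N (s / 2) ?x + bracket_pow N (s / 2) ?y)"
      by simp
  qed
qed

lemma sobolev_energy_mult: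
  fixes N s :: real
  assumes N: "N > 0" and s: "1 \<le> s"
  defines "g \<equiv> \<lambda>n. bracket_pow N s (of_int n)"
  shows "\<bar>energy_mult g p\<bar> \<le> 2 * s\<^sup>2 / N\<^sup>2 * (g (i1 p) + g (i2 p) + g (i3 p) + g (i4 p))"
    "energy_mult g p * resonance p = g (i1 p) - g (i2 p) + g (i3 p) - g (i4 p)"
proof -
  let ?h = "real_of_int (i1 p - i2 p)" and ?k = "real_of_int (i2 p - i3 p)"
  let ?D = "g (i1 p) - g (i2 p) + g (i3 p) - g (i4 p)" and ?W = "g (i1 p) + g (i2 p) + g (i3 p) + g (i4 p)"
  \<comment> \<open>The four points are n3 = x, n2 = x + k, n4 = x + h and n1 = x + h + k. Division
    by 2hk, the resonance function, turns the constant 4 into 2.\<close>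
  have sd: "\<bar>?D\<bar> \<le> 4 * s\<^sup>2 / N\<^sup>2 * ?W * \<bar>?h\<bar> * \<bar>?k\<bar>"
    using bracket_pow_second_difference[OF N s, of "of_int (i3 p)" ?h ?k]
    by (simp add: g_def algebra_simps)
  have r: "\<bar>resonance p\<bar> = 2 * (\<bar>?h\<bar> * \<bar>?k\<bar>)" by (simp only: resonance_factor abs_mult)
  show "energy_mult g p * resonance p = ?D"
  proof (cases "resonance p = 0")
    case True
    then have "\<bar>?h\<bar> * \<bar>?k\<bar> = 0" using r by simp
    then have "4 * s\<^sup>2 / N\<^sup>2 * ?W * \<bar>?h\<bar> * \<bar>?k\<bar> = 0" by simp
    then have "\<bar>?D\<bar> \<le> 0" using sd by linarith
    then show ?thesis using True by simp
  qed (simp add: energy_mult_def)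
  show "\<bar>energy_mult g p\<bar> \<le> 2 * s\<^sup>2 / N\<^sup>2 * ?W"
  proof (cases "resonance p = 0")
    case True
    have "0 \<le> g n" for n by (simp add: g_def bracket_pow_def)
    then show ?thesis using True by (simp add: energy_mult_def add_nonneg_nonneg)
  next
    case False
    have "\<bar>?D\<bar> \<le> 2 * s\<^sup>2 / N\<^sup>2 * ?W * \<bar>resonance p\<bar>" using sd unfolding r by (simp add: mult_ac)
    then show ?thesis using False by (simp add: energy_mult_def abs_divide field_simps)
  qed
qed

section \<open>Weak derivatives\<close>

lemma summable_int_inverse_square: "(\<lambda>n::int. 1 / (1 + (real_of_int n)\<^sup>2)) summable_on UNIV"
proof -
  let ?f = "\<lambda>n::int. 1 / (1 + (real_of_int n)\<^sup>2)"
  have nat: "(\<lambda>k::nat. 1 / (1 + (real k)\<^sup>2)) summable_on UNIV"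
  proof -
    have "summable (\<lambda>k. inverse ((real (Suc k)) ^ 2))"
      using inverse_power_summable[of 2, where 'a = real] by (subst summable_Suc_iff) simp
    then have "summable (\<lambda>k. 2 * inverse ((real (Suc k)) ^ 2))" by (rule summable_mult)
    then have "summable (\<lambda>k. 1 / (1 + (real k)\<^sup>2))"
    proof (rule summable_comparison_test')
      fix k :: nat assume "0 \<le> k"
      have "(real (Suc k))\<^sup>2 \<le> 2 * (1 + (real k)\<^sup>2)"
        using sum_squares_bound[of "real k" 1] by (simp add: power2_sum)
      then show "norm (1 / (1 + (real k)\<^sup>2)) \<le> 2 * inverse ((real (Suc k)) ^ 2)"
        by (simp add: field_simps add_pos_nonneg)
    qed
    then show ?thesis by (subst summable_on_UNIV_nonneg_real_iff) auto
  qed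
  have 1: "?f summable_on range int"
    using nat by (subst summable_on_reindex) (auto simp: o_def)
  have 2: "?f summable_on range (\<lambda>k. - int k)"
    using nat by (subst summable_on_reindex) (auto simp: o_def inj_def)
  have "UNIV = range int \<union> range (\<lambda>k. - int k)"
  proof (intro set_eqI iffI)
    fix n :: int
    show "n \<in> range int \<union> range (\<lambda>k. - int k)"
      by (cases n rule: int_cases2) auto
  qed simp
  then show ?thesis using summable_on_union[OF 1 2] by simp
qed

section \<open>Parseval, Bessel and Riesz-Fischer\<close>

text \<open>The square of the modulus is itself a synthesised function, with the autocorrelation of
  \<open>b\<close> as coefficients; its integral is the zeroth one.\<close>

lemma parseval_synth:
  assumes "in_l1 b"
  shows "integrable circle_measure (\<lambda>x. (cmod (synth b x))\<^sup>2)"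
    "(LINT x|circle_measure. (cmod (synth b x))\<^sup>2) = 1 / (2 * pi) * (\<Sum>\<^sub>\<infinity>n. (cmod (b n))\<^sup>2)"
proof -
  let ?c = "\<lambda>n. of_real (1 / (2 * pi)) * conv b (cnj_seq b) n"
  have b': "in_l1 (cnj_seq b)" using assms by (simp add: cnj_seq_l1)
  have c: "in_l1 ?c" by (intro in_l1_cmult conv_l1 assms b')
  have eq: "complex_of_real ((cmod (synth b x))\<^sup>2) = synth ?c x" for x
    unfolding complex_norm_square cnj_synth by (rule synth_mult[OF assms b'])
  have "integrable circle_measure (\<lambda>x. Re (complex_of_real ((cmod (synth b x))\<^sup>2)))"
    unfolding eq by (intro integrable_Re integrable_synth c)
  then show "integrable circle_measure (\<lambda>x. (cmod (synth b x))\<^sup>2)" by simp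
  have "complex_of_real (LINT x|circle_measure. (cmod (synth b x))\<^sup>2) = (LINT x|circle_measure. synth ?c x)"
    unfolding eq[symmetric] by (rule integral_complex_of_real[symmetric])
  also have "\<dots> = fourier_coeff (synth ?c) 0" by (simp add: fourier_coeff_cexp)
  also have "\<dots> = of_real (1 / (2 * pi)) * (\<Sum>\<^sub>\<infinity>n. b n * cnj (b n))"
    by (simp only: fourier_coeff_synth[OF c] conv_cnj_seq_0)
  also have "(\<Sum>\<^sub>\<infinity>n. b n * cnj (b n)) = of_real (\<Sum>\<^sub>\<infinity>n. (cmod (b n))\<^sup>2)"
    by (simp only: complex_norm_square[symmetric]
        infsumI[OF has_sum_of_real[OF has_sum_infsum[OF square_summable[OF assms]]]])
  finally show "(LINT x|circle_measure. (cmod (synth b x))\<^sup>2) = 1 / (2 * pi) * (\<Sum>\<^sub>\<infinity>n. (cmod (b n))\<^sup>2)"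
    by (simp only: of_real_mult[symmetric] of_real_eq_iff)
qed

definition trunc :: "int set \<Rightarrow> (int \<Rightarrow> complex) \<Rightarrow> int \<Rightarrow> complex" where
  "trunc F c n = (if n \<in> F then c n else 0)"

lemma infsum_trunc:
  fixes h :: "int \<Rightarrow> complex \<Rightarrow> 'a::banach"
  assumes "finite F" "\<And>n. h n 0 = 0"
  shows "(\<lambda>n. h n (trunc F c n)) summable_on UNIV" "(\<Sum>\<^sub>\<infinity>n. h n (trunc F c n)) = (\<Sum>n\<in>F. h n (c n))"
proof -
  have "((\<lambda>n. h n (trunc F c n)) has_sum (\<Sum>n\<in>F. h n (c n))) UNIV"
    by (rule has_sum_finite_neutralI[of F]) (use assms in \<open>auto simp: trunc_def\<close>)
  then show "(\<lambda>n. h n (trunc F c n)) summable_on UNIV" "(\<Sum>\<^sub>\<infinity>n. h n (trunc F c n)) = (\<Sum>n\<in>F. h n (c n))"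
    by (auto simp: has_sum_iff)
qed

lemma trunc_l1: "finite F \<Longrightarrow> in_l1 (trunc F c)"
  using infsum_trunc(1)[of F "\<lambda>n. cmod"] by simp

text \<open>The inequality suffices because the kinetic energy is only bounded from below.\<close>

lemma bessel_inequality:
  assumes g: "integrable circle_measure g" and g2: "integrable circle_measure (\<lambda>x. (cmod (g x))\<^sup>2)"
    and s: "(\<lambda>n. (cmod (fourier_coeff g n))\<^sup>2) summable_on UNIV"
  shows "1 / (2 * pi) * (\<Sum>\<^sub>\<infinity>n. (cmod (fourier_coeff g n))\<^sup>2) \<le> (LINT x|circle_measure. (cmod (g x))\<^sup>2)"
proof -
  let ?c = "fourier_coeff g"
  have fin: "(\<Sum>n\<in>F. (cmod (?c n))\<^sup>2) \<le> 2 * pi * (LINT x|circle_measure. (cmod (g x))\<^sup>2)" if F: "finite F" for F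
  proof -
    let ?b = "trunc F ?c"
    let ?s = "\<Sum>n\<in>F. (cmod (?c n))\<^sup>2"
    have b: "in_l1 ?b" by (rule trunc_l1[OF F])
    have b': "in_l1 (cnj_seq ?b)" using b by (simp add: cnj_seq_l1)
    have "(LINT x|circle_measure. g x * cnj (synth ?b x)) = of_real (1 / (2 * pi)) * (\<Sum>\<^sub>\<infinity>n. cnj_seq ?b n * ?c (- n))"
      unfolding cnj_synth by (rule integral_mult_synth[OF b' g])
    also have "(\<Sum>\<^sub>\<infinity>n. cnj_seq ?b n * ?c (- n)) = (\<Sum>\<^sub>\<infinity>n. cnj (?b n) * ?c n)"
      unfolding cnj_seq_def by (rule infsum_reindex_bij_witness[of UNIV uminus uminus]) auto
    also have "\<dots> = (\<Sum>n\<in>F. cnj (?c n) * ?c n)"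
      by (rule infsum_trunc(2)[OF F, of "\<lambda>n z. cnj z * ?c n"]) simp
    also have "\<dots> = of_real ?s"
      by (simp add: complex_norm_square mult.commute del: of_real_power)
    finally have ip: "(LINT x|circle_measure. g x * cnj (synth ?b x)) = of_real (1 / (2 * pi) * ?s)"
      by (simp only: of_real_mult)
    have ps: "(LINT x|circle_measure. (cmod (synth ?b x))\<^sup>2) = 1 / (2 * pi) * ?s"
      unfolding parseval_synth(2)[OF b] by (subst infsum_trunc(2)[OF F, of "\<lambda>n z. (cmod z)\<^sup>2"]) auto
    have ii: "integrable circle_measure (\<lambda>x. g x * cnj (synth ?b x))"
      unfolding cnj_synth by (rule integrable_mult_synth[OF b' g])
    have sq: "(cmod (g x - synth ?b x))\<^sup>2 = (cmod (g x))\<^sup>2 - 2 * Re (g x * cnj (synth ?b x)) + (cmod (synth ?b x))\<^sup>2" for x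
      unfolding cmod_power2 by (simp add: power2_eq_square algebra_simps)
    have "0 \<le> (LINT x|circle_measure. (cmod (g x - synth ?b x))\<^sup>2)"
      by (intro integral_nonneg_AE) auto
    also have "\<dots> = (LINT x|circle_measure. (cmod (g x))\<^sup>2) - 2 * (LINT x|circle_measure. Re (g x * cnj (synth ?b x)))
      + (LINT x|circle_measure. (cmod (synth ?b x))\<^sup>2)"
    proof -
      have "(LINT x|circle_measure. p x - 2 * q x + r x) = (LINT x|circle_measure. p x) - 2 * (LINT x|circle_measure. q x) + (LINT x|circle_measure. r x)"
        if "integrable circle_measure p" "integrable circle_measure q" "integrable circle_measure r" for p q r :: "real \<Rightarrow> real"
        using that by simp
      then show ?thesis unfolding sq using g2 integrable_Re[OF ii] parseval_synth(1)[OF b] .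
    qed
    also have "(LINT x|circle_measure. Re (g x * cnj (synth ?b x))) = 1 / (2 * pi) * ?s"
      using integral_Re[OF ii] unfolding ip by (simp only: Re_complex_of_real)
    finally have "1 / (2 * pi) * ?s \<le> (LINT x|circle_measure. (cmod (g x))\<^sup>2)" unfolding ps by simp
    then show ?thesis by (simp add: field_simps)
  qed
  have "(\<Sum>\<^sub>\<infinity>n. (cmod (?c n))\<^sup>2) \<le> 2 * pi * (LINT x|circle_measure. (cmod (g x))\<^sup>2)"
    by (rule infsum_le_finite_sums[OF s]) (rule fin)
  then show ?thesis by (simp add: field_simps)
qed

text \<open>A scaled form of 2xy \<le> x^2 + y^2 in place of Cauchy-Schwarz; \<open>l\<close> will
  be matched to the size of the L^2 norm.\<close>

lemma integral_cmod_le: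
  assumes "integrable circle_measure f" "integrable circle_measure (\<lambda>x. (cmod (f x))\<^sup>2)" "0 < l"
  shows "(LINT x|circle_measure. cmod (f x)) \<le> pi * l + (LINT x|circle_measure. (cmod (f x))\<^sup>2) / (2 * l)"
proof -
  have c: "integrable circle_measure (\<lambda>x. l / 2)" by (rule integrable_circle) simp
  have "(LINT x|circle_measure. cmod (f x)) \<le> (LINT x|circle_measure. l / 2 + (cmod (f x))\<^sup>2 / (2 * l))"
  proof (rule integral_mono)
    fix x
    have "2 * (l * cmod (f x)) \<le> l\<^sup>2 + (cmod (f x))\<^sup>2"
      using sum_squares_bound[of l "cmod (f x)"] by simp
    then show "cmod (f x) \<le> l / 2 + (cmod (f x))\<^sup>2 / (2 * l)"
      using assms(3) by (simp add: field_simps power2_eq_square)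
  qed (use assms c in auto)
  also have "\<dots> = (LINT x|circle_measure. l / 2) + (LINT x|circle_measure. (cmod (f x))\<^sup>2) / (2 * l)"
    using assms c by simp
  also have "(LINT x|circle_measure. l / 2) = pi * l"
    using integral_circle[of "\<lambda>_. l / 2"] by simp
  finally show ?thesis .
qed

text \<open>The \<open>L\<^sup>2\<close> distance of consecutive partial sums along \<open>N k\<close> is at most \<open>2\<^sup>-\<^sup>k\<close>, so the telescoping series converges
  absolutely almost everywhere.\<close>

theorem riesz_fischer:
  fixes c :: "int \<Rightarrow> complex"
  assumes s: "(\<lambda>n. (cmod (c n))\<^sup>2) summable_on UNIV"
  obtains g where "on_circle g" "integrable circle_measure g" "integrable circle_measure (\<lambda>x. (cmod (g x))\<^sup>2)"
    "fourier_coeff g = c"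
proof -
  let ?T = "\<Sum>\<^sub>\<infinity>n. (cmod (c n))\<^sup>2"
  have lim: "(\<lambda>R. \<Sum>n\<in>box_int R. (cmod (c n))\<^sup>2) \<longlonglongrightarrow> ?T"
    by (rule has_sum_box_int[OF has_sum_infsum[OF s]])
  have box_mono: "box_int R \<subseteq> box_int R'" if "R \<le> R'" for R R'
    using that by (auto simp: box_int_def)
  have "\<exists>N. \<forall>R\<ge>N. ?T - (\<Sum>n\<in>box_int R. (cmod (c n))\<^sup>2) < (1 / 4) ^ k" for k
  proof -
    have "\<forall>\<^sub>F R in sequentially. ?T - (1 / 4) ^ k < (\<Sum>n\<in>box_int R. (cmod (c n))\<^sup>2)"
      by (rule order_tendstoD(1)[OF lim]) simp
    then show ?thesis unfolding eventually_sequentially by (auto simp: algebra_simps)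
  qed
  then obtain N0 where N0: "\<And>k R. R \<ge> N0 k \<Longrightarrow> ?T - (\<Sum>n\<in>box_int R. (cmod (c n))\<^sup>2) < (1 / 4) ^ k"
    by metis
  \<comment> \<open>Summing the \<open>N0 j\<close> makes the sequence increasing, and the summand
    \<open>k\<close> makes the boxes exhaust the integers.\<close>
  define N where "N k = k + (\<Sum>j\<le>k. N0 j)" for k
  have N_ge: "N0 k \<le> N k" "k \<le> N k" for k
    unfolding N_def using member_le_sum[of k "{..k}" N0] by (auto intro: trans_le_add2)
  have N_mono: "N k \<le> N (Suc k)" for k by (simp add: N_def)
  define d where "d k = trunc (box_int (N (Suc k)) - box_int (N k)) c" for k
  have d: "in_l1 (d k)" for k unfolding d_def by (rule trunc_l1) simp
  define D where "D k = synth (d k)" for k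
  have D_int: "integrable circle_measure (D k)" "integrable circle_measure (\<lambda>x. (cmod (D k x))\<^sup>2)" for k
    unfolding D_def by (intro integrable_synth parseval_synth d)+
  have D_L2: "(LINT x|circle_measure. (cmod (D k x))\<^sup>2) \<le> (1 / 4) ^ k" for k
  proof -
    let ?F = "box_int (N (Suc k)) - box_int (N k)"
    have "(\<Sum>\<^sub>\<infinity>n. (cmod (d k n))\<^sup>2) = (\<Sum>n\<in>?F. (cmod (c n))\<^sup>2)"
      unfolding d_def by (rule infsum_trunc(2)[of _ "\<lambda>n z. (cmod z)\<^sup>2"]) auto
    also have "\<dots> = (\<Sum>n\<in>box_int (N (Suc k)). (cmod (c n))\<^sup>2) - (\<Sum>n\<in>box_int (N k). (cmod (c n))\<^sup>2)"
      by (rule sum_diff) (auto intro: box_mono[OF N_mono, THEN subsetD])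
    also have "\<dots> \<le> ?T - (\<Sum>n\<in>box_int (N k). (cmod (c n))\<^sup>2)"
      by (intro diff_right_mono finite_sum_le_infsum[OF s]) auto
    also have "\<dots> \<le> (1 / 4) ^ k" using N0[OF N_ge(1)[of k]] by simp
    finally have le: "(\<Sum>\<^sub>\<infinity>n. (cmod (d k n))\<^sup>2) \<le> (1 / 4) ^ k" .
    have "1 / (2 * pi) * (\<Sum>\<^sub>\<infinity>n. (cmod (d k n))\<^sup>2) \<le> 1 * (1 / 4) ^ k"
      using pi_gt3 by (intro mult_mono le) (auto intro!: infsum_nonneg)
    then show ?thesis unfolding D_def parseval_synth(2)[OF d] by simp
  qed
  have D_L1: "(LINT x|circle_measure. cmod (D k x)) \<le> (pi + 1 / 2) * (1 / 2) ^ k" for k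
  proof -
    \<comment> \<open>The parameter is 2^-k, which balances the bound 4^-k on the squared L^2
      norm.\<close>
    have "(LINT x|circle_measure. cmod (D k x)) \<le> pi * (1 / 2) ^ k + (LINT x|circle_measure. (cmod (D k x))\<^sup>2) / (2 * (1 / 2) ^ k)"
      by (rule integral_cmod_le[OF D_int]) simp
    also have "\<dots> \<le> pi * (1 / 2) ^ k + (1 / 4) ^ k / (2 * (1 / 2) ^ k)"
      by (intro add_left_mono divide_right_mono D_L2) auto
    also have "(1 / 4 :: real) ^ k = (1 / 2) ^ k * (1 / 2) ^ k"
      by (simp flip: power_mult_distrib)
    finally show ?thesis by (simp add: algebra_simps)
  qed
  have sumD: "summable (\<lambda>k. LINT x|circle_measure. cmod (D k x))"
  proof (rule summable_comparison_test')
    show "summable (\<lambda>k. (pi + 1 / 2) * (1 / 2 :: real) ^ k)"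
      by (intro summable_mult summable_geometric) simp
    show "norm (LINT x|circle_measure. cmod (D k x)) \<le> (pi + 1 / 2) * (1 / 2) ^ k" for k
      using D_L1[of k] by simp
  qed
  have AEsum: "AE x in circle_measure. summable (\<lambda>k. cmod (D k x))"
  proof -
    have [measurable]: "D k \<in> borel_measurable circle_measure" for k using D_int(1)[of k] by simp
    have "(\<integral>\<^sup>+x. (\<Sum>k. ennreal (cmod (D k x))) \<partial>circle_measure) = (\<Sum>k. \<integral>\<^sup>+x. ennreal (cmod (D k x)) \<partial>circle_measure)"
      by (rule nn_integral_suminf) measurable
    also have "\<dots> = (\<Sum>k. ennreal (LINT x|circle_measure. cmod (D k x)))"
      by (intro suminf_cong nn_integral_eq_integral) (use D_int in auto)
    also have "\<dots> \<noteq> \<infinity>"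
      unfolding infinity_ennreal_def
      by (rule ennreal_suminf_neq_top[OF sumD]) (auto intro: integral_nonneg_AE)
    finally have "AE x in circle_measure. (\<Sum>k. ennreal (cmod (D k x))) \<noteq> \<infinity>"
      by (intro nn_integral_noteq_infinite) auto
    then show ?thesis by eventually_elim (auto intro: summable_suminf_not_top)
  qed
  define S0 where "S0 = synth (trunc (box_int (N 0)) c)"
  have S0: "integrable circle_measure S0" unfolding S0_def by (intro integrable_synth trunc_l1) simp
  define g where "g x = S0 x + (\<Sum>k. D k x)" for x
  have g_int: "integrable circle_measure g"
    unfolding g_def by (intro Bochner_Integration.integrable_add S0 integrable_suminf D_int AEsum sumD)
  have synth_per: "synth b (x + 2 * pi) = synth b x" for b x
    by (simp add: synth_def cexp_periodic)
  have per: "on_circle g"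
    by unfold_locales (simp add: g_def S0_def D_def synth_per)
  have "fourier_coeff g n = c n" for n
  proof -
    let ?h = "\<lambda>k. trunc (box_int (N k)) c n"
    have sn: "(\<lambda>k. LINT x|circle_measure. D k x * cexp (- n) x) sums (LINT x|circle_measure. (\<Sum>k. D k x * cexp (- n) x))"
      by (rule sums_integral) (use D_int sumD AEsum in \<open>auto simp: norm_mult intro: integrable_mult_cexp\<close>)
    have "(LINT x|circle_measure. (\<Sum>k. D k x * cexp (- n) x)) = fourier_coeff (\<lambda>x. \<Sum>k. D k x) n"
      unfolding fourier_coeff_cexp
    proof (rule integral_cong_AE)
      have [measurable]: "D k \<in> borel_measurable circle_measure" for k using D_int(1)[of k] by simp
      show "(\<lambda>x. \<Sum>k. D k x * cexp (- n) x) \<in> borel_measurable circle_measure"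
        "(\<lambda>x. (\<Sum>k. D k x) * cexp (- n) x) \<in> borel_measurable circle_measure" by measurable
      show "AE x in circle_measure. (\<Sum>k. D k x * cexp (- n) x) = (\<Sum>k. D k x) * cexp (- n) x"
        using AEsum by eventually_elim (auto intro: suminf_mult2[symmetric] summable_norm_cancel)
    qed
    moreover have "(LINT x|circle_measure. D k x * cexp (- n) x) = ?h (Suc k) - ?h k" for k
    proof -
      have "(LINT x|circle_measure. D k x * cexp (- n) x) = d k n"
        using fourier_coeff_synth[OF d, of k n] unfolding fourier_coeff_cexp D_def .
      also have "\<dots> = ?h (Suc k) - ?h k"
        using box_mono[OF N_mono[of k]] by (auto simp: d_def trunc_def)
      finally show ?thesis .
    qed
    ultimately have "(\<lambda>k. ?h (Suc k) - ?h k) sums fourier_coeff (\<lambda>x. \<Sum>k. D k x) n"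
      using sn by simp
    moreover have "(\<lambda>k. ?h (Suc k) - ?h k) sums (c n - ?h 0)"
    proof (rule telescope_sums)
      have "eventually (\<lambda>k. ?h k = c n) sequentially"
        using eventually_ge_at_top[of "nat \<bar>n\<bar>"]
      proof eventually_elim
        case (elim k)
        then have "n \<in> box_int (N k)" using N_ge(2)[of k] by (auto simp: box_int_def)
        then show ?case by (simp add: trunc_def)
      qed
      then show "?h \<longlonglongrightarrow> c n" by (rule tendsto_eventually)
    qed
    ultimately have "fourier_coeff (\<lambda>x. \<Sum>k. D k x) n = c n - ?h 0" by (rule sums_unique2)
    moreover have "fourier_coeff S0 n = ?h 0"
      unfolding S0_def by (rule fourier_coeff_synth[OF trunc_l1]) simp
    moreover have "fourier_coeff g n = fourier_coeff S0 n + fourier_coeff (\<lambda>x. \<Sum>k. D k x) n"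
      unfolding g_def by (intro fourier_coeff_linear(1) S0 integrable_suminf D_int AEsum sumD)
    ultimately show ?thesis by simp
  qed
  then have coeff: "fourier_coeff g = c" by auto
  define P where "P k = synth (trunc (box_int (N k)) c)" for k
  have P_eq: "P k x = S0 x + (\<Sum>j<k. D j x)" for k x
  proof (induction k)
    case (Suc k)
    have "synth (trunc (box_int (N (Suc k))) c) x = synth (trunc (box_int (N k)) c) x + synth (d k) x"
    proof -
      have eq: "trunc (box_int (N (Suc k))) c n * cexp n x = trunc (box_int (N k)) c n * cexp n x + d k n * cexp n x" for n
        using box_mono[OF N_mono[of k]] by (auto simp: d_def trunc_def)
      have "(\<Sum>\<^sub>\<infinity>n. trunc (box_int (N (Suc k))) c n * cexp n x)
        = (\<Sum>\<^sub>\<infinity>n. trunc (box_int (N k)) c n * cexp n x) + (\<Sum>\<^sub>\<infinity>n. d k n * cexp n x)"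
        unfolding eq by (intro infsum_add synth_summable d trunc_l1) simp
      then show ?thesis by (simp add: synth_def distrib_left)
    qed
    then show ?case using Suc by (simp add: P_def D_def)
  qed (simp add: P_def S0_def)
  have P_lim: "AE x in circle_measure. (\<lambda>k. ennreal ((cmod (P k x))\<^sup>2)) \<longlonglongrightarrow> ennreal ((cmod (g x))\<^sup>2)"
    using AEsum
  proof eventually_elim
    case (elim x)
    have "(\<lambda>k. \<Sum>j<k. D j x) \<longlonglongrightarrow> (\<Sum>k. D k x)"
      using summable_LIMSEQ[OF summable_norm_cancel[OF elim]] .
    then show ?case
      unfolding P_eq g_def by (intro tendsto_ennrealI tendsto_intros)
  qed
  \<comment> \<open>Fatou's lemma along the partial sums \<open>P k\<close>, whose squared L^2 norms
    are bounded by \<open>?T\<close>.\<close>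
  have "integrable circle_measure (\<lambda>x. (cmod (g x))\<^sup>2)"
  proof (rule integrableI_bounded)
    have [measurable]: "g \<in> borel_measurable circle_measure" using g_int by simp
    have [measurable]: "P k \<in> borel_measurable circle_measure" for k
      unfolding P_def by (rule measurable_synth[OF trunc_l1]) simp
    show "(\<lambda>x. (cmod (g x))\<^sup>2) \<in> borel_measurable circle_measure" by measurable
    have "(\<integral>\<^sup>+x. ennreal (norm ((cmod (g x))\<^sup>2)) \<partial>circle_measure)
      = (\<integral>\<^sup>+x. liminf (\<lambda>k. ennreal ((cmod (P k x))\<^sup>2)) \<partial>circle_measure)"
      by (rule nn_integral_cong_AE) (use P_lim in \<open>eventually_elim, auto intro!: lim_imp_Liminf[symmetric]\<close>)
    also have "\<dots> \<le> liminf (\<lambda>k. \<integral>\<^sup>+x. ennreal ((cmod (P k x))\<^sup>2) \<partial>circle_measure)"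
      by (rule nn_integral_liminf) measurable
    also have "\<dots> \<le> liminf (\<lambda>k. ennreal ?T)"
    proof (rule Liminf_mono, rule always_eventually, rule allI)
      fix k
      have t: "in_l1 (trunc (box_int (N k)) c)" by (rule trunc_l1) simp
      have "(\<Sum>\<^sub>\<infinity>n. (cmod (trunc (box_int (N k)) c n))\<^sup>2) = (\<Sum>n\<in>box_int (N k). (cmod (c n))\<^sup>2)"
        by (rule infsum_trunc(2)[of _ "\<lambda>n z. (cmod z)\<^sup>2"]) auto
      also have "\<dots> \<le> ?T" by (rule finite_sum_le_infsum[OF s]) auto
      finally have "1 / (2 * pi) * (\<Sum>\<^sub>\<infinity>n. (cmod (trunc (box_int (N k)) c n))\<^sup>2) \<le> 1 * ?T"
        using pi_gt3 by (intro mult_mono) (auto intro!: infsum_nonneg)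
      then have "(LINT x|circle_measure. (cmod (P k x))\<^sup>2) \<le> ?T"
        unfolding P_def parseval_synth(2)[OF t] by simp
      then show "(\<integral>\<^sup>+x. ennreal ((cmod (P k x))\<^sup>2) \<partial>circle_measure) \<le> ennreal ?T"
        unfolding P_def by (subst nn_integral_eq_integral[OF parseval_synth(1)[OF t]]) (auto intro: ennreal_leI)
    qed
    also have "\<dots> < \<infinity>" by (simp add: Liminf_const)
    finally show "(\<integral>\<^sup>+x. ennreal (norm ((cmod (g x))\<^sup>2)) \<partial>circle_measure) < \<infinity>" .
  qed
  from that[OF per g_int this coeff] show thesis .
qed

section \<open>Test functions and Fourier coefficients of weak derivatives\<close>

lemma deriv_periodic:
  fixes f :: "real \<Rightarrow> real"
  assumes "\<And>x. f (x + p) = f x" "\<And>x. (f has_real_derivative f' x) (at x)"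
  shows "f' (x + p) = f' x"
proof -
  have "(f has_real_derivative f' (x + p)) (at (x + p))" by (rule assms(2))
  then have "((\<lambda>y. f (y + p)) has_real_derivative f' (x + p)) (at x)" by (simp add: DERIV_shift)
  then have "(f has_real_derivative f' (x + p)) (at x)" by (simp add: assms(1))
  from DERIV_unique[OF this assms(2)] show ?thesis .
qed

lemma fourier_coeff_deriv:
  fixes f :: "real \<Rightarrow> real"
  assumes per: "\<And>x. f (x + 2 * pi) = f x" and d: "\<And>x. (f has_real_derivative f' x) (at x)"
    and c: "continuous_on UNIV f'"
  shows "fourier_coeff (\<lambda>x. of_real (f' x)) n = \<i> * of_int n * fourier_coeff (\<lambda>x. of_real (f x)) n"
proof -
  have cf: "continuous_on UNIV f"
    using d by (intro continuous_at_imp_continuous_on ballI) (rule DERIV_isCont)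
  have d': "((\<lambda>x. complex_of_real (f x) * cexp (- n) x) has_vector_derivative
    of_real (f x) * (\<i> * of_int (- n) * cexp (- n) x) + of_real (f' x) * cexp (- n) x) (at x)" for x
    by (intro has_vector_derivative_mult has_vector_derivative_cexp has_vector_derivative_of_real)
       (use d in \<open>simp add: has_real_derivative_iff_has_vector_derivative\<close>)
  have i1: "integrable circle_measure (\<lambda>x. complex_of_real (f x) * cexp (- n) x)"
    and i2: "integrable circle_measure (\<lambda>x. complex_of_real (f' x) * cexp (- n) x)"
    by (intro integrable_circle continuous_intros cf c)+
  have "(LINT x|circle_measure. of_real (f x) * (\<i> * of_int (- n) * cexp (- n) x) + of_real (f' x) * cexp (- n) x) = 0"
    by (rule integral_circle_deriv[OF d'])
       (use cf c per[of 0] cexp_periodic[of "- n" 0] in \<open>auto intro!: continuous_intros\<close>)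
  also have "(\<lambda>x. of_real (f x) * (\<i> * of_int (- n) * cexp (- n) x) + of_real (f' x) * cexp (- n) x)
    = (\<lambda>x. - (\<i> * of_int n) * (of_real (f x) * cexp (- n) x) + of_real (f' x) * cexp (- n) x)"
    by (simp add: fun_eq_iff algebra_simps)
  also have "(LINT x|circle_measure. - (\<i> * of_int n) * (of_real (f x) * cexp (- n) x) + of_real (f' x) * cexp (- n) x)
    = - (\<i> * of_int n) * (LINT x|circle_measure. of_real (f x) * cexp (- n) x) + (LINT x|circle_measure. of_real (f' x) * cexp (- n) x)"
    using i1 i2 by simp
  finally show ?thesis unfolding fourier_coeff_cexp by (simp add: algebra_simps)
qed

lemma test_function_deriv:
  assumes "\<phi> \<in> circle_test_functions"
  shows "((deriv ^^ k) \<phi> has_real_derivative (deriv ^^ Suc k) \<phi> x) (at x)"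
    "continuous_on UNIV ((deriv ^^ k) \<phi>)" "(deriv ^^ k) \<phi> (x + 2 * pi) = (deriv ^^ k) \<phi> x"
proof -
  have diff: "(deriv ^^ j) \<phi> differentiable_on UNIV" and per: "on_circle \<phi>" for j
    using assms by (auto simp: circle_test_functions_def)
  have D: "((deriv ^^ j) \<phi> has_real_derivative (deriv ^^ Suc j) \<phi> y) (at y)" for j y
    using diff[of j] by (simp add: differentiable_on_def DERIV_deriv_iff_real_differentiable)
  then show "((deriv ^^ k) \<phi> has_real_derivative (deriv ^^ Suc k) \<phi> x) (at x)" .
  show "continuous_on UNIV ((deriv ^^ k) \<phi>)"
    by (rule differentiable_imp_continuous_on[OF diff])
  show "(deriv ^^ k) \<phi> (x + 2 * pi) = (deriv ^^ k) \<phi> x" for x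
  proof (induction k arbitrary: x)
    case 0
    interpret periodic_fun_simple \<phi> "2 * pi" by (rule per)
    show ?case by (simp add: plus_period)
  next
    case (Suc k)
    show ?case by (rule deriv_periodic[OF Suc D])
  qed
qed

text \<open>Two integrations by parts give decay like 1/(1 + n^2), hence absolute
  summability.\<close>

lemma fourier_coeff_test_function:
  assumes "\<phi> \<in> circle_test_functions"
  shows "fourier_coeff (\<lambda>x. of_real (deriv \<phi> x)) n = \<i> * of_int n * fourier_coeff (\<lambda>x. of_real (\<phi> x)) n"
    "in_l1 (fourier_coeff (\<lambda>x. of_real (\<phi> x)))"
proof -
  note t = test_function_deriv[OF assms]
  show 1: "fourier_coeff (\<lambda>x. of_real (deriv \<phi> x)) n = \<i> * of_int n * fourier_coeff (\<lambda>x. of_real (\<phi> x)) n" for n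
    by (rule fourier_coeff_deriv) (use t(1)[of 0] t(2)[of 1] t(3)[of 0] in auto)
  have 2: "fourier_coeff (\<lambda>x. of_real (deriv (deriv \<phi>) x)) n = \<i> * of_int n * fourier_coeff (\<lambda>x. of_real (deriv \<phi> x)) n" for n
    by (rule fourier_coeff_deriv) (use t(1)[of 1] t(2)[of 2] t(3)[of 1] in \<open>auto simp: numeral_2_eq_2\<close>)
  let ?f = "fourier_coeff (\<lambda>x. of_real (\<phi> x))"
  have i: "integrable circle_measure (\<lambda>x. complex_of_real (\<phi> x))"
    "integrable circle_measure (\<lambda>x. complex_of_real (deriv (deriv \<phi>) x))"
    by (intro integrable_circle continuous_intros, use t(2)[of 0] t(2)[of 2] in \<open>simp add: numeral_2_eq_2\<close>)+
  define C where "C = (LINT x|circle_measure. cmod (of_real (\<phi> x))) + (LINT x|circle_measure. cmod (of_real (deriv (deriv \<phi>) x)))"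
  have le: "cmod (?f n) \<le> C * (1 / (1 + (real_of_int n)\<^sup>2))" for n
  proof -
    have "cmod (fourier_coeff (\<lambda>x. of_real (deriv (deriv \<phi>) x)) n) = (real_of_int n)\<^sup>2 * cmod (?f n)"
      unfolding 2 1 by (simp add: norm_mult power2_eq_square)
    then have "cmod (?f n) + (real_of_int n)\<^sup>2 * cmod (?f n) \<le> C"
      using norm_fourier_coeff_le[OF i(1), of n] norm_fourier_coeff_le[OF i(2), of n] unfolding C_def by linarith
    then have "cmod (?f n) * (1 + (real_of_int n)\<^sup>2) \<le> C" by (simp add: algebra_simps)
    then show ?thesis by (simp add: field_simps add_pos_nonneg)
  qed
  show "in_l1 ?f"
    by (rule summable_on_comparison_test[OF summable_on_cmult_right[OF summable_int_inverse_square] le]) auto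
qed

text \<open>Both pairings are evaluated by Parseval; the factor i n passes from the test function to
  \<open>f\<close>, and n -> -n produces the minus sign.\<close>

lemma weak_deriv_exists:
  assumes f: "integrable circle_measure f" and a: "in_l1 (fourier_coeff f)"
    and g: "on_circle g" "integrable circle_measure g" "fourier_coeff g = (\<lambda>n. \<i> * of_int n * fourier_coeff f n)"
  shows "has_weak_deriv f g"
  unfolding has_weak_deriv_def
proof (intro conjI ballI)
  show "g \<in> L1_circle" using g by (simp add: L1_circle_def)
  fix \<phi> assume \<phi>: "\<phi> \<in> circle_test_functions"
  note t = test_function_deriv[OF \<phi>]
  note F = fourier_coeff_test_function[OF \<phi>]
  let ?a = "fourier_coeff f" and ?p = "fourier_coeff (\<lambda>x. of_real (\<phi> x))"
  have i: "integrable circle_measure (\<lambda>x. complex_of_real (\<phi> x))" "integrable circle_measure (\<lambda>x. complex_of_real (deriv \<phi> x))"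
    by (intro integrable_circle continuous_intros, use t(2)[of 0] t(2)[of 1] in simp)+
  have [measurable]: "f \<in> borel_measurable circle_measure" "g \<in> borel_measurable circle_measure"
    "(\<lambda>x. complex_of_real (\<phi> x)) \<in> borel_measurable circle_measure" "(\<lambda>x. complex_of_real (deriv \<phi> x)) \<in> borel_measurable circle_measure"
    "synth ?a \<in> borel_measurable circle_measure" "synth ?p \<in> borel_measurable circle_measure"
    using f g i measurable_synth[OF a] measurable_synth[OF F(2)] by auto
  have "(LINT x|circle_measure. f x * of_real (deriv \<phi> x)) = (LINT x|circle_measure. of_real (deriv \<phi> x) * synth ?a x)"
  proof (rule integral_cong_AE)
    show "AE x in circle_measure. f x * of_real (deriv \<phi> x) = of_real (deriv \<phi> x) * synth ?a x"
      using AE_eq_synth[OF f a] by eventually_elim simp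
  qed measurable
  also have "\<dots> = of_real (1 / (2 * pi)) * (\<Sum>\<^sub>\<infinity>n. ?a n * fourier_coeff (\<lambda>x. of_real (deriv \<phi> x)) (- n))"
    by (rule integral_mult_synth[OF a i(2)])
  also have "(\<Sum>\<^sub>\<infinity>n. ?a n * fourier_coeff (\<lambda>x. of_real (deriv \<phi> x)) (- n)) = (\<Sum>\<^sub>\<infinity>n. - (?p n * fourier_coeff g (- n)))"
    unfolding F(1) g(3) by (rule infsum_reindex_bij_witness[of UNIV uminus uminus]) auto
  also have "\<dots> = - (\<Sum>\<^sub>\<infinity>n. ?p n * fourier_coeff g (- n))" by (rule infsum_uminus)
  finally have 1: "(LINT x|circle_measure. f x * of_real (deriv \<phi> x))
    = - (of_real (1 / (2 * pi)) * (\<Sum>\<^sub>\<infinity>n. ?p n * fourier_coeff g (- n)))" by (simp only: mult_minus_right)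
  have "(LINT x|circle_measure. g x * of_real (\<phi> x)) = (LINT x|circle_measure. g x * synth ?p x)"
  proof (rule integral_cong_AE)
    show "AE x in circle_measure. g x * of_real (\<phi> x) = g x * synth ?p x"
      using AE_eq_synth[OF i(1) F(2)] by eventually_elim simp
  qed measurable
  also have "\<dots> = of_real (1 / (2 * pi)) * (\<Sum>\<^sub>\<infinity>n. ?p n * fourier_coeff g (- n))"
    by (rule integral_mult_synth[OF F(2) g(2)])
  finally show "(LINT x|circle_measure. f x * of_real (deriv \<phi> x)) = - (LINT x|circle_measure. g x * of_real (\<phi> x))"
    using 1 by simp
qed

text \<open>The family with arbitrary \<open>A\<close> and \<open>B\<close> is closed under
  differentiation, so the induction covers all derivatives at once.\<close>

lemma trig_test_functions: "(\<lambda>x. A * cos (m * x) + B * sin (m * x)) \<in> circle_test_functions" if "m = real_of_int n" for A B m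
proof -
  have D: "((\<lambda>x. A * cos (m * x) + B * sin (m * x)) has_real_derivative (B * m) * cos (m * x) + (- A * m) * sin (m * x)) (at x)" for A B x
    by (auto intro!: derivative_eq_intros)
  have it: "\<exists>A' B'. (deriv ^^ k) (\<lambda>x. A * cos (m * x) + B * sin (m * x)) = (\<lambda>x. A' * cos (m * x) + B' * sin (m * x))" for k
  proof (induction k)
    case (Suc k)
    then obtain A' B' where "(deriv ^^ k) (\<lambda>x. A * cos (m * x) + B * sin (m * x)) = (\<lambda>x. A' * cos (m * x) + B' * sin (m * x))"
      by blast
    moreover have "deriv (\<lambda>x. A' * cos (m * x) + B' * sin (m * x)) = (\<lambda>x. (B' * m) * cos (m * x) + (- A' * m) * sin (m * x))"
      by (rule ext) (rule DERIV_imp_deriv[OF D])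
    ultimately have "(deriv ^^ Suc k) (\<lambda>x. A * cos (m * x) + B * sin (m * x)) = (\<lambda>x. (B' * m) * cos (m * x) + (- A' * m) * sin (m * x))"
      by simp
    then show ?case by blast
  qed auto
  have per: "on_circle (\<lambda>x. A * cos (m * x) + B * sin (m * x))"
  proof unfold_locales
    fix x
    have "cos (m * (x + 2 * pi)) = cos (m * x)" "sin (m * (x + 2 * pi)) = sin (m * x)"
      using cexp_periodic[of n x] that by (simp_all add: cexp_def complex_eq_iff)
    then show "A * cos (m * (x + 2 * pi)) + B * sin (m * (x + 2 * pi)) = A * cos (m * x) + B * sin (m * x)"
      by simp
  qed
  have "(\<lambda>x. A' * cos (m * x) + B' * sin (m * x)) differentiable_on UNIV" for A' B'
    unfolding differentiable_on_def real_differentiable_def using D[of A' B'] by blast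
  then show ?thesis
    unfolding circle_test_functions_def mem_Collect_eq
  proof (intro conjI allI per)
    assume T: "(\<lambda>x. A' * cos (m * x) + B' * sin (m * x)) differentiable_on UNIV" for A' B'
    fix k
    obtain A' B' where "(deriv ^^ k) (\<lambda>x. A * cos (m * x) + B * sin (m * x)) = (\<lambda>x. A' * cos (m * x) + B' * sin (m * x))"
      using it by blast
    then show "(deriv ^^ k) (\<lambda>x. A * cos (m * x) + B * sin (m * x)) differentiable_on UNIV"
      using T by simp
  qed
qed

text \<open>Test functions are real, so the exponential is tested through its cosine and sine
  separately.\<close>

lemma fourier_coeff_weak_deriv:
  assumes f: "integrable circle_measure f" and g: "has_weak_deriv f g"
  shows "fourier_coeff g n = \<i> * of_int n * fourier_coeff f n"
proof -
  let ?m = "real_of_int n"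
  let ?c = "\<lambda>x. 1 * cos (?m * x) + 0 * sin (?m * x)" and ?s = "\<lambda>x. 0 * cos (?m * x) + 1 * sin (?m * x)"
  have gi: "integrable circle_measure g" using g by (simp add: has_weak_deriv_def L1_circle_def)
  have dc: "deriv ?c = (\<lambda>x. - ?m * sin (?m * x))" and ds: "deriv ?s = (\<lambda>x. ?m * cos (?m * x))"
    by (auto intro!: ext DERIV_imp_deriv derivative_eq_intros)
  have G: "(LINT x|circle_measure. f x * of_real (deriv \<phi> x)) = - (LINT x|circle_measure. g x * of_real (\<phi> x))"
    if "\<phi> \<in> circle_test_functions" for \<phi>
    using g that by (simp add: has_weak_deriv_def)
  have wc: "(LINT x|circle_measure. f x * of_real (- ?m * sin (?m * x))) = - (LINT x|circle_measure. g x * of_real (cos (?m * x)))"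
    using G[OF trig_test_functions[OF refl, of 1 n 0]] unfolding dc by simp
  have ws: "(LINT x|circle_measure. f x * of_real (?m * cos (?m * x))) = - (LINT x|circle_measure. g x * of_real (sin (?m * x)))"
    using G[OF trig_test_functions[OF refl, of 0 n 1]] unfolding ds by simp
  have b: "integrable circle_measure (\<lambda>x. h x * of_real (cos (?m * x)))" "integrable circle_measure (\<lambda>x. h x * of_real (sin (?m * x)))"
    if "integrable circle_measure h" for h :: "real \<Rightarrow> complex"
    by (rule integrable_mult_bounded[OF that, where B = 1];
        auto intro!: borel_measurable_circle continuous_intros)+
  have split: "fourier_coeff h n = (LINT x|circle_measure. h x * of_real (cos (?m * x))) - \<i> * (LINT x|circle_measure. h x * of_real (sin (?m * x)))"
    if h: "integrable circle_measure h" for h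
  proof -
    have "h x * cexp (- n) x = h x * of_real (cos (?m * x)) - \<i> * (h x * of_real (sin (?m * x)))" for x
      by (simp add: cexp_def complex_eq_iff algebra_simps)
    then show ?thesis unfolding fourier_coeff_cexp using b[OF h] by simp
  qed
  have "(LINT x|circle_measure. f x * of_real (- ?m * sin (?m * x))) = - of_int n * (LINT x|circle_measure. f x * of_real (sin (?m * x)))"
    "(LINT x|circle_measure. f x * of_real (?m * cos (?m * x))) = of_int n * (LINT x|circle_measure. f x * of_real (cos (?m * x)))"
    by (simp_all add: mult.left_commute)
  then show ?thesis
    unfolding split[OF gi] split[OF f] using wc ws by (simp add: algebra_simps)
qed

text \<open>\<open>weak_deriv\<close> is an arbitrary choice, and a square that failed to be
  integrable would have integral 0 by convention. Riesz-Fischer supplies a weak derivative in L^2,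
  and uniqueness shows that the chosen one agrees with it almost everywhere.\<close>

lemma kinetic_energy_bound:
  assumes f: "integrable circle_measure f" and a: "in_l1 (fourier_coeff f)"
    and s: "(\<lambda>n. (of_int n)\<^sup>2 * (cmod (fourier_coeff f n))\<^sup>2) summable_on UNIV"
  shows "1 / (2 * pi) * (\<Sum>\<^sub>\<infinity>n. (of_int n)\<^sup>2 * (cmod (fourier_coeff f n))\<^sup>2)
    \<le> (LINT x|circle_measure. (cmod (weak_deriv f x))\<^sup>2)"
proof -
  let ?c = "\<lambda>n. \<i> * of_int n * fourier_coeff f n"
  have sq: "(cmod (?c n))\<^sup>2 = (of_int n)\<^sup>2 * (cmod (fourier_coeff f n))\<^sup>2" for n
    by (simp add: norm_mult power_mult_distrib)
  have s': "(\<lambda>n. (cmod (?c n))\<^sup>2) summable_on UNIV" unfolding sq by (rule s)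
  obtain g where g: "on_circle g" "integrable circle_measure g" "integrable circle_measure (\<lambda>x. (cmod (g x))\<^sup>2)"
    "fourier_coeff g = ?c"
    using riesz_fischer[OF s'] by blast
  let ?d = "weak_deriv f"
  have "has_weak_deriv f g" by (rule weak_deriv_exists[OF f a g(1,2,4)])
  then have d: "has_weak_deriv f ?d" unfolding weak_deriv_def by (rule someI[of "has_weak_deriv f"])
  then have di: "integrable circle_measure ?d" by (simp add: has_weak_deriv_def L1_circle_def)
  have eq: "AE x in circle_measure. ?d x = g x"
    by (rule fourier_coeff_unique[OF di g(2)]) (simp add: fourier_coeff_weak_deriv[OF f d] g(4))
  have [measurable]: "?d \<in> borel_measurable circle_measure" "g \<in> borel_measurable circle_measure" using di g by auto
  have "1 / (2 * pi) * (\<Sum>\<^sub>\<infinity>n. (cmod (fourier_coeff g n))\<^sup>2) \<le> (LINT x|circle_measure. (cmod (g x))\<^sup>2)"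
    by (rule bessel_inequality[OF g(2,3)]) (use s' g(4) in simp)
  also have "\<dots> = (LINT x|circle_measure. (cmod (?d x))\<^sup>2)"
    by (rule integral_cong_AE) (use eq in \<open>auto elim: eventually_mono\<close>)
  finally show ?thesis unfolding g(4) sq .
qed

section \<open>Duhamel's formula in Fourier space\<close>

lemma conv_tendsto_l1:
  assumes "\<And>t. in_l1 (x t)" "\<And>t. in_l1 (y t)" "in_l1 x0" "in_l1 y0"
    and x: "((\<lambda>t. l1_norm (\<lambda>n. x t n - x0 n)) \<longlongrightarrow> 0) F" and y: "((\<lambda>t. l1_norm (\<lambda>n. y t n - y0 n)) \<longlongrightarrow> 0) F"
  shows "((\<lambda>t. l1_norm (\<lambda>n. conv (x t) (y t) n - conv x0 y0 n)) \<longlongrightarrow> 0) F"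
proof (rule tendsto_sandwich[OF _ _ tendsto_const])
  let ?dx = "\<lambda>t. l1_norm (\<lambda>n. x t n - x0 n)" and ?dy = "\<lambda>t. l1_norm (\<lambda>n. y t n - y0 n)"
  show "\<forall>\<^sub>F t in F. 0 \<le> l1_norm (\<lambda>n. conv (x t) (y t) n - conv x0 y0 n)"
    by (simp add: l1_norm_nonneg)
  show "\<forall>\<^sub>F t in F. l1_norm (\<lambda>n. conv (x t) (y t) n - conv x0 y0 n)
    \<le> ?dx t * (?dy t + l1_norm y0) + l1_norm x0 * ?dy t"
  proof (rule always_eventually, rule allI)
    fix t
    have "l1_norm (\<lambda>n. (y t n - y0 n) + y0 n) \<le> ?dy t + l1_norm y0"
      by (intro l1_diff assms)
    then have "l1_norm (y t) \<le> ?dy t + l1_norm y0" by simp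
    from mult_left_mono[OF this l1_norm_nonneg[of "\<lambda>n. x t n - x0 n"]]
    show "l1_norm (\<lambda>n. conv (x t) (y t) n - conv x0 y0 n) \<le> ?dx t * (?dy t + l1_norm y0) + l1_norm x0 * ?dy t"
      using conv_diff_l1[OF assms(1,2,3,4), of t t] by linarith
  qed
  have "((\<lambda>t. ?dx t * (?dy t + l1_norm y0) + l1_norm x0 * ?dy t) \<longlongrightarrow> 0 * (0 + l1_norm y0) + l1_norm x0 * 0) F"
    by (intro tendsto_intros x y)
  then show "((\<lambda>t. ?dx t * (?dy t + l1_norm y0) + l1_norm x0 * ?dy t) \<longlongrightarrow> 0) F" by simp
qed

lemma mult_tendsto_l1:
  assumes x: "\<And>t. in_l1 (\<lambda>n. x t n - x0 n)" and c: "\<And>n. cmod (c n) \<le> C"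
    and lim: "((\<lambda>t. l1_norm (\<lambda>n. x t n - x0 n)) \<longlongrightarrow> 0) F"
  shows "((\<lambda>t. l1_norm (\<lambda>n. c n * x t n - c n * x0 n)) \<longlongrightarrow> 0) F"
proof (rule tendsto_sandwich[OF _ _ tendsto_const])
  show "\<forall>\<^sub>F t in F. 0 \<le> l1_norm (\<lambda>n. c n * x t n - c n * x0 n)" by (simp add: l1_norm_nonneg)
  show "\<forall>\<^sub>F t in F. l1_norm (\<lambda>n. c n * x t n - c n * x0 n) \<le> C * l1_norm (\<lambda>n. x t n - x0 n)"
  proof (rule always_eventually, rule allI)
    fix t
    have le: "cmod (c n * x t n - c n * x0 n) \<le> C * cmod (x t n - x0 n)" for n
      unfolding right_diff_distrib[symmetric] norm_mult by (intro mult_right_mono c) auto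
    have s: "(\<lambda>n. C * cmod (x t n - x0 n)) summable_on UNIV" by (rule summable_on_cmult_right[OF x])
    show "l1_norm (\<lambda>n. c n * x t n - c n * x0 n) \<le> C * l1_norm (\<lambda>n. x t n - x0 n)"
      unfolding l1_norm_def infsum_cmult_right[OF x, symmetric]
      by (rule infsum_mono[OF summable_on_comparison_test[OF s le] s le]) auto
  qed
  show "((\<lambda>t. C * l1_norm (\<lambda>n. x t n - x0 n)) \<longlongrightarrow> 0) F"
    using tendsto_mult_left[OF lim, of C] by simp
qed

text \<open>Provides the continuity in time of the Duhamel integrand, frequency by
  frequency.\<close>

lemma (in hartree_coeffs) hartree_seq_tendsto:
  assumes x: "\<And>t. in_l1 (x t)" "in_l1 x0" and lim: "((\<lambda>t. l1_norm (\<lambda>n. x t n - x0 n)) \<longlongrightarrow> 0) F"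
  shows "((\<lambda>t. hartree_seq v (x t) n) \<longlongrightarrow> hartree_seq v x0 n) F"
proof -
  let ?c = "\<lambda>n::int. complex_of_real (1 / (2 * pi))"
  let ?p = "\<lambda>x. conv x (cnj_seq x)"
  let ?z = "\<lambda>x n. of_real (v n) * (?c n * ?p x n)"
  have cn: "in_l1 (cnj_seq y)" if "in_l1 y" for y using that by (simp add: cnj_seq_l1)
  have p: "in_l1 (?p y)" if "in_l1 y" for y using conv_l1(1)[OF that cn[OF that]] .
  have y: "in_l1 (\<lambda>n. ?c n * ?p y n)" if "in_l1 y" for y by (rule in_l1_cmult[OF p[OF that]])
  have z: "in_l1 (?z y)" if "in_l1 y" for y by (rule in_l1_bounded_mult(1)[where v = v, OF y[OF that] v_bound])
  have "(\<lambda>t. l1_norm (\<lambda>n. cnj_seq (x t) n - cnj_seq x0 n)) = (\<lambda>t. l1_norm (\<lambda>n. x t n - x0 n))"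
  proof
    fix t
    have "(\<lambda>n. cnj_seq (x t) n - cnj_seq x0 n) = cnj_seq (\<lambda>n. x t n - x0 n)"
      by (simp add: cnj_seq_def fun_eq_iff)
    then show "l1_norm (\<lambda>n. cnj_seq (x t) n - cnj_seq x0 n) = l1_norm (\<lambda>n. x t n - x0 n)"
      by (simp only: cnj_seq_l1)
  qed
  then have "((\<lambda>t. l1_norm (\<lambda>n. cnj_seq (x t) n - cnj_seq x0 n)) \<longlongrightarrow> 0) F" using lim by simp
  then have 1: "((\<lambda>t. l1_norm (\<lambda>n. ?p (x t) n - ?p x0 n)) \<longlongrightarrow> 0) F"
    by (intro conv_tendsto_l1 x cn lim)
  have 2: "((\<lambda>t. l1_norm (\<lambda>n. ?c n * ?p (x t) n - ?c n * ?p x0 n)) \<longlongrightarrow> 0) F"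
    by (rule mult_tendsto_l1[OF l1_diff(1)[OF p p] inv_2pi_le_1 1]) (rule x)+
  have 3: "((\<lambda>t. l1_norm (\<lambda>n. ?z (x t) n - ?z x0 n)) \<longlongrightarrow> 0) F"
    by (rule mult_tendsto_l1[where C = B, OF l1_diff(1)[OF y y] _ 2]) (use x v_bound in auto)
  have 4: "((\<lambda>t. l1_norm (\<lambda>n. conv (?z (x t)) (x t) n - conv (?z x0) x0 n)) \<longlongrightarrow> 0) F"
    by (intro conv_tendsto_l1 z x 3 lim)
  have "((\<lambda>t. conv (?z (x t)) (x t) n - conv (?z x0) x0 n) \<longlongrightarrow> 0) F"
  proof (rule Lim_null_comparison[OF _ 4], rule always_eventually, rule allI)
    fix t
    have "in_l1 (\<lambda>n. conv (?z (x t)) (x t) n - conv (?z x0) x0 n)"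
      by (intro l1_diff conv_l1 z x)
    from cmod_le_l1_norm[OF this, of n]
    show "norm (conv (?z (x t)) (x t) n - conv (?z x0) x0 n) \<le> l1_norm (\<lambda>n. conv (?z (x t)) (x t) n - conv (?z x0) x0 n)" .
  qed
  then have "((\<lambda>t. conv (?z (x t)) (x t) n) \<longlongrightarrow> conv (?z x0) x0 n) F" by (simp only: LIM_zero_iff)
  then show ?thesis unfolding hartree_seq_def by (intro tendsto_mult_left)
qed

text \<open>With l^1 norms bounded by \<open>K\<close> on a finite measure space, the constant
  \<open>K\<close> dominates all partial sums, and the integrated sequence is again in l^1.\<close>

lemma synth_integral_exchange:
  assumes fin: "finite_measure M" and meas: "\<And>n. (\<lambda>t. H t n) \<in> borel_measurable M"
    and H: "\<And>t. t \<in> space M \<Longrightarrow> in_l1 (H t) \<and> l1_norm (H t) \<le> K"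
  shows "in_l1 (\<lambda>n. LINT t|M. H t n)"
    "(LINT t|M. synth (H t) x) = synth (\<lambda>n. LINT t|M. H t n) x"
proof -
  interpret finite_measure M by (rule fin)
  have K: "integrable M (\<lambda>_. K)" by simp
  have Hn: "cmod (H t n) \<le> K" if "t \<in> space M" for t n
    using H[OF that] cmod_le_l1_norm[of "H t" n] by linarith
  have Hi: "integrable M (\<lambda>t. H t n)" for n
  proof (rule Bochner_Integration.integrable_bound[OF K meas], rule AE_I2)
    fix t assume "t \<in> space M"
    from Hn[OF this, of n] show "norm (H t n) \<le> norm K" by simp
  qed
  have fs: "(\<Sum>n\<in>F. cmod (H t n)) \<le> K" if "finite F" "t \<in> space M" for F t
    using finite_sum_le_infsum[of "\<lambda>n. cmod (H t n)" UNIV F] H[OF that(2)] that(1) unfolding l1_norm_def by auto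
  show l1: "in_l1 (\<lambda>n. LINT t|M. H t n)"
  proof (rule nonneg_bdd_above_summable_on)
    show "bdd_above (sum (\<lambda>n. cmod (LINT t|M. H t n)) ` {F. F \<subseteq> UNIV \<and> finite F})"
    proof (rule bdd_aboveI2)
      fix F :: "int set" assume F: "F \<in> {F. F \<subseteq> UNIV \<and> finite F}"
      have "(\<Sum>n\<in>F. cmod (LINT t|M. H t n)) \<le> (\<Sum>n\<in>F. (LINT t|M. cmod (H t n)))"
        by (intro sum_mono integral_norm_bound)
      also have "\<dots> = (LINT t|M. (\<Sum>n\<in>F. cmod (H t n)))"
        using Hi by (intro Bochner_Integration.integral_sum[symmetric]) auto
      also have "\<dots> \<le> (LINT t|M. K)"
        using F Hi by (intro integral_mono Bochner_Integration.integrable_sum integrable_norm K) (auto intro: fs)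
      finally show "(\<Sum>n\<in>F. cmod (LINT t|M. H t n)) \<le> (LINT t|M. K)" .
    qed
  qed auto
  let ?s = "\<lambda>R t. of_real (1 / (2 * pi)) * (\<Sum>n\<in>box_int R. H t n * cexp n x)"
  have lm: "(\<lambda>R. ?s R t) \<longlonglongrightarrow> synth (H t) x" if "t \<in> space M" for t
    by (rule synth_partial) (use H[OF that] in simp)
  have lim: "(\<lambda>R. LINT t|M. ?s R t) \<longlonglongrightarrow> (LINT t|M. synth (H t) x)"
  proof (rule integral_dominated_convergence[where w = "\<lambda>_. K"])
    show m: "(\<lambda>t. ?s R t) \<in> borel_measurable M" for R
      using meas by measurable
    show "(\<lambda>t. synth (H t) x) \<in> borel_measurable M"
      by (rule borel_measurable_LIMSEQ_metric[where f = ?s, OF m lm])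
    show "AE t in M. (\<lambda>R. ?s R t) \<longlonglongrightarrow> synth (H t) x"
      by (rule AE_I2) (rule lm)
    show "AE t in M. norm (?s R t) \<le> K" for R
    proof (rule AE_I2)
      fix t assume t: "t \<in> space M"
      have "cmod (\<Sum>n\<in>box_int R. H t n * cexp n x) \<le> (\<Sum>n\<in>box_int R. cmod (H t n))"
        by (intro sum_norm_le) (simp add: norm_mult)
      also have "\<dots> \<le> K" by (rule fs[OF _ t]) simp
      finally have "cmod (\<Sum>n\<in>box_int R. H t n * cexp n x) \<le> K" .
      from mult_mono[OF inv_2pi_le_1 this]
      show "norm (?s R t) \<le> K" by (simp only: norm_mult norm_ge_zero zero_le_one mult_1_left simp_thms)
    qed
  qed (rule K)
  have "(LINT t|M. ?s R t) = of_real (1 / (2 * pi)) * (\<Sum>n\<in>box_int R. (LINT t|M. H t n) * cexp n x)" for R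
    using Hi by simp
  then have "(\<lambda>R. LINT t|M. ?s R t) \<longlonglongrightarrow> synth (\<lambda>n. LINT t|M. H t n) x"
    using synth_partial[OF l1, of x] by (simp only:)
  from LIMSEQ_unique[OF lim this] show "(LINT t|M. synth (H t) x) = synth (\<lambda>n. LINT t|M. H t n) x" .
qed

section \<open>The free propagator and time integrals of Fourier series\<close>

definition phase :: "real \<Rightarrow> int \<Rightarrow> complex" where
  "phase t n = cis (- t * (of_int n)\<^sup>2)"

lemma norm_phase [simp]: "cmod (phase t n) = 1" by (simp add: phase_def)

lemma phase_diff: "phase (t - r) n = phase t n * phase (- r) n"
  by (simp add: phase_def cis_mult algebra_simps)

lemma phase_0 [simp]: "phase 0 n = 1" by (simp add: phase_def)

lemma continuous_on_phase: "continuous_on A (\<lambda>t. phase (c + d * t) n)"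
  unfolding phase_def by (intro continuous_intros)

lemma has_vector_derivative_phase:
  "((\<lambda>t. phase t n) has_vector_derivative (- \<i> * (of_int n)\<^sup>2 * phase t n)) (at t)"
  unfolding phase_def cis_conv_exp
  by (auto intro!: derivative_eq_intros has_vector_derivative_real_field simp: mult_ac)

lemma free_propagator_synth: "free_propagator t f x = synth (\<lambda>n. phase t n * fourier_coeff f n) x"
proof -
  have "exp (- \<i> * of_real t * (of_int n)\<^sup>2) = phase t n" for n
    by (simp add: phase_def cis_conv_exp mult.assoc)
  then show ?thesis
    unfolding free_propagator_def synth_def exp_eq_cexp by simp
qed

lemma phase_l1: "in_l1 c \<Longrightarrow> in_l1 (\<lambda>n. phase t n * c n)" "l1_norm (\<lambda>n. phase t n * c n) = l1_norm c"
  by (simp_all add: norm_mult l1_norm_def)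

lemma interval_integral_synth:
  fixes t :: real
  assumes meas: "\<And>n. (\<lambda>r. H r n) \<in> borel_measurable lborel"
    and H: "\<And>r. \<bar>r\<bar> \<le> \<bar>t\<bar> \<Longrightarrow> in_l1 (H r) \<and> l1_norm (H r) \<le> K"
  shows "in_l1 (\<lambda>n. LBINT r=0..t. H r n)"
    "(LBINT r=0..t. synth (H r) x) = synth (\<lambda>n. LBINT r=0..t. H r n) x"
proof -
  \<comment> \<open>The oriented integral is an integral over an open interval with a sign that
    depends on \<open>t\<close>; both cases are reduced to one finite measure.\<close>
  define I where "I = (if 0 \<le> t then {0<..<t} else {t<..<0})"
  define M where "M = restrict_space lborel I"
  have I: "I \<in> sets lborel" by (simp add: I_def)
  have sp: "space M = I" unfolding M_def by (simp add: space_restrict_space)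
  have eq: "(LBINT r=0..t. h r) = (if 0 \<le> t then LINT r|M. h r else - (LINT r|M. h r))" for h :: "real \<Rightarrow> complex"
  proof -
    have "einterval 0 (ereal t) = {0<..<t}" "einterval (ereal t) 0 = {t<..<0}"
      by (auto simp: einterval_def)
    moreover have "(LINT r|M. h r) = set_lebesgue_integral lborel I h"
      unfolding M_def set_lebesgue_integral_def using I by (subst integral_restrict_space) auto
    ultimately show ?thesis
      by (auto simp: interval_lebesgue_integral_def I_def)
  qed
  have fin: "finite_measure M"
  proof
    have "emeasure M (space M) = emeasure lborel I"
      unfolding sp unfolding M_def using I by (subst emeasure_restrict_space) auto
    also have "\<dots> \<noteq> \<infinity>" by (simp add: I_def emeasure_lborel_Ioo)
    finally show "emeasure M (space M) \<noteq> \<infinity>" .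
  qed
  have meas': "(\<lambda>r. H r n) \<in> borel_measurable M" for n
    unfolding M_def by (rule measurable_restrict_space1[OF meas])
  have H': "in_l1 (H r) \<and> l1_norm (H r) \<le> K" if "r \<in> space M" for r
    using that unfolding sp I_def by (intro H) (auto split: if_splits)
  note ex = synth_integral_exchange[OF fin meas' H']
  have l: "in_l1 (\<lambda>n. - (LINT r|M. H r n))" using ex(1) by simp
  have neg: "synth (\<lambda>n. - (LINT r|M. H r n)) x = - synth (\<lambda>n. LINT r|M. H r n) x"
    using synth_cmult[of "-1"] by simp
  show "in_l1 (\<lambda>n. LBINT r=0..t. H r n)" unfolding eq using ex(1) l by (cases "0 \<le> t") simp_all
  show "(LBINT r=0..t. synth (H r) x) = synth (\<lambda>n. LBINT r=0..t. H r n) x"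
    unfolding eq using ex(2)[of x] neg by (cases "0 \<le> t") simp_all
qed

lemma interval_integral_has_vector_derivative:
  fixes h :: "real \<Rightarrow> 'a::euclidean_space"
  assumes "continuous_on UNIV h"
  shows "((\<lambda>t. LBINT r=0..t. h r) has_vector_derivative h t) (at t)"
proof -
  \<comment> \<open>The interval contains 0 and has \<open>t\<close> in its interior, so the
    derivative within it is the full one.\<close>
  have "((\<lambda>u. LBINT y=ereal 0..ereal u. h y) has_vector_derivative h t) (at t within {- \<bar>t\<bar> - 1..\<bar>t\<bar> + 1})"
    by (rule interval_integral_FTC2) (auto intro: continuous_on_subset[OF assms])
  moreover have "at t within {- \<bar>t\<bar> - 1..\<bar>t\<bar> + 1} = at t"
    by (rule at_within_interior) (simp add: interior_atLeastAtMost_real, linarith)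
  ultimately show ?thesis by (simp add: zero_ereal_def)
qed

section \<open>Sobolev weights and the embedding of H^1\<close>

abbreviation sob_weight :: "real \<Rightarrow> int \<Rightarrow> real" where
  "sob_weight s n \<equiv> bracket_pow 1 s (of_int n)"

lemma japanese_bracket_powr: "japanese_bracket n powr (2 * s) = sob_weight s n"
proof -
  have p: "0 < 1 + (real_of_int n)\<^sup>2" by (simp add: add_pos_nonneg)
  have "japanese_bracket n powr (2 * s) = ((1 + (real_of_int n)\<^sup>2) powr (1 / 2)) powr (2 * s)"
    using p by (simp add: japanese_bracket_def powr_half_sqrt)
  also have "\<dots> = sob_weight s n" by (simp add: powr_powr bracket_pow_def)
  finally show ?thesis .
qed

lemma sob_weight_nonneg: "0 \<le> sob_weight s n" by (simp add: bracket_pow_def)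

lemma sob_weight_1: "sob_weight 1 n = 1 + (of_int n)\<^sup>2"
  by (simp add: bracket_pow_def add_nonneg_nonneg)

lemma sobolev_norm_eq: "sobolev_norm s f = sqrt (wt_sum (sob_weight s) (fourier_coeff f))"
  unfolding sobolev_norm_def wt_sum_def japanese_bracket_powr by (simp add: mult.commute)

lemma wt_mono:
  assumes y: "in_wt w' x" and le: "\<And>n. w n \<le> C * w' n" "\<And>n. 0 \<le> w n"
  shows "in_wt w x" "wt_sum w x \<le> C * wt_sum w' x"
proof -
  have l: "w n * (cmod (x n))\<^sup>2 \<le> C * (w' n * (cmod (x n))\<^sup>2)" for n
    using mult_right_mono[OF le(1)[of n], of "(cmod (x n))\<^sup>2"] by (simp add: mult.assoc)
  have s: "(\<lambda>n. C * (w' n * (cmod (x n))\<^sup>2)) summable_on UNIV" by (rule summable_on_cmult_right[OF y])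
  show 1: "in_wt w x" by (rule summable_on_comparison_test[OF s l]) (simp add: le(2))
  show "wt_sum w x \<le> C * wt_sum w' x"
    unfolding wt_sum_def infsum_cmult_right[OF y, symmetric] by (rule infsum_mono[OF 1 s l])
qed

lemma wt_add:
  assumes x: "in_wt w x" and y: "in_wt w y" and w: "\<And>n. 0 \<le> w n"
  shows "in_wt w (\<lambda>n. x n + y n)" "wt_sum w (\<lambda>n. x n + y n) \<le> 2 * wt_sum w x + 2 * wt_sum w y"
proof -
  have l: "w n * (cmod (x n + y n))\<^sup>2 \<le> 2 * (w n * (cmod (x n))\<^sup>2) + 2 * (w n * (cmod (y n))\<^sup>2)" for n
  proof -
    have "(cmod (x n + y n))\<^sup>2 \<le> (cmod (x n) + cmod (y n))\<^sup>2" by (intro power_mono norm_triangle_ineq) auto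
    also have "\<dots> \<le> 2 * (cmod (x n))\<^sup>2 + 2 * (cmod (y n))\<^sup>2"
      using sum_squares_bound[of "cmod (x n)" "cmod (y n)"] by (simp add: power2_sum)
    finally show ?thesis using mult_left_mono[OF _ w[of n]] by (fastforce simp: algebra_simps)
  qed
  have s: "(\<lambda>n. 2 * (w n * (cmod (x n))\<^sup>2)) summable_on UNIV" "(\<lambda>n. 2 * (w n * (cmod (y n))\<^sup>2)) summable_on UNIV"
    by (intro summable_on_cmult_right x y)+
  note s' = summable_on_add[OF s]
  show 1: "in_wt w (\<lambda>n. x n + y n)" by (rule summable_on_comparison_test[OF s' l]) (simp add: w)
  have "wt_sum w (\<lambda>n. x n + y n) \<le> (\<Sum>\<^sub>\<infinity>n. 2 * (w n * (cmod (x n))\<^sup>2) + 2 * (w n * (cmod (y n))\<^sup>2))"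
    unfolding wt_sum_def by (rule infsum_mono[OF 1 s' l])
  also have "\<dots> = 2 * wt_sum w x + 2 * wt_sum w y"
    unfolding wt_sum_def infsum_add[OF s] by (simp only: infsum_cmult_right')
  finally show "wt_sum w (\<lambda>n. x n + y n) \<le> 2 * wt_sum w x + 2 * wt_sum w y" .
qed

definition embed_const :: real where
  "embed_const = (\<Sum>\<^sub>\<infinity>n::int. 1 / (1 + (real_of_int n)\<^sup>2))"

lemma embed_const_nonneg: "0 \<le> embed_const"
  by (auto simp: embed_const_def intro!: infsum_nonneg add_nonneg_nonneg)

text \<open>Cauchy-Schwarz against 1/(1 + n^2), summable in one dimension. It converts the H^1 bound
  into the l^1 bound that the multilinear estimates use.\<close>

lemma l1_embedding:
  assumes "in_wt (sob_weight 1) x"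
  shows "in_l1 x" "(l1_norm x)\<^sup>2 \<le> embed_const * wt_sum (sob_weight 1) x"
proof -
  let ?p = "\<lambda>n::int. sqrt (1 / (1 + (real_of_int n)\<^sup>2))" and ?q = "\<lambda>n. sqrt (1 + (real_of_int n)\<^sup>2) * cmod (x n)"
  have pos: "0 < 1 + (real_of_int n)\<^sup>2" for n by (simp add: add_pos_nonneg)
  have p2: "(?p n)\<^sup>2 = 1 / (1 + (real_of_int n)\<^sup>2)" for n using pos[of n] by simp
  have q2: "(?q n)\<^sup>2 = sob_weight 1 n * (cmod (x n))\<^sup>2" for n
    using pos[of n] by (simp add: power_mult_distrib sob_weight_1)
  have pq: "?p n * ?q n = cmod (x n)" for n
    using pos[of n] by (simp add: real_sqrt_divide)
  have "(\<lambda>n. (?p n)\<^sup>2) summable_on UNIV" "(\<lambda>n. (?q n)\<^sup>2) summable_on UNIV"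
    unfolding p2 q2 by (rule summable_int_inverse_square, rule assms)
  note CS = Cauchy_Schwarz_infsum[OF this]
  show "in_l1 x" using CS(1) unfolding pq .
  show "(l1_norm x)\<^sup>2 \<le> embed_const * wt_sum (sob_weight 1) x"
    using CS(2) unfolding pq p2 q2 l1_norm_def embed_const_def wt_sum_def .
qed

lemma sobolev_space_facts:
  assumes "f \<in> sobolev_space s" "1 \<le> s"
  shows "integrable circle_measure f" "in_wt (sob_weight s) (fourier_coeff f)" "in_wt (sob_weight 1) (fourier_coeff f)"
    "in_l1 (fourier_coeff f)"
proof -
  have m: "f \<in> borel_measurable circle_measure" and i: "integrable circle_measure (\<lambda>x. (cmod (f x))\<^sup>2)"
    using assms(1) by (auto simp: sobolev_space_def)
  have c: "integrable circle_measure (\<lambda>x. 1 :: real)" by (rule integrable_circle) simp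
  show "integrable circle_measure f"
  proof (rule Bochner_Integration.integrable_bound[OF Bochner_Integration.integrable_add[OF c i] m], rule AE_I2)
    fix x
    have "2 * (1 * cmod (f x)) \<le> 1 + (cmod (f x))\<^sup>2" using sum_squares_bound[of 1 "cmod (f x)"] by simp
    then have "cmod (f x) \<le> 1 + (cmod (f x))\<^sup>2" using norm_ge_zero[of "f x"] by linarith
    then show "norm (f x) \<le> norm (1 + (cmod (f x))\<^sup>2)" by simp
  qed
  show w: "in_wt (sob_weight s) (fourier_coeff f)"
    using assms(1) unfolding sobolev_space_def japanese_bracket_powr by (simp add: mult.commute)
  show w1: "in_wt (sob_weight 1) (fourier_coeff f)"
  proof (rule wt_mono(1)[OF w])
    show "sob_weight 1 n \<le> 1 * sob_weight s n" for n
      unfolding bracket_pow_def mult_1_left by (rule powr_mono) (use assms(2) in auto)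
  qed (rule sob_weight_nonneg)
  show "in_l1 (fourier_coeff f)" by (rule l1_embedding(1)[OF w1])
qed

section \<open>Fourier coefficients of a solution\<close>

locale hartree_sol = hartree_potential V for V +
  fixes s :: real and \<Phi> :: "real \<Rightarrow> complex" and u :: "real \<Rightarrow> real \<Rightarrow> complex"
  assumes s: "1 \<le> s" and \<Phi>: "\<Phi> \<in> sobolev_space s" and sol: "hartree_solution V s \<Phi> u"
begin

definition "a t = fourier_coeff (u t)"

definition "B = (LINT x|circle_measure. \<bar>V x\<bar>)"

lemma u_sob: "u t \<in> sobolev_space s"
  using sol by (simp add: hartree_solution_def)

lemma a_facts: "integrable circle_measure (u t)" "in_wt (sob_weight s) (a t)" "in_wt (sob_weight 1) (a t)" "in_l1 (a t)"
  unfolding a_def by (rule sobolev_space_facts[OF u_sob s])+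

lemma a_diff: "fourier_coeff (\<lambda>x. u t x - u r x) = (\<lambda>n. a t n - a r n)"
  unfolding a_def using a_facts(1) by (auto simp: fourier_coeff_linear)

lemma diff_wt: "in_wt (sob_weight s) (\<lambda>n. a t n - a r n)"
  using wt_add(1)[OF a_facts(2)[of t], of "\<lambda>n. - a r n"] a_facts(2)[of r] sob_weight_nonneg by simp

lemma a_cont_wt: "((\<lambda>t. wt_sum (sob_weight s) (\<lambda>n. a t n - a r n)) \<longlongrightarrow> 0) (at r)"
proof -
  have "((\<lambda>t. (sobolev_norm s (\<lambda>x. u t x - u r x))\<^sup>2) \<longlongrightarrow> 0\<^sup>2) (at r)"
    using sol by (intro tendsto_power) (simp add: hartree_solution_def)
  moreover have "(sobolev_norm s (\<lambda>x. u t x - u r x))\<^sup>2 = wt_sum (sob_weight s) (\<lambda>n. a t n - a r n)" for t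
    unfolding sobolev_norm_eq a_diff by (rule real_sqrt_pow2) (rule wt_sum_nonneg[OF sob_weight_nonneg])
  ultimately show ?thesis by simp
qed

lemma a_cont_l1: "((\<lambda>t. l1_norm (\<lambda>n. a t n - a r n)) \<longlongrightarrow> 0) (at r)"
proof (rule tendsto_sandwich[OF _ _ tendsto_const])
  show "\<forall>\<^sub>F t in at r. 0 \<le> l1_norm (\<lambda>n. a t n - a r n)" by (simp add: l1_norm_nonneg)
  show "\<forall>\<^sub>F t in at r. l1_norm (\<lambda>n. a t n - a r n) \<le> sqrt (embed_const * wt_sum (sob_weight s) (\<lambda>n. a t n - a r n))"
  proof (rule always_eventually, rule allI, rule real_le_rsqrt)
    fix t
    have le: "sob_weight 1 n \<le> 1 * sob_weight s n" for n
      unfolding bracket_pow_def mult_1_left by (rule powr_mono) (use s in auto)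
    note m = wt_mono[OF diff_wt le sob_weight_nonneg, of t r]
    show "(l1_norm (\<lambda>n. a t n - a r n))\<^sup>2 \<le> embed_const * wt_sum (sob_weight s) (\<lambda>n. a t n - a r n)"
      using l1_embedding(2)[OF m(1)] mult_left_mono[OF m(2) embed_const_nonneg] by simp
  qed
  have "((\<lambda>t. sqrt (embed_const * wt_sum (sob_weight s) (\<lambda>n. a t n - a r n))) \<longlongrightarrow> sqrt (embed_const * 0)) (at r)"
    by (intro tendsto_intros a_cont_wt)
  then show "((\<lambda>t. sqrt (embed_const * wt_sum (sob_weight s) (\<lambda>n. a t n - a r n))) \<longlongrightarrow> 0) (at r)" by simp
qed

text \<open>Continuity bounds the norm near each time, and bisection makes the bound uniform on an
  interval. This will keep the supremum in \<open>weighted_bound\<close> finite.\<close>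

lemma wt_locally_bounded: "\<exists>C. \<forall>t. \<bar>t\<bar> \<le> T \<longrightarrow> wt_sum (sob_weight s) (a t) \<le> C"
proof (cases "0 \<le> T")
  case True
  then have "- T \<le> T" by simp
  then have "\<exists>C. \<forall>t\<in>{- T..T}. wt_sum (sob_weight s) (a t) \<le> C"
  proof (rule Bolzano[where P = "\<lambda>x y. \<exists>C. \<forall>t\<in>{x..y}. wt_sum (sob_weight s) (a t) \<le> C"])
    fix x y z :: real
    assume "\<exists>C. \<forall>t\<in>{x..y}. wt_sum (sob_weight s) (a t) \<le> C" "\<exists>C. \<forall>t\<in>{y..z}. wt_sum (sob_weight s) (a t) \<le> C"
    then obtain C1 C2 where "\<forall>t\<in>{x..y}. wt_sum (sob_weight s) (a t) \<le> C1" "\<forall>t\<in>{y..z}. wt_sum (sob_weight s) (a t) \<le> C2"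
      by blast
    then show "\<exists>C. \<forall>t\<in>{x..z}. wt_sum (sob_weight s) (a t) \<le> C"
      by (intro exI[of _ "max C1 C2"]) (force simp: le_max_iff_disj)
  next
    fix r :: real
    have "\<forall>\<^sub>F t in at r. wt_sum (sob_weight s) (\<lambda>n. a t n - a r n) < 1"
      by (rule order_tendstoD(2)[OF a_cont_wt]) simp
    then obtain d where d: "d > 0" "\<And>t. t \<noteq> r \<Longrightarrow> dist t r < d \<Longrightarrow> wt_sum (sob_weight s) (\<lambda>n. a t n - a r n) < 1"
      unfolding eventually_at by blast
    have bd: "wt_sum (sob_weight s) (a t) \<le> 2 + 2 * wt_sum (sob_weight s) (a r)" if "dist t r < d" for t
    proof -
      have "wt_sum (sob_weight s) (\<lambda>n. a t n - a r n) \<le> 1"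
        using d(2)[OF _ that] by (cases "t = r") (auto simp: wt_sum_def)
      then show ?thesis
        using wt_add(2)[OF diff_wt[of t r] a_facts(2)[of r] sob_weight_nonneg] by simp
    qed
    show "\<exists>d>0. \<forall>x y. x \<le> r \<and> r \<le> y \<and> y - x < d \<longrightarrow> (\<exists>C. \<forall>t\<in>{x..y}. wt_sum (sob_weight s) (a t) \<le> C)"
    proof (rule exI[of _ d], intro conjI d(1) allI impI)
      fix x y assume xy: "x \<le> r \<and> r \<le> y \<and> y - x < d"
      then have "dist t r < d" if "t \<in> {x..y}" for t using that by (auto simp: dist_real_def abs_if)
      then show "\<exists>C. \<forall>t\<in>{x..y}. wt_sum (sob_weight s) (a t) \<le> C" using bd by blast
    qed
  qed
  then obtain C where C: "\<forall>t\<in>{- T..T}. wt_sum (sob_weight s) (a t) \<le> C" by blast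
  have "wt_sum (sob_weight s) (a t) \<le> C" if "\<bar>t\<bar> \<le> T" for t
    by (rule bspec[OF C]) (use that in \<open>simp add: abs_le_iff\<close>)
  then show ?thesis by blast
next
  case False
  have "\<not> \<bar>t\<bar> \<le> T" for t using False by linarith
  then show ?thesis by blast
qed

lemma le_sob_weight: "sob_weight 1 n \<le> 1 * sob_weight s n"
  unfolding bracket_pow_def mult_1_left by (rule powr_mono) (use s in auto)

lemma l1_locally_bounded: "\<exists>K. \<forall>t. \<bar>t\<bar> \<le> T \<longrightarrow> l1_norm (a t) \<le> K"
proof -
  obtain C where C: "\<And>t. \<bar>t\<bar> \<le> T \<Longrightarrow> wt_sum (sob_weight s) (a t) \<le> C" using wt_locally_bounded by blast
  have "l1_norm (a t) \<le> sqrt (embed_const * C)" if "\<bar>t\<bar> \<le> T" for t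
  proof (rule real_le_rsqrt)
    have "embed_const * wt_sum (sob_weight 1) (a t) \<le> embed_const * C"
      using wt_mono(2)[OF a_facts(2) le_sob_weight sob_weight_nonneg, of t] C[OF that]
      by (intro mult_left_mono embed_const_nonneg) auto
    then show "(l1_norm (a t))\<^sup>2 \<le> embed_const * C" using l1_embedding(2)[OF a_facts(3)[of t]] by linarith
  qed
  then show ?thesis by blast
qed

sublocale hartree_coeffs v B
  by unfold_locales (use v_even v_bound in \<open>auto simp: B_def\<close>)

text \<open>For each \<open>t\<close> both sides of Duhamel's formula are represented by absolutely
  convergent Fourier series; comparing coefficients removes the exceptional null set in
  \<open>x\<close>.\<close>

lemma duhamel_coeff:
  "a t n = phase t n * (fourier_coeff \<Phi> n - \<i> * (LBINT r=0..t. phase (- r) n * hartree_seq v (a r) n))"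
proof -
  let ?F = "\<lambda>r. hartree_seq v (a r)"
  let ?H = "\<lambda>r n. phase (t - r) n * ?F r n"
  have Fl1: "in_l1 (?F r)" for r by (rule hartree_seq_bound(1)[OF a_facts(4)])
  have Fc: "continuous_on UNIV (\<lambda>r. ?F r n)" for n
    unfolding continuous_on_def by (auto intro!: hartree_seq_tendsto a_facts(4) a_cont_l1)
  have Hm: "(\<lambda>r. ?H r n) \<in> borel_measurable lborel" for n
    using continuous_on_mult[OF continuous_on_phase[of _ t "-1" n] Fc[of n]]
    by (auto intro: borel_measurable_continuous_onI)
  obtain K where K: "\<And>r. \<bar>r\<bar> \<le> \<bar>t\<bar> \<Longrightarrow> l1_norm (a r) \<le> K" using l1_locally_bounded by blast
  have Hb: "in_l1 (?H r) \<and> l1_norm (?H r) \<le> B * K ^ 3" if "\<bar>r\<bar> \<le> \<bar>t\<bar>" for r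
  proof -
    have "B * (l1_norm (a r)) ^ 3 \<le> B * K ^ 3"
      by (intro mult_left_mono power_mono K that l1_norm_nonneg B_nonneg)
    then show ?thesis
      using hartree_seq_bound[OF a_facts(4)[of r]] phase_l1(1)[OF Fl1] phase_l1(2) by simp
  qed
  have ex: "in_l1 (\<lambda>n. LBINT r=0..t. ?H r n)"
    "(LBINT r=0..t. synth (?H r) x) = synth (\<lambda>n. LBINT r=0..t. ?H r n) x" for x
    by (rule interval_integral_synth[where H = ?H, OF Hm Hb], assumption)+
  let ?c1 = "\<lambda>n. phase t n * fourier_coeff \<Phi> n" and ?c2 = "\<lambda>n. LBINT r=0..t. ?H r n"
  let ?c = "\<lambda>n. ?c1 n - \<i> * ?c2 n"
  have c1: "in_l1 ?c1" by (rule phase_l1(1)[OF sobolev_space_facts(4)[OF \<Phi> s]])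
  have c2: "in_l1 (\<lambda>n. \<i> * ?c2 n)" by (rule in_l1_cmult[OF ex(1)])
  have c: "in_l1 ?c" by (rule l1_diff(1)[OF c1 c2])
  have fp: "free_propagator (t - r) (hartree_nonlinearity V (u r)) x = synth (?H r) x" for r x
    unfolding free_propagator_synth fourier_coeff_nonlinearity[OF a_facts(1) a_def a_facts(4)] ..
  have syn: "synth ?c x = synth ?c1 x - \<i> * synth ?c2 x" for x
  proof -
    have "(\<Sum>\<^sub>\<infinity>n. ?c1 n * cexp n x - \<i> * ?c2 n * cexp n x)
      = (\<Sum>\<^sub>\<infinity>n. ?c1 n * cexp n x) - (\<Sum>\<^sub>\<infinity>n. \<i> * ?c2 n * cexp n x)"
      by (rule infsum_minus(2)[OF synth_summable[OF c1] synth_summable[OF c2]])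
    then have "synth ?c x = synth ?c1 x - synth (\<lambda>n. \<i> * ?c2 n) x"
      unfolding synth_def by (simp only: left_diff_distrib right_diff_distrib)
    then show ?thesis by (simp only: synth_cmult)
  qed
  have eq: "AE x in circle_measure. u t x = synth ?c x"
  proof -
    have "AE x in circle_measure. u t x = free_propagator t \<Phi> x
      - \<i> * (LBINT r=0..t. free_propagator (t - r) (hartree_nonlinearity V (u r)) x)"
      using sol by (simp add: hartree_solution_def)
    then show ?thesis
      unfolding syn unfolding fp ex(2) unfolding free_propagator_synth .
  qed
  have "a t n = fourier_coeff (u t) n" by (simp only: a_def)
  also have "\<dots> = fourier_coeff (synth ?c) n"
    by (rule fourier_coeff_cong_AE[OF _ _ eq]) (use a_facts(1) measurable_synth[OF c] in auto)
  also have "\<dots> = ?c n" by (rule fourier_coeff_synth[OF c])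
  \<comment> \<open>The group law of the phase takes \<open>t\<close> out of the integrand, so that
    only the upper limit still depends on it.\<close>
  also have "?c2 n = phase t n * (LBINT r=0..t. phase (- r) n * ?F r n)"
    unfolding phase_diff mult.assoc by (rule interval_lebesgue_integral_mult_right)
  finally show ?thesis by (simp add: algebra_simps)
qed

lemma a_0: "a 0 = fourier_coeff \<Phi>"
proof
  fix n
  show "a 0 n = fourier_coeff \<Phi> n"
    using duhamel_coeff[of 0 n] by (simp add: zero_ereal_def[symmetric])
qed

text \<open>The integrand in \<open>duhamel_coeff\<close> is continuous, so each coefficient is
  differentiable although \<open>u\<close> is only continuous with values in H^s.\<close>

sublocale flow: hartree_flow v B a
proof unfold_locales
  fix n t
  let ?F = "\<lambda>r. hartree_seq v (a r) n"
  let ?J = "\<lambda>t. LBINT r=0..t. phase (- r) n * ?F r"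
  have Fc: "continuous_on UNIV ?F"
    unfolding continuous_on_def by (auto intro!: hartree_seq_tendsto a_facts(4) a_cont_l1)
  have "continuous_on UNIV (\<lambda>r. phase (- r) n * ?F r)"
    using continuous_on_mult[OF continuous_on_phase[of _ 0 "-1" n] Fc] by simp
  then have J: "(?J has_vector_derivative phase (- t) n * ?F t) (at t)"
    by (rule interval_integral_has_vector_derivative)
  have pp: "phase t n * phase (- t) n = 1" using phase_diff[of t t n] by simp
  have "((\<lambda>t. phase t n * (fourier_coeff \<Phi> n - \<i> * ?J t)) has_vector_derivative
    (phase t n * (0 - \<i> * (phase (- t) n * ?F t)) + - \<i> * (of_int n)\<^sup>2 * phase t n * (fourier_coeff \<Phi> n - \<i> * ?J t))) (at t)"
    by (intro has_vector_derivative_mult has_vector_derivative_phase has_vector_derivative_diff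
        has_vector_derivative_const has_vector_derivative_mult_right J)
  moreover have "phase t n * (0 - \<i> * (phase (- t) n * ?F t)) + - \<i> * (of_int n)\<^sup>2 * phase t n * (fourier_coeff \<Phi> n - \<i> * ?J t)
    = - \<i> * (of_int n)\<^sup>2 * a t n - \<i> * ?F t"
  proof -
    have "p * (0 - \<i> * (q * w)) + - \<i> * m * p * z = - \<i> * m * (p * z) - \<i> * w"
      if "p * q = 1" for p q m z w :: complex
    proof -
      have "p * (0 - \<i> * (q * w)) = - \<i> * ((p * q) * w)" by (simp add: algebra_simps)
      then show ?thesis by (simp add: that algebra_simps)
    qed
    from this[OF pp] show ?thesis unfolding duhamel_coeff[of t n] .
  qed
  ultimately show "((\<lambda>t. a t n) has_vector_derivative - \<i> * (of_int n)\<^sup>2 * a t n - \<i> * ?F t) (at t)"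
    unfolding duhamel_coeff[of _ n, abs_def] by (simp only:)
  show "in_l1 (a t)" by (rule a_facts)
qed

end

section \<open>Conservation laws and growth of Sobolev norms\<close>

text \<open>Here \<open>h\<close> stands for the H^1 bound, and the common factor 2 s^2/N^2 is left
  out. The first summand pays for the correction at both ends of the time interval (12 = 2 * 6), the
  second for the change of the modified energy per unit of time (48 = 2 * 24).\<close>

definition growth_const :: "real \<Rightarrow> real \<Rightarrow> real \<Rightarrow> real" where
  "growth_const B s h = 12 * B * (2 powr s)\<^sup>2 * (embed_const * h)
    + 48 * B * (2 powr s)\<^sup>2 * (1 + 10 * (2 powr s) ^ 4 * B\<^sup>2 * (embed_const * h)\<^sup>2)
      * (embed_const * h * (1 + B * (embed_const * h))\<^sup>2)"

lemma growth_const_nonneg: "0 \<le> B \<Longrightarrow> 0 \<le> h \<Longrightarrow> 0 \<le> growth_const B s h"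
  unfolding growth_const_def using embed_const_nonneg
  by (intro add_nonneg_nonneg mult_nonneg_nonneg zero_le_power2 zero_le_power) auto

text \<open>Multiplication by 4 pi clears the normalisation: the kinetic part becomes the sum over
  \<open>n\<^sup>2\<close>, up to Bessel's inequality, and the potential part half the quartic form.
  The first claim is used at time 0, the second at later times.\<close>

lemma (in hartree_potential) energy_identity:
  assumes f: "f \<in> sobolev_space s" "1 \<le> s"
  shows "(\<Sum>\<^sub>\<infinity>n. (of_int n)\<^sup>2 * (cmod (fourier_coeff f n))\<^sup>2)
      + 1 / 2 * Re (\<Sum>\<^sub>\<infinity>n. hartree_seq v (fourier_coeff f) n * cnj (fourier_coeff f n)) \<le> 4 * pi * energy V f"
    "0 \<le> Re (\<Sum>\<^sub>\<infinity>n. hartree_seq v (fourier_coeff f) n * cnj (fourier_coeff f n))"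
proof -
  note F = sobolev_space_facts[OF f]
  let ?P = "LINT x|circle_measure. circle_conv V (\<lambda>y. (cmod (f y))\<^sup>2) x * (cmod (f x))\<^sup>2"
  let ?Q = "\<Sum>\<^sub>\<infinity>n. hartree_seq v (fourier_coeff f) n * cnj (fourier_coeff f n)"
  note pe = potential_energy_eq[OF F(1) refl F(4)]
  have "?P = 1 / (2 * pi) * Re ?Q"
  proof -
    have "Re (of_real c * z) = c * Re z" for c z by simp
    then show ?thesis using arg_cong[OF pe(1), of Re] by (simp only: Re_complex_of_real)
  qed
  then have P: "Re ?Q = 2 * pi * ?P" by (simp add: field_simps)
  show "0 \<le> Re ?Q" unfolding P using pe(2) by simp
  have s: "(\<lambda>n. (of_int n)\<^sup>2 * (cmod (fourier_coeff f n))\<^sup>2) summable_on UNIV"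
    by (rule wt_mono(1)[OF F(3), where C = 1]) (auto simp: sob_weight_1)
  have "(\<Sum>\<^sub>\<infinity>n. (of_int n)\<^sup>2 * (cmod (fourier_coeff f n))\<^sup>2) \<le> 2 * pi * (LINT x|circle_measure. (cmod (weak_deriv f x))\<^sup>2)"
    using kinetic_energy_bound[OF F(1,4) s] by (simp add: field_simps)
  then show "(\<Sum>\<^sub>\<infinity>n. (of_int n)\<^sup>2 * (cmod (fourier_coeff f n))\<^sup>2) + 1 / 2 * Re ?Q \<le> 4 * pi * energy V f"
    unfolding P energy_def by (simp add: algebra_simps)
qed

context hartree_sol
begin

lemma weight_1: "subadd_weight (\<lambda>n. bracket_pow 1 (1 / 2) (of_int n)) (2 powr 1)"
  by (rule sobolev_weight(1)) auto

lemma weight_1_square: "(bracket_pow 1 (1 / 2) x)\<^sup>2 = 1 + x\<^sup>2"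
  using sobolev_weight(2)[of 1 1 x] by (simp add: bracket_pow_def add_nonneg_nonneg)

lemma local_bounds:
  "\<exists>K S. \<forall>r. \<bar>r\<bar> \<le> T \<longrightarrow> in_wt (\<lambda>n. (bracket_pow 1 (1 / 2) (of_int n))\<^sup>2) (a r) \<and> l1_norm (a r) \<le> K
     \<and> wt_sum (\<lambda>n. (bracket_pow 1 (1 / 2) (of_int n))\<^sup>2) (a r) \<le> S"
proof -
  obtain K where K: "\<And>r. \<bar>r\<bar> \<le> T \<Longrightarrow> l1_norm (a r) \<le> K" using l1_locally_bounded by blast
  obtain S where S: "\<And>r. \<bar>r\<bar> \<le> T \<Longrightarrow> wt_sum (sob_weight s) (a r) \<le> S" using wt_locally_bounded by blast
  note m = wt_mono[OF a_facts(2) le_sob_weight sob_weight_nonneg]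
  have "wt_sum (sob_weight 1) (a r) \<le> S" if "\<bar>r\<bar> \<le> T" for r
    using m(2)[of r] S[OF that] by simp
  then show ?thesis
    unfolding weight_1_square sob_weight_1[symmetric] using K m(1) by blast
qed

lemma mass_conservation: "(\<Sum>\<^sub>\<infinity>n. (cmod (a t n))\<^sup>2) = (\<Sum>\<^sub>\<infinity>n. (cmod (a 0 n))\<^sup>2)"
proof -
  interpret subadd_weight "\<lambda>n. bracket_pow 1 (1 / 2) (of_int n)" "2 powr 1" by (rule weight_1)
  interpret E: weighted_flow v B a "\<lambda>n. bracket_pow 1 (1 / 2) (of_int n)" "2 powr 1" "\<lambda>_. 1" "\<lambda>_. 0" 0
    by unfold_locales (auto simp: weight_1_square)
  have me: "E.modified_energy (a t) = (\<Sum>\<^sub>\<infinity>n. (cmod (a t n))\<^sup>2)" for t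
    by (simp add: E.modified_energy_def E.quartic_def)
  obtain K S where KS: "\<And>r. \<bar>r\<bar> \<le> \<bar>t\<bar> \<Longrightarrow> in_wt w (a r) \<and> l1_norm (a r) \<le> K \<and> wt_sum w (a r) \<le> S"
    using local_bounds[of "\<bar>t\<bar>"] by blast
  \<comment> \<open>Taking \<open>max\<close> and \<open>min\<close> with 0 orders the two times, so
    negative \<open>t\<close> is covered as well.\<close>
  have "\<bar>E.modified_energy (a (max 0 t)) - E.modified_energy (a (min 0 t))\<bar> \<le> 2 * 0 * B * E.majorant_bound K S * (max 0 t - min 0 t)"
    by (rule E.modified_energy_change) (auto intro!: KS)
  then have "E.modified_energy (a (max 0 t)) = E.modified_energy (a (min 0 t))" by simp
  then show ?thesis unfolding me by (auto simp: max_def min_def split: if_splits)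
qed

text \<open>With constant multiplier there is no smallness in \<open>\<mu>\<close>; instead the real
  part of the remaining derivative vanishes by \<open>quartic_derivative_real_part\<close>.\<close>

lemma energy_conservation:
  "(\<Sum>\<^sub>\<infinity>n. (of_int n)\<^sup>2 * (cmod (a t n))\<^sup>2) + 1 / 2 * Re (\<Sum>\<^sub>\<infinity>n. hartree_seq v (a t) n * cnj (a t n))
    = (\<Sum>\<^sub>\<infinity>n. (of_int n)\<^sup>2 * (cmod (a 0 n))\<^sup>2) + 1 / 2 * Re (\<Sum>\<^sub>\<infinity>n. hartree_seq v (a 0) n * cnj (a 0 n))"
proof -
  interpret subadd_weight "\<lambda>n. bracket_pow 1 (1 / 2) (of_int n)" "2 powr 1" by (rule weight_1)
  have W: "4 \<le> w (i1 p) + w (i2 p) + w (i3 p) + w (i4 p)" for p :: "int \<times> int \<times> int"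
  proof -
    have "1 \<le> w n" for n by (simp add: weight_1_square)
    from add_mono[OF add_mono[OF add_mono[OF this[of "i1 p"] this[of "i2 p"]] this[of "i3 p"]] this[of "i4 p"]]
    show ?thesis by simp
  qed
  interpret E: weighted_flow v B a "\<lambda>n. bracket_pow 1 (1 / 2) (of_int n)" "2 powr 1" "\<lambda>n. (of_int n)\<^sup>2" "\<lambda>_. 1" 1
  proof unfold_locales
    show "\<bar>(real_of_int n)\<^sup>2\<bar> \<le> w n" for n by (simp add: weight_1_square)
    show "\<bar>1\<bar> \<le> 1 * (w (i1 p) + w (i2 p) + w (i3 p) + w (i4 p))" for p
      unfolding abs_one mult_1_left using W[of p] by (rule order.trans[rotated]) simp
    show "1 * resonance p = (of_int (i1 p))\<^sup>2 - (of_int (i2 p))\<^sup>2 + (of_int (i3 p))\<^sup>2 - (of_int (i4 p))\<^sup>2" for p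
      by (simp add: resonance_def)
  qed
  have aw: "in_wt w (a t)" for t
    unfolding weight_1_square sob_weight_1[symmetric] by (rule a_facts)
  have qs: "(\<lambda>p. cmod (quad (a t) (a t) (a t) y p)) summable_on UNIV"
    if "\<And>n. cmod (y n) \<le> E.majorant (a t) n" for t y
  proof -
    note m = E.majorant[OF a_facts(4)[of t] aw]
    show ?thesis
    proof (rule E.dominated_quad(2)[OF m(1,2,5), where C = 1])
      fix p
      let ?P = "E.majorant (a t) (i1 p) * E.majorant (a t) (i2 p) * E.majorant (a t) (i3 p) * E.majorant (a t) (i4 p)"
      have "cmod (quad (a t) (a t) (a t) y p) \<le> ?P" by (intro E.norm_quad_le m that)
      also have "\<dots> \<le> (w (i1 p) + w (i2 p) + w (i3 p) + w (i4 p)) * ?P"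
        using W[of p] mult_right_mono[of 1 "w (i1 p) + w (i2 p) + w (i3 p) + w (i4 p)" ?P] m(5) by simp
      finally show "norm (quad (a t) (a t) (a t) y p) \<le> 1 * ((w (i1 p) + w (i2 p) + w (i3 p) + w (i4 p)) * ?P)"
        by simp
    qed simp
  qed
  have me: "E.modified_energy (a t) = (\<Sum>\<^sub>\<infinity>n. (of_int n)\<^sup>2 * (cmod (a t n))\<^sup>2) + 1 / 2 * Re (\<Sum>\<^sub>\<infinity>n. hartree_seq v (a t) n * cnj (a t n))" for t
    unfolding trilinear_form(3)[OF a_facts(4) qs[OF E.majorant(6)[OF a_facts(4) aw]]]
    by (simp add: E.modified_energy_def E.quartic_def)
  obtain K S where KS: "\<And>r. \<bar>r\<bar> \<le> \<bar>t\<bar> \<Longrightarrow> in_wt w (a r) \<and> l1_norm (a r) \<le> K \<and> wt_sum w (a r) \<le> S"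
    using local_bounds[of "\<bar>t\<bar>"] by blast
  have "((\<lambda>r. cst / 2 * Re (infsum (E.quartic_deriv (a r) (E.force r)) UNIV)) has_integral
    E.modified_energy (a (max 0 t)) - E.modified_energy (a (min 0 t))) {min 0 t..max 0 t}"
    by (rule E.modified_energy_has_integral[where K = K and S = S]) (auto intro!: KS)
  moreover have "Re (infsum (E.quartic_deriv (a r) (E.force r)) UNIV) = 0" for r
  proof -
    have "cmod (E.force r n) \<le> E.majorant (a r) n" for n
      using E.majorant(7)[OF a_facts(4) aw, of r n] by (simp add: norm_mult)
    from quartic_derivative_real_part[OF a_facts(4) refl qs[OF this]]
    show ?thesis by (simp add: E.quartic_deriv_def[abs_def])
  qed
  ultimately have "E.modified_energy (a (max 0 t)) - E.modified_energy (a (min 0 t)) = 0"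
    using has_integral_unique has_integral_0 by fastforce
  then show ?thesis unfolding me[symmetric] by (auto simp: max_def min_def split: if_splits)
qed

definition "H1_bound = 2 * pi * mass \<Phi> + 4 * pi * energy V \<Phi>"

text \<open>Mass gives the sum of squares; the kinetic sum at time \<open>t\<close> is bounded by
  the conserved energy after the nonnegative potential part is dropped.\<close>

lemma H1_bound: "wt_sum (sob_weight 1) (a t) \<le> H1_bound"
proof -
  have s1: "(\<lambda>n. (of_int n)\<^sup>2 * (cmod (a t n))\<^sup>2) summable_on UNIV"
    by (rule wt_mono(1)[OF a_facts(3), where C = 1]) (auto simp: sob_weight_1)
  have "wt_sum (sob_weight 1) (a t) = (\<Sum>\<^sub>\<infinity>n. (cmod (a t n))\<^sup>2) + (\<Sum>\<^sub>\<infinity>n. (of_int n)\<^sup>2 * (cmod (a t n))\<^sup>2)"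
    unfolding wt_sum_def sob_weight_1 distrib_right mult_1_left
    by (rule infsum_add[OF square_summable[OF a_facts(4)] s1])
  also have "(\<Sum>\<^sub>\<infinity>n. (cmod (a t n))\<^sup>2) = 2 * pi * mass \<Phi>"
    unfolding mass_conservation a_0
    using mass_eq[OF sobolev_space_facts(1)[OF \<Phi> s] refl sobolev_space_facts(4)[OF \<Phi> s]] by (simp add: field_simps)
  also have "(\<Sum>\<^sub>\<infinity>n. (of_int n)\<^sup>2 * (cmod (a t n))\<^sup>2) \<le> 4 * pi * energy V \<Phi>"
    using energy_conservation[of t] energy_identity(1)[OF \<Phi> s] energy_identity(2)[OF u_sob s, of t]
    unfolding a_0 a_def[symmetric] by linarith
  finally show ?thesis unfolding H1_bound_def by simp
qed

text \<open>An absorption argument: the correction and its accumulated change are small multiples of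
  the supremum \<open>S\<close> over [-T, T]. The choice of \<open>N\<close> makes their total at
  most \<open>S / 2\<close>, and taking the supremum on the left gives
  \<open>S \<le> 2 * A 0\<close>.\<close>

lemma weighted_bound:
  fixes T N :: real
  assumes N: "N\<^sup>2 = 1 + 4 * s\<^sup>2 * growth_const B s H1_bound * (1 + T)" "1 \<le> N" and t: "\<bar>t\<bar> \<le> T"
  shows "wt_sum (\<lambda>n. bracket_pow N s (of_int n)) (a t) \<le> 2 * wt_sum (\<lambda>n. bracket_pow N s (of_int n)) (a 0)"
proof -
  let ?\<theta> = "\<lambda>n::int. bracket_pow N (s / 2) (of_int n)" and ?g = "\<lambda>n::int. bracket_pow N s (of_int n)"
  let ?\<mu> = "2 * s\<^sup>2 / N\<^sup>2"
  have N0: "0 < N" using N(2) by simp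
  have T: "0 \<le> T" using t by linarith
  interpret subadd_weight ?\<theta> "2 powr s" by (rule sobolev_weight(1)[OF N0 s])
  have w: "w n = ?g n" for n by (rule sobolev_weight(2)[OF N0 s])
  interpret E: weighted_flow v B a ?\<theta> "2 powr s" ?g "energy_mult ?g" ?\<mu>
  proof unfold_locales
    show "\<bar>?g n\<bar> \<le> w n" for n unfolding w by (simp add: bracket_pow_def)
    show "\<bar>energy_mult ?g p\<bar> \<le> ?\<mu> * (w (i1 p) + w (i2 p) + w (i3 p) + w (i4 p))" for p
      unfolding w by (rule sobolev_energy_mult(1)[OF N0 s])
    show "energy_mult ?g p * resonance p = ?g (i1 p) - ?g (i2 p) + ?g (i3 p) - ?g (i4 p)" for p
      by (rule sobolev_energy_mult(2)[OF N0 s])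
  qed
  define A where "A r = wt_sum ?g (a r)" for r
  have A0: "0 \<le> A r" for r unfolding A_def by (rule wt_sum_nonneg) (simp add: bracket_pow_def)
  have g_le: "?g n \<le> 1 * sob_weight s n" for n
  proof -
    have "(real_of_int n)\<^sup>2 / N\<^sup>2 \<le> (real_of_int n)\<^sup>2 / 1" using N(2) by (intro divide_left_mono) auto
    then show ?thesis unfolding bracket_pow_def mult_1_left using s by (intro powr_mono2) (auto simp: add_nonneg_nonneg)
  qed
  have g0: "0 \<le> ?g n" for n by (simp add: bracket_pow_def)
  note gw = wt_mono[OF a_facts(2) g_le g0]
  have aw: "in_wt w (a r)" for r unfolding w by (rule gw(1))
  have Aw: "A r = wt_sum w (a r)" for r unfolding A_def w ..
  define k where "k = embed_const * H1_bound"
  have h0: "0 \<le> H1_bound"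
    by (rule order.trans[OF wt_sum_nonneg H1_bound[of 0]]) (rule sob_weight_nonneg)
  have k0: "0 \<le> k" unfolding k_def by (intro mult_nonneg_nonneg embed_const_nonneg h0)
  define K where "K = sqrt k"
  have K2: "K\<^sup>2 = k" using k0 by (simp add: K_def)
  have K4: "K ^ 4 = k\<^sup>2" unfolding K2[symmetric] by simp
  have K3: "(K + B * K ^ 3)\<^sup>2 = k * (1 + B * k)\<^sup>2"
  proof -
    have "K + B * K ^ 3 = K * (1 + B * K\<^sup>2)" by (simp add: algebra_simps power2_eq_square power3_eq_cube)
    then show ?thesis by (simp only: power_mult_distrib K2)
  qed
  have aK: "l1_norm (a r) \<le> K" for r
    unfolding K_def
  proof (rule real_le_rsqrt)
    show "(l1_norm (a r))\<^sup>2 \<le> k"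
      using l1_embedding(2)[OF a_facts(3)[of r]] mult_left_mono[OF H1_bound[of r] embed_const_nonneg]
      unfolding k_def by linarith
  qed
  obtain C where C: "\<And>r. \<bar>r\<bar> \<le> T \<Longrightarrow> wt_sum (sob_weight s) (a r) \<le> C" using wt_locally_bounded by blast
  have AC: "A r \<le> C" if "\<bar>r\<bar> \<le> T" for r
    using gw(2)[of r] C[OF that] unfolding A_def by simp
  \<comment> \<open>Finite by the local bound \<open>C\<close>; otherwise \<open>S / 2\<close> could
    not be subtracted in the end.\<close>
  define S where "S = Sup (A ` {- T..T})"
  have bdd: "bdd_above (A ` {- T..T})"
    by (rule bdd_aboveI2[where M = C]) (auto intro: AC simp: abs_le_iff)
  have AS: "A r \<le> S" if "\<bar>r\<bar> \<le> T" for r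
    unfolding S_def by (rule cSUP_upper[OF _ bdd]) (use that in auto)
  have S0: "0 \<le> S" using AS[of 0] A0[of 0] T by simp
  let ?L = "2 powr s"
  have me: "\<bar>E.modified_energy (a r) - A r\<bar> \<le> 6 * ?\<mu> * B * ?L\<^sup>2 * k * S" if "\<bar>r\<bar> \<le> T" for r
  proof -
    have "\<bar>Re (infsum (E.quartic (a r)) UNIV)\<bar> \<le> ?\<mu> * B * (12 * ?L\<^sup>2 * (wt_sum w (a r) * (l1_norm (a r))\<^sup>2))"
      using E.quartic_bound(2)[OF a_facts(4) aw, of r] abs_Re_le_cmod order.trans by blast
    also have "\<dots> \<le> ?\<mu> * B * (12 * ?L\<^sup>2 * (S * K\<^sup>2))"
      using B_nonneg S0 AS[OF that] A0[of r] unfolding Aw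
      by (intro mult_left_mono mult_mono power_mono aK l1_norm_nonneg) auto
    finally have q: "\<bar>Re (infsum (E.quartic (a r)) UNIV)\<bar> \<le> ?\<mu> * B * (12 * ?L\<^sup>2 * (S * k))" unfolding K2 .
    have "\<bar>cst / 2 * Re (infsum (E.quartic (a r)) UNIV)\<bar> \<le> 1 / 2 * (?\<mu> * B * (12 * ?L\<^sup>2 * (S * k)))"
      unfolding abs_mult using cst q by (intro mult_mono) auto
    moreover have "E.modified_energy (a r) - A r = cst / 2 * Re (infsum (E.quartic (a r)) UNIV)"
      by (simp add: E.modified_energy_def A_def wt_sum_def)
    moreover have "1 / 2 * (?\<mu> * B * (12 * ?L\<^sup>2 * (S * k))) = 6 * ?\<mu> * B * ?L\<^sup>2 * k * S"
      by (simp add: mult_ac)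
    ultimately show ?thesis by (simp only:)
  qed
  have mb: "E.majorant_bound K S = 24 * ?L\<^sup>2 * (1 + 10 * ?L ^ 4 * B\<^sup>2 * k\<^sup>2) * (k * (1 + B * k)\<^sup>2) * S"
    unfolding E.majorant_bound_def K3 K4 by (simp add: mult_ac)
  have mb0: "0 \<le> E.majorant_bound K S"
    unfolding mb using S0 k0 by (intro mult_nonneg_nonneg add_nonneg_nonneg) auto
  have chg: "\<bar>E.modified_energy (a r) - E.modified_energy (a 0)\<bar> \<le> 2 * ?\<mu> * B * E.majorant_bound K S * T" if r: "\<bar>r\<bar> \<le> T" for r
  proof -
    have "\<bar>E.modified_energy (a (max 0 r)) - E.modified_energy (a (min 0 r))\<bar> \<le> 2 * ?\<mu> * B * E.majorant_bound K S * (max 0 r - min 0 r)"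
    proof (rule E.modified_energy_change)
      fix x assume "x \<in> {min 0 r..max 0 r}"
      then have "\<bar>x\<bar> \<le> T" using r by auto
      then show "in_wt w (a x) \<and> l1_norm (a x) \<le> K \<and> wt_sum w (a x) \<le> S"
        using aw aK AS Aw by simp
    qed simp
    also have "\<dots> \<le> 2 * ?\<mu> * B * E.majorant_bound K S * T"
      using r B_nonneg mb0 by (intro mult_left_mono mult_nonneg_nonneg) auto
    finally show ?thesis by (auto simp: max_def min_def split: if_splits)
  qed
  have "A r \<le> A 0 + S / 2" if r: "\<bar>r\<bar> \<le> T" for r
  proof -
    have z: "\<bar>0\<bar> \<le> T" using T by simp
    have "A r \<le> A 0 + (2 * (6 * ?\<mu> * B * ?L\<^sup>2 * k * S) + 2 * ?\<mu> * B * E.majorant_bound K S * T)"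
      using me[OF r] me[OF z] chg[OF r] by linarith
    also have "2 * (6 * ?\<mu> * B * ?L\<^sup>2 * k * S) + 2 * ?\<mu> * B * E.majorant_bound K S * T
      = ?\<mu> * (12 * B * ?L\<^sup>2 * k + 48 * B * ?L\<^sup>2 * (1 + 10 * ?L ^ 4 * B\<^sup>2 * k\<^sup>2) * (k * (1 + B * k)\<^sup>2) * T) * S"
      unfolding mb by (simp add: algebra_simps)
    also have "\<dots> \<le> ?\<mu> * (growth_const B s H1_bound * (1 + T)) * S"
    proof (intro mult_right_mono mult_left_mono S0)
      let ?x = "12 * B * ?L\<^sup>2 * k" and ?y = "48 * B * ?L\<^sup>2 * (1 + 10 * ?L ^ 4 * B\<^sup>2 * k\<^sup>2) * (k * (1 + B * k)\<^sup>2)"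
      have "0 \<le> ?x * T" "0 \<le> ?y" using B_nonneg k0 T
        by (intro mult_nonneg_nonneg add_nonneg_nonneg zero_le_power2 zero_le_power; simp)+
      moreover have "growth_const B s H1_bound = ?x + ?y" by (simp add: growth_const_def k_def)
      ultimately show "?x + ?y * T \<le> growth_const B s H1_bound * (1 + T)" by (simp add: algebra_simps)
    qed simp
    \<comment> \<open>The defining equation of \<open>N\<close> was chosen for this: 4 s^2 times the
      growth constant times 1 + T is at most \<open>N\<^sup>2\<close>.\<close>
    also have "?\<mu> * (growth_const B s H1_bound * (1 + T)) * S \<le> 1 / 2 * S"
    proof (rule mult_right_mono[OF _ S0])
      have "4 * s\<^sup>2 * growth_const B s H1_bound * (1 + T) \<le> N\<^sup>2" unfolding N(1) by simp
      then show "?\<mu> * (growth_const B s H1_bound * (1 + T)) \<le> 1 / 2"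
        using N0 by (simp add: field_simps)
    qed
    finally show ?thesis by simp
  qed
  then have "S \<le> A 0 + S / 2"
    unfolding S_def by (intro cSUP_least) (use T in \<open>auto simp: abs_le_iff S_def\<close>)
  then have "S \<le> 2 * A 0" by simp
  then show ?thesis using AS[OF t] unfolding A_def by linarith
qed

text \<open>\<open>N\<close> is adapted to T = |t|. The scaled weight lies below the Sobolev weight,
  which in turn is at most N^(2s) times the scaled one, and \<open>N\<^sup>2\<close> is at most a
  constant times 1 + |t|. The square root halves the exponent s.\<close>

lemma sobolev_growth:
  "sobolev_norm s (u t) \<le> sqrt 2 * (1 + 4 * s\<^sup>2 * growth_const B s H1_bound) powr (s / 2) * (1 + \<bar>t\<bar>) powr (s / 2) * sobolev_norm s \<Phi>"
proof -
  let ?R = "growth_const B s H1_bound"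
  have h0: "0 \<le> H1_bound"
    by (rule order.trans[OF wt_sum_nonneg H1_bound[of 0]]) (rule sob_weight_nonneg)
  have R0: "0 \<le> ?R" by (rule growth_const_nonneg[OF B_nonneg h0])
  define N where "N = sqrt (1 + 4 * s\<^sup>2 * ?R * (1 + \<bar>t\<bar>))"
  have p: "0 \<le> 4 * s\<^sup>2 * ?R * (1 + \<bar>t\<bar>)" using R0 by (intro mult_nonneg_nonneg) auto
  have N2: "N\<^sup>2 = 1 + 4 * s\<^sup>2 * ?R * (1 + \<bar>t\<bar>)" unfolding N_def using p by simp
  have N1: "1 \<le> N" unfolding N_def using p by simp
  let ?g = "\<lambda>n::int. bracket_pow N s (of_int n)"
  have g_le: "?g n \<le> 1 * sob_weight s n" for n
  proof -
    have "(real_of_int n)\<^sup>2 / N\<^sup>2 \<le> (real_of_int n)\<^sup>2 / 1" using N1 by (intro divide_left_mono) auto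
    then show ?thesis unfolding bracket_pow_def mult_1_left using s by (intro powr_mono2) (auto simp: add_nonneg_nonneg)
  qed
  have le_g: "sob_weight s n \<le> (N\<^sup>2) powr s * ?g n" for n
  proof -
    have N21: "1 \<le> N\<^sup>2" using N1 by simp
    have "N\<^sup>2 * (1 + (real_of_int n)\<^sup>2 / N\<^sup>2) = N\<^sup>2 + (real_of_int n)\<^sup>2"
      using N1 by (simp add: field_simps)
    then have "sob_weight s n \<le> (N\<^sup>2 * (1 + (real_of_int n)\<^sup>2 / N\<^sup>2)) powr s"
      unfolding bracket_pow_def using s N21 by (intro powr_mono2) (auto simp: add_nonneg_nonneg)
    then show ?thesis unfolding powr_mult bracket_pow_def .
  qed
  have g0: "0 \<le> ?g n" for n by (simp add: bracket_pow_def)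
  have gw: "in_wt ?g (a r)" "wt_sum ?g (a r) \<le> 1 * wt_sum (sob_weight s) (a r)" for r
    by (rule wt_mono[OF a_facts(2) g_le g0])+
  have "wt_sum (sob_weight s) (a t) \<le> (N\<^sup>2) powr s * wt_sum ?g (a t)"
    by (rule wt_mono(2)[OF gw(1) le_g sob_weight_nonneg])
  also have "\<dots> \<le> (N\<^sup>2) powr s * (2 * wt_sum ?g (a 0))"
    by (intro mult_left_mono weighted_bound[OF N2 N1]) auto
  also have "\<dots> \<le> (N\<^sup>2) powr s * (2 * wt_sum (sob_weight s) (a 0))"
    using gw(2)[of 0] by (intro mult_left_mono) auto
  also have "\<dots> \<le> ((1 + 4 * s\<^sup>2 * ?R) * (1 + \<bar>t\<bar>)) powr s * (2 * wt_sum (sob_weight s) (a 0))"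
  proof (intro mult_right_mono powr_mono2)
    show "N\<^sup>2 \<le> (1 + 4 * s\<^sup>2 * ?R) * (1 + \<bar>t\<bar>)" unfolding N2 by (simp add: algebra_simps)
  qed (use s wt_sum_nonneg[OF sob_weight_nonneg] in auto)
  finally have le: "wt_sum (sob_weight s) (a t) \<le> 2 * ((1 + 4 * s\<^sup>2 * ?R) powr s * (1 + \<bar>t\<bar>) powr s) * wt_sum (sob_weight s) (a 0)"
    unfolding powr_mult by (simp add: mult_ac)
  have sq: "sqrt (x powr s) = x powr (s / 2)" if "0 \<le> x" for x :: real
    using that powr_half_sqrt[of "x powr s"] by (simp add: powr_powr)
  have "sobolev_norm s (u t) = sqrt (wt_sum (sob_weight s) (a t))"
    unfolding sobolev_norm_eq a_def ..
  also have "\<dots> \<le> sqrt (2 * ((1 + 4 * s\<^sup>2 * ?R) powr s * (1 + \<bar>t\<bar>) powr s) * wt_sum (sob_weight s) (a 0))"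
    using le by (rule real_sqrt_le_mono)
  also have "\<dots> = sqrt 2 * (1 + 4 * s\<^sup>2 * ?R) powr (s / 2) * (1 + \<bar>t\<bar>) powr (s / 2) * sobolev_norm s \<Phi>"
    using R0 by (simp add: real_sqrt_mult sq sobolev_norm_eq a_0)
  finally show ?thesis .
qed

end

theorem theorem1p2:
  fixes V :: "real \<Rightarrow> real" and s :: real
  assumes V_L1: "V \<in> L1_circle"
    and V_nonneg: "AE x in circle_measure. 0 \<le> V x"
    and V_even: "AE x in circle_measure. V (- x) = V x"
    and s_ge_1: "1 \<le> s"
  shows "\<exists>\<epsilon>0>0. \<forall>\<epsilon>. 0 < \<epsilon> \<and> \<epsilon> < \<epsilon>0 \<longrightarrow>
    (\<exists>C :: real \<Rightarrow> real \<Rightarrow> real.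
       continuous_on ({0..} \<times> {0..}) (\<lambda>(E, M). C E M) \<and>
       (\<forall>E\<ge>0. \<forall>M\<ge>0. 0 < C E M) \<and>
       (\<forall>\<Phi>\<in>sobolev_space s. \<forall>u. hartree_solution V s \<Phi> u \<longrightarrow>
          (\<forall>t. sobolev_norm s (u t) \<le>
             C (energy V \<Phi>) (mass \<Phi>) * (1 + \<bar>t\<bar>) powr (s / 2 + \<epsilon>) * sobolev_norm s \<Phi>)))"
proof -
  interpret hartree_potential V by unfold_locales (fact V_L1 V_nonneg V_even)+
  define \<beta> where "\<beta> = (LINT x|circle_measure. \<bar>V x\<bar>)"
  have \<beta>: "0 \<le> \<beta>" unfolding \<beta>_def by (intro integral_nonneg_AE) auto
  \<comment> \<open>The argument of \<open>growth_const\<close> is \<open>H1_bound\<close> as a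
    function of energy and mass; \<open>\<beta>\<close> is the L^1 norm of V.\<close>
  define C where "C E M = sqrt 2 * (1 + 4 * s\<^sup>2 * growth_const \<beta> s (2 * pi * M + 4 * pi * E)) powr (s / 2)" for E M
  have pos: "0 < 1 + 4 * s\<^sup>2 * growth_const \<beta> s (2 * pi * M + 4 * pi * E)" if "0 \<le> E" "0 \<le> M" for E M
  proof -
    have "0 \<le> growth_const \<beta> s (2 * pi * M + 4 * pi * E)"
      by (rule growth_const_nonneg[OF \<beta>]) (use that in simp)
    then show ?thesis by (intro add_pos_nonneg mult_nonneg_nonneg) auto
  qed
  \<comment> \<open>Continuity of \<open>powr\<close> is used where its base is positive, which
    \<open>pos\<close> ensures on the closed quadrant.\<close>
  have cont: "continuous_on ({0..} \<times> {0..}) (\<lambda>(E, M). C E M)"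
    unfolding C_def case_prod_unfold growth_const_def
    by (intro continuous_intros; use pos in \<open>force simp: growth_const_def\<close>)
  have Cpos: "0 < C E M" if "0 \<le> E" "0 \<le> M" for E M
    using pos[OF that] unfolding C_def by (auto intro!: mult_pos_pos)
  have bound: "sobolev_norm s (u t) \<le> C (energy V \<Phi>) (mass \<Phi>) * (1 + \<bar>t\<bar>) powr (s / 2 + \<epsilon>) * sobolev_norm s \<Phi>"
    if \<epsilon>: "0 < \<epsilon>" and \<Phi>: "\<Phi> \<in> sobolev_space s" and u: "hartree_solution V s \<Phi> u" for \<epsilon> \<Phi> u t
  proof -
    interpret hartree_sol V s \<Phi> u by unfold_locales (fact s_ge_1 \<Phi> u)+
    have "sobolev_norm s (u t) \<le> C (energy V \<Phi>) (mass \<Phi>) * (1 + \<bar>t\<bar>) powr (s / 2) * sobolev_norm s \<Phi>"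
      using sobolev_growth[of t] unfolding C_def H1_bound_def B_def \<beta>_def .
    also have "\<dots> \<le> C (energy V \<Phi>) (mass \<Phi>) * (1 + \<bar>t\<bar>) powr (s / 2 + \<epsilon>) * sobolev_norm s \<Phi>"
    proof (intro mult_right_mono mult_left_mono powr_mono)
      show "0 \<le> C (energy V \<Phi>) (mass \<Phi>)" unfolding C_def by simp
      show "0 \<le> sobolev_norm s \<Phi>" unfolding sobolev_norm_eq by (simp add: wt_sum_nonneg sob_weight_nonneg)
    qed (use \<epsilon> in auto)
    finally show ?thesis .
  qed
  show ?thesis
    \<comment> \<open>The threshold 1 is arbitrary: as 1 + |t| is at least 1, a larger exponent only
      weakens the bound.\<close>
    using cont Cpos bound by (intro exI[of _ 1]) (auto intro!: exI[of _ C])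
qed

end
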